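(* Let $\Omega\subset\mathbb{R}^n$ be an open and bounded domain with Lipschitz boundary, let $s\in(0,1)$, and let $G$ be a Young function satisfying $$\int_1^\infty\left(\frac{t}{G(t)}\right)^{\frac{s}{n-s}}dt=\infty,\qquad \int_0^1\left(\frac{t}{G(t)}\right)^{\frac{s}{n-s}}dt<\infty.$$ For each $\alpha>0$ there exists $u_\alpha\in W^s_0L^G(\Omega)$, one-signed in $\Omega$, with $\mathcal{J}(u_\alpha)=\alpha$ and $$\Lambda_\alpha:=\mathcal{F}(u_\alpha)=\min\{\mathcal{F}(u): u\in W^s_0L^G(\Omega),\ \mathcal{J}(u)=\alpha\}.$$
   Context: A Young function is a map $G:[0,\infty)\to[0,\infty)$ of the form $G(t)=\int_0^t g(\tau)\,d\tau$, where $g:[0,\infty)\to[0,\infty)$ is right continuous, nondecreasing on $(0,\infty)$, $g(0)=0$, $g(t)>0$ for $t>0$, and $\lim_{t\to\infty}g(t)=\infty$. No $\Delta_2$ (doubling) condition is assumed. Its complementary function is $\tilde G(t)=\sup\{tw-G(w):w>0\}$. For a measure space $(X,\nu)$, $K^G(X,\nu)$ is the set of measurable $u$ with $\int_X G(|u|)\,d\nu<\infty$; $L^G(X,\nu)$ is its linear hull, normed by $\|u\|_G=\inf\{\lambda>0:\int_X G(|u|/\lambda)\,d\nu\le1\}$; $E^G(X,\nu)$ is the closure in $L^G(X,\nu)$ of the bounded measurable functions (supported on sets of finite measure if $\nu(X)=\infty$). On $\Omega$ one uses Lebesgue measure. One has $(E^{\tilde G})'=L^G$. Set $D_su(x,y)=\frac{u(x)-u(y)}{|x-y|^s}$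 and $d\mu=\frac{dx\,dy}{|x-y|^n}$ on $\mathbb{R}^n\times\mathbb{R}^n$. $W^sL^G(\Omega)$ is the space of measurable functions $u$ on $\mathbb{R}^n$ with $u|_\Omega\in L^G(\Omega)$ and $D_su\in L^G(\mathbb{R}^n\times\mathbb{R}^n,d\mu)$, with norm $\|u\|_{s,G}=\|u\|_G+[u]_{s,G}$, where $[u]_{s,G}=\inf\{\lambda>0:\iint G(|D_su|/\lambda)\,d\mu\le1\}$. Via $u\mapsto(u,D_su)$ it is regarded as a subspace of $L^G(\Omega)\times L^G(\mathbb{R}^n\times\mathbb{R}^n,d\mu)$, the dual of $E^{\tilde G}(\Omega)\times E^{\tilde G}(\mathbb{R}^n\times\mathbb{R}^n,d\mu)$; weak* refers to this duality. $W^s_0L^G(\Omega)$ is the weak* closure of $C_c^\infty(\Omega)$ (functions extended by zero outside $\Omega$) in $W^sL^G(\Omega)$. $\mathcal{F}(u)=\iint_{\mathbb{R}^n\times\mathbb{R}^n}G(|D_su|)\,d\mu$ and $\mathcal{J}(u)=\int_\Omega G(|u|)\,dx$. "One-signed in $\Omega$" means $u\ge0$ a.e. in $\Omega$ or $u\le0$ a.e. in $\Omega$. *)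

theory Defs
  imports "HOL-Analysis.Analysis"
begin

section \<open>Lipschitz domains and test functions\<close>

text \<open>Near each boundary point the set lies on one side of the graph of a Lipschitz function.
  The unit vector \<open>e\<close> plays the role of the last axis of a rotated Cartesian coordinate system,
  and \<open>x - (x \<bullet> e) *\<^sub>R e\<close> is the vector of the remaining coordinates of \<open>x\<close>. In dimension one the
  hyperplane is \<open>{0}\<close> and the graph is a point.\<close>

definition lipschitz_boundary :: "'a::euclidean_space set \<Rightarrow> bool" where
  "lipschitz_boundary \<Omega> \<longleftrightarrow>
    (\<forall>p \<in> frontier \<Omega>. \<exists>r>0. \<exists>e \<gamma> L. norm e = 1 \<and>
      L-lipschitz_on {y. y \<bullet> e = 0} (\<gamma> :: 'a \<Rightarrow> real) \<and>
      \<Omega> \<inter> ball p r = {x \<in> ball p r. x \<bullet> e > \<gamma> (x - (x \<bullet> e) *\<^sub>R e)})"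

primrec C_k :: "nat \<Rightarrow> ('a::euclidean_space \<Rightarrow> real) \<Rightarrow> bool" where
  "C_k 0 f \<longleftrightarrow> continuous_on UNIV f"
| "C_k (Suc k) f \<longleftrightarrow>
    f differentiable_on UNIV \<and> (\<forall>b \<in> Basis. C_k k (\<lambda>x. frechet_derivative f (at x) b))"

definition test_functions :: "'a::euclidean_space set \<Rightarrow> ('a \<Rightarrow> real) set" where
  "test_functions \<Omega> =
    {\<phi>. (\<forall>k. C_k k \<phi>) \<and> compact (closure {x. \<phi> x \<noteq> 0}) \<and> closure {x. \<phi> x \<noteq> 0} \<subseteq> \<Omega>}"

section \<open>Young functions and Orlicz spaces\<close>

text \<open>Young functions live on \<open>[0, \<infinity>)\<close>; their values at negative arguments are irrelevant
  throughout.\<close>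

definition young_function :: "(real \<Rightarrow> real) \<Rightarrow> bool" where
  "young_function G \<longleftrightarrow>
    (\<exists>g. (\<forall>t\<ge>0. continuous (at_right t) g) \<and> mono_on {0<..} g \<and> g 0 = 0 \<and> (\<forall>t>0. g t > 0) \<and>
         filterlim g at_top at_top \<and> (\<forall>t\<ge>0. G t = integral {0..t} g))"

text \<open>For a Young function \<open>G\<close> the supremum is finite at every \<open>t \<ge> 0\<close>, because \<open>G w / w\<close> tends to
  infinity.\<close>

definition complementary :: "(real \<Rightarrow> real) \<Rightarrow> real \<Rightarrow> real" where
  "complementary G t = (SUP w \<in> {0<..}. t * w - G w)"

definition orlicz_modular :: "(real \<Rightarrow> real) \<Rightarrow> 'b measure \<Rightarrow> ('b \<Rightarrow> real) \<Rightarrow> ennreal" where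
  "orlicz_modular G M u = (\<integral>\<^sup>+ x. ennreal (G \<bar>u x\<bar>) \<partial>M)"

text \<open>All function spaces consist of functions rather than of classes modulo null sets.\<close>

definition orlicz_class :: "(real \<Rightarrow> real) \<Rightarrow> 'b measure \<Rightarrow> ('b \<Rightarrow> real) set" where
  "orlicz_class G M = {u \<in> borel_measurable M. orlicz_modular G M u < \<infinity>}"

text \<open>The linear hull of the Orlicz class.\<close>

definition orlicz_space :: "(real \<Rightarrow> real) \<Rightarrow> 'b measure \<Rightarrow> ('b \<Rightarrow> real) set" where
  "orlicz_space G M =
    {u. \<exists>(k::nat) c f. (\<forall>i<k. f i \<in> orlicz_class G M) \<and> u = (\<lambda>x. \<Sum>i<k. c i * f i x)}"

definition luxemburg_norm :: "(real \<Rightarrow> real) \<Rightarrow> 'b measure \<Rightarrow> ('b \<Rightarrow> real) \<Rightarrow> real" where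
  "luxemburg_norm G M u = Inf {l. l > 0 \<and> orlicz_modular G M (\<lambda>x. u x / l) \<le> 1}"

text \<open>The requirement on the support holds automatically if the whole space has finite measure.\<close>

definition orlicz_heart :: "(real \<Rightarrow> real) \<Rightarrow> 'b measure \<Rightarrow> ('b \<Rightarrow> real) set" where
  "orlicz_heart G M =
    {u \<in> orlicz_space G M. \<forall>\<epsilon>>0. \<exists>v \<in> borel_measurable M.
       bounded (v ` space M) \<and> emeasure M {x \<in> space M. v x \<noteq> 0} < \<infinity> \<and>
       luxemburg_norm G M (\<lambda>x. u x - v x) < \<epsilon>}"

text \<open>The weak* topology of \<open>L\<^sup>G(M) \<times> L\<^sup>G(N)\<close> as the dual of the product of the spaces
  \<open>E\<close> of the complementary function: the initial topology for all pairings with elements of that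
  product. The pairings are finite by Hoelder's inequality.\<close>

definition orlicz_pairing ::
  "'b measure \<Rightarrow> 'c measure \<Rightarrow> ('b \<Rightarrow> real) \<times> ('c \<Rightarrow> real) \<Rightarrow> ('b \<Rightarrow> real) \<times> ('c \<Rightarrow> real) \<Rightarrow> real" where
  "orlicz_pairing M N w z = (\<integral>x. fst w x * fst z x \<partial>M) + (\<integral>y. snd w y * snd z y \<partial>N)"

definition orlicz_weak_star ::
  "(real \<Rightarrow> real) \<Rightarrow> 'b measure \<Rightarrow> 'c measure \<Rightarrow> (('b \<Rightarrow> real) \<times> ('c \<Rightarrow> real)) topology" where
  "orlicz_weak_star G M N =
    (let E = orlicz_heart (complementary G) M \<times> orlicz_heart (complementary G) N in
     pullback_topology (orlicz_space G M \<times> orlicz_space G N)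
       (\<lambda>w. restrict (orlicz_pairing M N w) E) (product_topology (\<lambda>_. euclideanreal) E))"

section \<open>Fractional Orlicz--Sobolev spaces\<close>

definition frac_quot :: "real \<Rightarrow> ('a::euclidean_space \<Rightarrow> real) \<Rightarrow> 'a \<times> 'a \<Rightarrow> real" where
  "frac_quot s u = (\<lambda>(x, y). (u x - u y) / norm (x - y) powr s)"

text \<open>The diagonal, where the density is \<open>1 / 0 = 0\<close>, is a Lebesgue null set.\<close>

definition frac_measure :: "('a::euclidean_space \<times> 'a) measure" where
  "frac_measure = density lebesgue (\<lambda>(x, y). ennreal (1 / norm (x - y) ^ DIM('a)))"

definition frac_space ::
  "real \<Rightarrow> (real \<Rightarrow> real) \<Rightarrow> 'a::euclidean_space set \<Rightarrow> ('a \<Rightarrow> real) set" where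
  "frac_space s G \<Omega> =
    {u \<in> borel_measurable lebesgue.
       u \<in> orlicz_space G (lebesgue_on \<Omega>) \<and> frac_quot s u \<in> orlicz_space G frac_measure}"

definition frac_weak_star ::
  "real \<Rightarrow> (real \<Rightarrow> real) \<Rightarrow> 'a::euclidean_space set \<Rightarrow> ('a \<Rightarrow> real) topology" where
  "frac_weak_star s G \<Omega> =
    pullback_topology (frac_space s G \<Omega>) (\<lambda>u. (u, frac_quot s u))
      (orlicz_weak_star G (lebesgue_on \<Omega>) frac_measure)"

definition frac_space_0 ::
  "real \<Rightarrow> (real \<Rightarrow> real) \<Rightarrow> 'a::euclidean_space set \<Rightarrow> ('a \<Rightarrow> real) set" where
  "frac_space_0 s G \<Omega> = frac_weak_star s G \<Omega> closure_of test_functions \<Omega>"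

text \<open>Without a doubling condition both functionals may be infinite.\<close>

definition energy_F :: "real \<Rightarrow> (real \<Rightarrow> real) \<Rightarrow> ('a::euclidean_space \<Rightarrow> real) \<Rightarrow> ennreal" where
  "energy_F s G u = orlicz_modular G frac_measure (frac_quot s u)"

definition energy_J ::
  "(real \<Rightarrow> real) \<Rightarrow> 'a::euclidean_space set \<Rightarrow> ('a \<Rightarrow> real) \<Rightarrow> ennreal" where
  "energy_J G \<Omega> u = orlicz_modular G (lebesgue_on \<Omega>) u"

definition one_signed :: "'a::euclidean_space set \<Rightarrow> ('a \<Rightarrow> real) \<Rightarrow> bool" where
  "one_signed \<Omega> u \<longleftrightarrow> (AE x in lebesgue_on \<Omega>. u x \<ge> 0) \<or> (AE x in lebesgue_on \<Omega>. u x \<le> 0)"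

end

theory Submission
  imports Defs "HOL-Complex_Analysis.Great_Picard"
begin

text \<open>The direct method. Three elementary observations, none of which needs an Orlicz--Sobolev embedding,
  make it work.

  Compactness: \<open>t \<le> G t + c\<close> turns an energy bound into a uniform modulus of continuity in the mean, so
  minimizing sequences are relatively compact in \<open>L\<^sup>1\<close>.

  No loss of mass in the constraint: where \<open>\<bar>u\<bar>\<close> is large, half of a small ball of radius \<open>r\<close> lies in the
  set where \<open>\<bar>u\<bar>\<close> is at most half as large. Hence the energy controls \<open>\<integral> G(\<bar>u\<bar> / (2 r\<^sup>s))\<close> over that part, and
  by convexity \<open>G(\<bar>u\<bar>)\<close> is uniformly integrable.

  Admissibility of \<open>\<bar>u\<bar>\<close> and of limits: the weak* closure of the test functions consists of all functions
  of the space that vanish outside \<open>\<Omega>\<close>. One inclusion follows by pairing with suitable test pairs. For the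
  other one, exterior balls at the Lipschitz boundary give Hardy's inequality, which keeps the modulars of
  functions cut off near the boundary bounded; mollification does not increase the modulars, by Jensen's
  inequality. An almost everywhere limit with bounded modulars is a weak* limit.\<close>

section \<open>Young functions\<close>

text \<open>Without a doubling condition \<open>G (2 * t)\<close> is not controlled by
  \<open>G t\<close>: finite energy need not survive scaling, and a constant lost in an estimate
  cannot be moved out of \<open>G\<close>. Hence bounds are stated for the modular of
  \<open>u / L\<close> at an explicit scale, and losses enlarge the scale (\<open>2 * L\<close>,
  \<open>24 * L\<close>). This is harmless for weak* convergence, which only asks for a bound at
  some scale, but it would ruin the constraint, which lives at scale one. There the estimate gains
  instead of losing: convexity gives \<open>G t \<le> p * G (t / p)\<close> for small
  \<open>p\<close>, and \<open>p\<close> is a power of a radius at our disposal.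

  Membership in the weak* closure is obtained from sequences that converge almost everywhere with
  bounded modulars. This suffices because the topology tests only against the heart, whose elements
  are close in norm to bounded functions supported on sets of finite measure.

  The definitions use completed measures, whereas Fubini's theorem is applied on
  \<open>lborel\<close>; functions are therefore exchanged for Borel representatives before any
  double integral is estimated.\<close>

text \<open>The part of convexity that \<open>G\<close> and \<open>complementary G\<close> share, so
  that facts about modulars and Orlicz spaces are proved once for both.\<close>

definition orlicz_function :: "(real \<Rightarrow> real) \<Rightarrow> bool" where
  "orlicz_function \<Phi> \<longleftrightarrow> convex_on {0..} \<Phi> \<and> \<Phi> 0 = 0 \<and> (\<forall>t\<ge>0. 0 \<le> \<Phi> t)"

lemma orlicz_function_zero: "orlicz_function \<Phi> \<Longrightarrow> \<Phi> 0 = 0"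
  and orlicz_function_nonneg: "orlicz_function \<Phi> \<Longrightarrow> 0 \<le> t \<Longrightarrow> 0 \<le> \<Phi> t"
  by (auto simp: orlicz_function_def)

lemma orlicz_function_convexD:
  assumes "orlicz_function \<Phi>" "0 \<le> a" "0 \<le> b" "0 \<le> p" "p \<le> 1"
  shows "\<Phi> ((1 - p) * a + p * b) \<le> (1 - p) * \<Phi> a + p * \<Phi> b"
  using assms convex_onD[of "{0..}" \<Phi> p a b] by (simp add: orlicz_function_def)

lemma orlicz_function_scale:
  assumes "orlicz_function \<Phi>" "0 \<le> p" "p \<le> 1" "0 \<le> t"
  shows "\<Phi> (p * t) \<le> p * \<Phi> t"
  using orlicz_function_convexD[OF assms(1) order_refl assms(4) assms(2,3)] assms(1)
  by (simp add: orlicz_function_def)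

text \<open>Convexity puts the graph below its chord from the origin, and the chord to
  \<open>b\<close> is nonnegative.\<close>

lemma orlicz_function_mono:
  assumes \<Phi>: "orlicz_function \<Phi>" and "0 \<le> a" "a \<le> b"
  shows "\<Phi> a \<le> \<Phi> b"
proof (cases "b = 0")
  case True
  then show ?thesis using assms by simp
next
  case False
  then have b: "b > 0" using assms by auto
  have "\<Phi> (a / b * b) \<le> a / b * \<Phi> b"
    using assms b by (intro orlicz_function_scale) auto
  also have "\<dots> \<le> 1 * \<Phi> b"
    using assms b by (intro mult_right_mono orlicz_function_nonneg[OF \<Phi>]) auto
  finally show ?thesis using b by simp
qed

text \<open>Convexity at the midpoint of \<open>2 * a\<close> and \<open>2 * b\<close>. The doubling
  is paid inside the argument, since it cannot be taken out of \<open>\<Phi>\<close>.\<close>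

lemma orlicz_function_half_sum:
  assumes \<Phi>: "orlicz_function \<Phi>" and "0 \<le> a" "0 \<le> b" "0 \<le> c" "c \<le> a + b"
  shows "\<Phi> c \<le> \<Phi> (2 * a) / 2 + \<Phi> (2 * b) / 2"
proof -
  have "\<Phi> c \<le> \<Phi> ((1 - 1/2) * (2 * a) + (1/2) * (2 * b))"
    by (rule orlicz_function_mono[OF \<Phi>]) (use assms(2-) in simp_all)
  also have "\<dots> \<le> (1 - 1/2) * \<Phi> (2 * a) + (1/2) * \<Phi> (2 * b)"
    by (rule orlicz_function_convexD[OF \<Phi>]) (use assms(2-) in simp_all)
  finally show ?thesis by simp
qed

lemma borel_measurable_orlicz_function [measurable (raw)]:
  assumes \<Phi>: "orlicz_function \<Phi>" and [measurable]: "u \<in> borel_measurable M"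
  shows "(\<lambda>x. \<Phi> \<bar>u x\<bar>) \<in> borel_measurable M"
proof -
  \<comment> \<open>Values at negative arguments are arbitrary; \<open>max t 0\<close> replaces them
    by \<open>\<Phi> 0\<close> and makes the function monotone on the whole line, hence
    Borel.\<close>
  have "mono (\<lambda>t. \<Phi> (max t 0))"
    by (intro monoI orlicz_function_mono[OF \<Phi>]) auto
  then have [measurable]: "(\<lambda>t. \<Phi> (max t 0)) \<in> borel_measurable borel"
    by (rule borel_measurable_mono)
  have "(\<lambda>x. \<Phi> (max \<bar>u x\<bar> 0)) \<in> borel_measurable M"
    by measurable
  then show ?thesis by simp
qed

text \<open>The density \<open>g\<close> is a slope of a supporting line at every point. Convexity,
  continuity, growth and Jensen's inequality are all derived from this inequality instead of from
  the integral.\<close>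

lemma young_function_subgradient:
  assumes "young_function G"
  obtains g where "\<And>t. t > 0 \<Longrightarrow> 0 < g t" "g 0 = 0" "filterlim g at_top at_top"
    "\<And>a t. 0 \<le> a \<Longrightarrow> 0 \<le> t \<Longrightarrow> G t \<ge> G a + g a * (t - a)" "G 0 = 0"
proof -
  obtain g where g: "mono_on {0<..} g" "g 0 = 0" "\<forall>t>0. g t > 0"
      "filterlim g at_top at_top" and G: "\<forall>t\<ge>0. G t = integral {0..t} g"
    using assms unfolding young_function_def by blast
  \<comment> \<open>Monotonicity is given on the open half-line only; \<open>g 0 = 0\<close> extends
    it to the endpoint, so that \<open>g\<close> is integrable on intervals starting at
    zero.\<close>
  have mono: "mono_on {0..} g"
  proof (rule mono_onI)
    fix r s :: real assume "r \<in> {0..}" "s \<in> {0..}" "r \<le> s"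
    then consider "r = 0" "s = 0" | "r = 0" "s > 0" | "r > 0" "s > 0"
      by fastforce
    then show "g r \<le> g s"
    proof cases
      case 2
      then show ?thesis using g(2,3) by (auto intro: less_imp_le)
    next
      case 3
      then show ?thesis using monotone_onD[OF g(1), of r s] \<open>r \<le> s\<close> by simp
    qed simp
  qed
  have int: "g integrable_on {a..b}" if "0 \<le> a" for a b
    by (rule integrable_on_mono_on) (rule mono_on_subset[OF mono], use that in auto)
  have diff: "G b = G a + integral {a..b} g" if "0 \<le> a" "a \<le> b" for a b
    using Henstock_Kurzweil_Integration.integral_combine[of 0 a b g] that int[of 0 b] G by auto
  have "G t \<ge> G a + g a * (t - a)" if "0 \<le> a" "0 \<le> t" for a t
  proof (cases "a \<le> t")
    case True
    have "integral {a..t} (\<lambda>_. g a) \<le> integral {a..t} g"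
      by (rule integral_le) (use int[OF that(1)] that monotone_onD[OF mono] in auto)
    then show ?thesis using diff[OF that(1) True] True by (simp add: mult.commute)
  next
    case False
    have "integral {t..a} g \<le> integral {t..a} (\<lambda>_. g a)"
      by (rule integral_le) (use int[OF that(2)] that monotone_onD[OF mono] in auto)
    then show ?thesis using diff[OF that(2), of a] False by (simp add: algebra_simps)
  qed
  moreover have "G 0 = 0" using G by simp
  ultimately show ?thesis using g that by blast
qed

lemma young_function_orlicz:
  assumes "young_function G"
  shows "orlicz_function G"
proof -
  obtain g where g: "\<And>t. t > 0 \<Longrightarrow> 0 < g t" "g 0 = 0"
    "\<And>a t. 0 \<le> a \<Longrightarrow> 0 \<le> t \<Longrightarrow> G t \<ge> G a + g a * (t - a)" "G 0 = 0"
    using young_function_subgradient[OF assms] by metis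
  have "convex_on {0..} G"
  proof (rule convex_onI)
    fix t x y :: real
    assume t: "0 < t" "t < 1" and xy: "x \<in> {0..}" "y \<in> {0..}"
    define z where "z = (1 - t) *\<^sub>R x + t *\<^sub>R y"
    have z: "0 \<le> z" using t xy by (auto simp: z_def)
    have "(1 - t) * (G z + g z * (x - z)) + t * (G z + g z * (y - z)) \<le> (1 - t) * G x + t * G y"
      using t xy z by (intro add_mono mult_left_mono g(3)) auto
    moreover have "(1 - t) * (G z + g z * (x - z)) + t * (G z + g z * (y - z)) = G z"
      by (simp add: z_def algebra_simps)
    ultimately show "G ((1 - t) *\<^sub>R x + t *\<^sub>R y) \<le> (1 - t) * G x + t * G y"
      by (simp add: z_def)
  qed auto
  moreover have "0 \<le> G t" if "0 \<le> t" for t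
    using g(3)[of 0 t] g(2,4) that by simp
  ultimately show ?thesis using g(4) by (auto simp: orlicz_function_def)
qed

lemma young_function_superlinear:
  assumes "young_function G"
  obtains T where "T > 0" "\<And>t. t \<ge> T \<Longrightarrow> K * t \<le> G t"
proof -
  obtain g where g: "filterlim g at_top at_top"
    "\<And>a t. 0 \<le> a \<Longrightarrow> 0 \<le> t \<Longrightarrow> G t \<ge> G a + g a * (t - a)"
    using young_function_subgradient[OF assms(1)] by metis
  have "eventually (\<lambda>t. g t \<ge> 2 * \<bar>K\<bar>) at_top"
    using g(1) by (simp add: filterlim_at_top)
  then obtain T0 where T0: "\<And>t. t \<ge> T0 \<Longrightarrow> g t \<ge> 2 * \<bar>K\<bar>"
    by (auto simp: eventually_at_top_linorder)
  show ?thesis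
  proof (rule that[of "2 * max T0 1"])
    fix t assume t: "t \<ge> 2 * max T0 1"
    \<comment> \<open>The supporting line at \<open>t / 2\<close> is followed over the length
      \<open>t / 2\<close>, which explains the slope \<open>2 * \<bar>K\<bar>\<close> demanded of
      \<open>g\<close>.\<close>
    have "K * t \<le> 2 * \<bar>K\<bar> * (t - t/2)"
      using t by (auto intro: mult_right_mono)
    also have "\<dots> \<le> g (t/2) * (t - t/2)"
      using t T0[of "t/2"] by (intro mult_right_mono) auto
    also have "\<dots> \<le> G t - G (t/2)" using g(2)[of "t/2" t] t by (simp add: algebra_simps)
    also have "\<dots> \<le> G t"
      using orlicz_function_nonneg[OF young_function_orlicz[OF assms(1)], of "t/2"] t by simp
    finally show "K * t \<le> G t" .
  qed simp
qed

text \<open>This is the source of all bounds in the mean: on a set of finite measure a modular bound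
  controls the integral, up to \<open>B\<close> times the measure.\<close>

lemma young_function_affine_bound:
  assumes "young_function G" "K \<ge> 0"
  obtains B where "B \<ge> 0" "\<And>t. t \<ge> 0 \<Longrightarrow> K * t \<le> G t + B"
proof -
  obtain T where T: "T > 0" "\<And>t. t \<ge> T \<Longrightarrow> K * t \<le> G t"
    using young_function_superlinear[OF assms(1)] by metis
  show ?thesis
  proof (rule that[of "K * T"])
    show "0 \<le> K * T" using T assms by simp
    fix t :: real assume t: "t \<ge> 0"
    show "K * t \<le> G t + K * T"
    proof (cases "t \<ge> T")
      case True
      have "0 \<le> K * T" using T(1) assms(2) by simp
      with T(2)[OF True] show ?thesis by linarith
    next
      case False
      then have "K * t \<le> K * T" using assms by (intro mult_left_mono) auto
      then show ?thesis
        using orlicz_function_nonneg[OF young_function_orlicz[OF assms(1)] t] by linarith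
    qed
  qed
qed

text \<open>The supporting lines at two points bound the difference of the values from both sides,
  so \<open>G\<close> is Lipschitz on \<open>{0..<b}\<close> with constant
  \<open>g b\<close>.\<close>

lemma young_function_continuous:
  assumes "young_function G"
  shows "continuous_on {0..} G"
proof -
  obtain g where g: "\<And>t. t > 0 \<Longrightarrow> 0 < g t" "g 0 = 0"
    "\<And>a t. 0 \<le> a \<Longrightarrow> 0 \<le> t \<Longrightarrow> G t \<ge> G a + g a * (t - a)"
    using young_function_subgradient[OF assms] by metis
  have mono: "g a \<le> g b" if "0 \<le> a" "a < b" for a b
  proof -
    have "0 \<le> (g b - g a) * (b - a)"
      using g(3)[of a b] g(3)[of b a] that by (simp add: algebra_simps)
    then show ?thesis using that by (simp add: zero_le_mult_iff)
  qed
  have nn: "0 \<le> g a" if "0 \<le> a" for a using g(1)[of a] g(2) that by (cases "a = 0") auto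
  have lip: "\<bar>G x - G y\<bar> \<le> g b * \<bar>x - y\<bar>" if "0 \<le> x" "x < b" "0 \<le> y" "y < b" for x y b
  proof -
    have *: "G x - G y \<le> g b * \<bar>x - y\<bar>" if "0 \<le> x" "x < b" "0 \<le> y" for x y
    proof -
      have "G x - G y \<le> g x * (x - y)" using g(3)[of x y] that by (simp add: algebra_simps)
      also have "\<dots> \<le> g x * \<bar>x - y\<bar>" using nn[of x] that by (intro mult_left_mono) auto
      also have "\<dots> \<le> g b * \<bar>x - y\<bar>" using mono[of x b] that by (intro mult_right_mono) auto
      finally show ?thesis .
    qed
    show ?thesis using *[of x y] *[of y x] that by (simp add: abs_le_iff abs_minus_commute)
  qed
  show ?thesis unfolding continuous_on_def
  proof
    fix x :: real assume x: "x \<in> {0..}"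
    show "(G \<longlongrightarrow> G x) (at x within {0..})"
    proof (rule Lim_transform_bound[where g="\<lambda>y. g (x + 1) * \<bar>y - x\<bar>" and f="\<lambda>y. G y - G x", THEN LIM_zero_cancel])
      have "eventually (\<lambda>y. y < x + 1) (at x within {0..})"
        by (rule order_tendstoD(2)[OF tendsto_ident_at]) simp
      moreover have "eventually (\<lambda>y. y \<in> {0..}) (at x within {0..})"
        by (simp add: eventually_at_filter)
      ultimately show "\<forall>\<^sub>F y in at x within {0..}. norm (G y - G x) \<le> norm (g (x + 1) * \<bar>y - x\<bar>)"
        by eventually_elim (use lip[of _ "x+1" x] nn[of "x+1"] x in \<open>auto simp: abs_mult\<close>)
      show "((\<lambda>y. g (x + 1) * \<bar>y - x\<bar>) \<longlongrightarrow> 0) (at x within {0..})"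
        by (intro tendsto_eq_intros) auto
    qed
  qed
qed

lemma young_function_tendsto:
  assumes "young_function G" "(f \<longlongrightarrow> l) F"
  shows "((\<lambda>k. G \<bar>f k\<bar>) \<longlongrightarrow> G \<bar>l\<bar>) F"
  by (rule continuous_on_tendsto_compose[OF young_function_continuous[OF assms(1)]])
    (use assms in \<open>auto intro: tendsto_rabs\<close>)

text \<open>A real supremum carries information only over a set bounded above; superlinear growth of
  \<open>G\<close> provides the bound.\<close>

lemma complementary_bdd_above:
  assumes "young_function G"
  shows "bdd_above ((\<lambda>w. t * w - G w) ` {0<..})"
proof -
  obtain B where "\<And>w. w \<ge> 0 \<Longrightarrow> \<bar>t\<bar> * w \<le> G w + B"
    using young_function_affine_bound[OF assms, of "\<bar>t\<bar>"] by (metis abs_ge_zero)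
  then have "t * w - G w \<le> B" if "w > 0" for w
    using that mult_right_mono[of t "\<bar>t\<bar>" w] by (smt (verit))
  then show ?thesis by (auto simp: bdd_above_def)
qed

lemma young_inequality:
  assumes "young_function G" "0 \<le> w" "0 \<le> t"
  shows "t * w \<le> G w + complementary G t"
proof -
  have *: "t * w - G w \<le> complementary G t" if "w > 0" for w
    unfolding complementary_def using that by (intro cSUP_upper complementary_bdd_above assms) auto
  show ?thesis
  proof (cases "w = 0")
    case True
    \<comment> \<open>The supremum runs over positive \<open>w\<close>, so the value zero is reached
      as a limit from the right.\<close>
    have "((\<lambda>w. t * w - G w) \<longlongrightarrow> t * 0 - G 0) (at 0 within {0..})"
      using young_function_continuous[OF assms(1)]
      by (intro tendsto_intros) (auto simp: continuous_on_def)
    then have "((\<lambda>w. t * w - G w) \<longlongrightarrow> t * 0 - G 0) (at_right 0)"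
      by (rule tendsto_within_subset) auto
    then have "t * 0 - G 0 \<le> complementary G t"
      by (rule tendsto_upperbound) (auto simp: eventually_at_right_less eventually_at_filter *)
    then show ?thesis using True by simp
  qed (use *[of w] assms in auto)
qed

text \<open>A supremum of affine functions of \<open>t\<close> is convex. Nonnegativity is Young's
  inequality at \<open>w = 0\<close>, and the value at zero is a supremum of the nonpositive numbers
  \<open>- G w\<close>.\<close>

lemma complementary_orlicz:
  assumes G: "young_function G"
  shows "orlicz_function (complementary G)"
proof -
  note GO = young_function_orlicz[OF G]
  have nn: "0 \<le> complementary G t" if "0 \<le> t" for t
    using young_inequality[OF G order_refl that] orlicz_function_zero[OF GO] by simp
  have "complementary G 0 \<le> 0"
    unfolding complementary_def
    by (rule cSUP_least) (auto intro: orlicz_function_nonneg[OF GO])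
  then have "complementary G 0 = 0" using nn[of 0] by simp
  moreover have "convex_on {0..} (complementary G)"
  proof (rule convex_onI)
    fix p x y :: real
    assume p: "0 < p" "p < 1" and xy: "x \<in> {0..}" "y \<in> {0..}"
    have "((1 - p) * x + p * y) * w - G w \<le> (1 - p) * complementary G x + p * complementary G y"
      if "w > 0" for w
    proof -
      have "((1 - p) * x + p * y) * w - G w = (1 - p) * (x * w - G w) + p * (y * w - G w)"
        by (simp add: algebra_simps)
      also have "\<dots> \<le> (1 - p) * complementary G x + p * complementary G y"
        using p xy young_inequality[OF G, of w x] young_inequality[OF G, of w y] that
        by (intro add_mono mult_left_mono) auto
      finally show ?thesis .
    qed
    then show "complementary G ((1 - p) *\<^sub>R x + p *\<^sub>R y) \<le> (1 - p) * complementary G x + p * complementary G y"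
      unfolding complementary_def[of G "(1 - p) *\<^sub>R x + p *\<^sub>R y"]
      by (intro cSUP_least) auto
  qed auto
  ultimately show ?thesis using nn by (auto simp: orlicz_function_def)
qed

section \<open>Modulars and Orlicz spaces\<close>

lemma orlicz_modular_mono:
  assumes \<Phi>: "orlicz_function \<Phi>" and "AE x in M. \<bar>u x\<bar> \<le> \<bar>v x\<bar>"
  shows "orlicz_modular \<Phi> M u \<le> orlicz_modular \<Phi> M v"
  unfolding orlicz_modular_def using assms(2)
  by (intro nn_integral_mono_AE) (auto elim!: eventually_mono intro!: ennreal_leI orlicz_function_mono[OF \<Phi>])

lemma orlicz_modular_cong:
  assumes "AE x in M. \<bar>u x\<bar> = \<bar>v x\<bar>"
  shows "orlicz_modular \<Phi> M u = orlicz_modular \<Phi> M v"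
  unfolding orlicz_modular_def using assms
  by (intro nn_integral_cong_AE) (auto elim!: eventually_mono)

lemma orlicz_modular_scale:
  assumes \<Phi>: "orlicz_function \<Phi>" and [measurable]: "u \<in> borel_measurable M" and p: "0 \<le> p" "p \<le> 1"
  shows "orlicz_modular \<Phi> M (\<lambda>x. p * u x) \<le> ennreal p * orlicz_modular \<Phi> M u"
proof -
  note [measurable] = borel_measurable_orlicz_function[OF \<Phi>]
  have "orlicz_modular \<Phi> M (\<lambda>x. p * u x) \<le> (\<integral>\<^sup>+x. ennreal p * ennreal (\<Phi> \<bar>u x\<bar>) \<partial>M)"
    unfolding orlicz_modular_def
    using p orlicz_function_scale[OF \<Phi> p] orlicz_function_nonneg[OF \<Phi>]
    by (intro nn_integral_mono) (auto simp: abs_mult ennreal_mult'[symmetric] intro!: ennreal_leI)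
  also have "\<dots> = ennreal p * orlicz_modular \<Phi> M u"
    unfolding orlicz_modular_def by (rule nn_integral_cmult) measurable
  finally show ?thesis .
qed

text \<open>The factor 2 on the left is kept for \<open>orlicz_modular_le_of_half_sum\<close>: it
  lets a common bound of both terms pass to \<open>w\<close> without growing, whereas
  \<open>orlicz_modular_sum_le\<close> gives it away.\<close>

lemma orlicz_modular_half_sum:
  assumes \<Phi>: "orlicz_function \<Phi>" and [measurable]: "u \<in> borel_measurable M" "v \<in> borel_measurable M"
    and le: "AE x in M. \<bar>w x\<bar> \<le> \<bar>u x\<bar> + \<bar>v x\<bar>" and w [measurable]: "w \<in> borel_measurable M"
  shows "2 * orlicz_modular \<Phi> M w \<le> orlicz_modular \<Phi> M (\<lambda>x. 2 * u x) + orlicz_modular \<Phi> M (\<lambda>x. 2 * v x)"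
proof -
  note [measurable] = borel_measurable_orlicz_function[OF \<Phi>]
  have "2 * orlicz_modular \<Phi> M w = (\<integral>\<^sup>+x. 2 * ennreal (\<Phi> \<bar>w x\<bar>) \<partial>M)"
    unfolding orlicz_modular_def by (rule nn_integral_cmult[symmetric]) measurable
  also have "\<dots> \<le> (\<integral>\<^sup>+x. ennreal (\<Phi> \<bar>2 * u x\<bar>) + ennreal (\<Phi> \<bar>2 * v x\<bar>) \<partial>M)"
  proof (intro nn_integral_mono_AE, use le in eventually_elim)
    case (elim x)
    have "\<Phi> \<bar>w x\<bar> \<le> \<Phi> (2 * \<bar>u x\<bar>) / 2 + \<Phi> (2 * \<bar>v x\<bar>) / 2"
      by (rule orlicz_function_half_sum[OF \<Phi>]) (use elim in auto)
    then have "2 * \<Phi> \<bar>w x\<bar> \<le> \<Phi> \<bar>2 * u x\<bar> + \<Phi> \<bar>2 * v x\<bar>"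
      by (simp add: abs_mult)
    then have "ennreal (2 * \<Phi> \<bar>w x\<bar>) \<le> ennreal (\<Phi> \<bar>2 * u x\<bar> + \<Phi> \<bar>2 * v x\<bar>)"
      by (rule ennreal_leI)
    then show ?case
      using orlicz_function_nonneg[OF \<Phi>] by (simp add: ennreal_mult' ennreal_plus)
  qed
  also have "\<dots> = orlicz_modular \<Phi> M (\<lambda>x. 2 * u x) + orlicz_modular \<Phi> M (\<lambda>x. 2 * v x)"
    unfolding orlicz_modular_def by (rule nn_integral_add) measurable
  finally show ?thesis .
qed

lemma orlicz_modular_sum_le:
  assumes "orlicz_function \<Phi>" "u \<in> borel_measurable M" "v \<in> borel_measurable M"
    "AE x in M. \<bar>w x\<bar> \<le> \<bar>u x\<bar> + \<bar>v x\<bar>" "w \<in> borel_measurable M"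
  shows "orlicz_modular \<Phi> M w \<le> orlicz_modular \<Phi> M (\<lambda>x. 2 * u x) + orlicz_modular \<Phi> M (\<lambda>x. 2 * v x)"
proof -
  have "1 * orlicz_modular \<Phi> M w \<le> 2 * orlicz_modular \<Phi> M w" by (intro mult_right_mono) auto
  then show ?thesis using orlicz_modular_half_sum[OF assms] by simp
qed

lemma orlicz_modular_le_of_half_sum:
  assumes "orlicz_function \<Phi>" "u \<in> borel_measurable M" "v \<in> borel_measurable M"
    "AE x in M. \<bar>w x\<bar> \<le> \<bar>u x\<bar> + \<bar>v x\<bar>" "w \<in> borel_measurable M"
    and C: "orlicz_modular \<Phi> M (\<lambda>x. 2 * u x) \<le> C" "orlicz_modular \<Phi> M (\<lambda>x. 2 * v x) \<le> C"
  shows "orlicz_modular \<Phi> M w \<le> C"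
proof -
  have "2 * orlicz_modular \<Phi> M w \<le> C + C"
    by (rule order_trans[OF orlicz_modular_half_sum[OF assms(1-5)] add_mono[OF C]])
  then have "2 * orlicz_modular \<Phi> M w \<le> 2 * C" by (simp add: mult_2)
  then show ?thesis by (simp add: ennreal_mult_le_mult_iff)
qed

lemma orlicz_modular_Fatou:
  assumes G: "young_function G" and [measurable]: "\<And>k. u k \<in> borel_measurable M"
    and lim: "AE x in M. (\<lambda>k. u k x) \<longlonglongrightarrow> v x"
  shows "orlicz_modular G M v \<le> liminf (\<lambda>k. orlicz_modular G M (u k))"
proof -
  note [measurable] = borel_measurable_orlicz_function[OF young_function_orlicz[OF G]]
  have "orlicz_modular G M v = (\<integral>\<^sup>+x. liminf (\<lambda>k. ennreal (G \<bar>u k x\<bar>)) \<partial>M)"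
    unfolding orlicz_modular_def
  proof (intro nn_integral_cong_AE, use lim in eventually_elim)
    case (elim x)
    then have "(\<lambda>k. ennreal (G \<bar>u k x\<bar>)) \<longlonglongrightarrow> ennreal (G \<bar>v x\<bar>)"
      by (intro tendsto_ennrealI young_function_tendsto[OF G])
    then show ?case by (simp add: lim_imp_Liminf)
  qed
  also have "\<dots> \<le> liminf (\<lambda>k. orlicz_modular G M (u k))"
    unfolding orlicz_modular_def by (rule nn_integral_liminf) measurable
  finally show ?thesis .
qed

lemma orlicz_modular_limit_le:
  assumes "young_function G" "\<And>k. u k \<in> borel_measurable M"
    and "AE x in M. (\<lambda>k. u k x) \<longlonglongrightarrow> v x" "\<And>k. orlicz_modular G M (u k) \<le> C"
  shows "orlicz_modular G M v \<le> C"
proof -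
  have "liminf (\<lambda>k. orlicz_modular G M (u k)) \<le> limsup (\<lambda>k. orlicz_modular G M (u k))"
    by (rule Liminf_le_Limsup) simp
  also have "\<dots> \<le> C" by (rule Limsup_bounded) (use assms(4) in simp)
  finally show ?thesis using orlicz_modular_Fatou[OF assms(1-3)] by simp
qed

section \<open>Orlicz spaces and hearts through scaled modulars\<close>

lemma ex_orlicz_modular_le_1:
  assumes \<Phi>: "orlicz_function \<Phi>" and [measurable]: "u \<in> borel_measurable M"
    and L: "L > 0" "orlicz_modular \<Phi> M (\<lambda>x. u x / L) < \<infinity>"
  shows "\<exists>K>0. orlicz_modular \<Phi> M (\<lambda>x. u x / K) \<le> 1"
proof -
  obtain C where C: "C \<ge> 0" "orlicz_modular \<Phi> M (\<lambda>x. u x / L) = ennreal C"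
    using L(2) by (cases "orlicz_modular \<Phi> M (\<lambda>x. u x / L)") auto
  \<comment> \<open>Dividing by \<open>C + 1\<close> rather than by \<open>C\<close> keeps the
    factor in the unit interval, also for \<open>C < 1\<close>.\<close>
  have "orlicz_modular \<Phi> M (\<lambda>x. 1 / (C + 1) * (u x / L)) \<le> ennreal (1 / (C + 1)) * ennreal C"
    unfolding C(2)[symmetric] using C(1) by (intro orlicz_modular_scale[OF \<Phi>]) (auto simp: field_simps)
  also have "\<dots> = ennreal (C / (C + 1))" using C by (simp add: ennreal_mult'[symmetric])
  also have "\<dots> \<le> 1" using C by (auto simp: field_simps)
  finally show ?thesis
    using C L by (intro exI[of _ "(C + 1) * L"]) (auto simp: field_simps add_pos_nonneg)
qed

lemma orlicz_space_add_aux: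
  assumes \<Phi>: "orlicz_function \<Phi>"
    and [measurable]: "u \<in> borel_measurable M" "v \<in> borel_measurable M"
    and L: "L > 0" "orlicz_modular \<Phi> M (\<lambda>x. u x / L) < \<infinity>"
    and K: "K > 0" "orlicz_modular \<Phi> M (\<lambda>x. v x / K) < \<infinity>"
  shows "\<exists>N>0. orlicz_modular \<Phi> M (\<lambda>x. (u x + v x) / N) < \<infinity>"
proof (intro exI conjI)
  let ?m = "max L K"
  \<comment> \<open>The maximum is a scale common to both functions, and the 2 absorbs the doubled
    arguments of midpoint convexity.\<close>
  show "0 < 2 * ?m" using L by auto
  have "\<bar>a + b\<bar> / (2 * ?m) \<le> \<bar>a\<bar> / (2 * ?m) + \<bar>b\<bar> / (2 * ?m)" for a b :: real
    using L by (subst add_divide_distrib[symmetric]) (intro divide_right_mono, auto)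
  then have "orlicz_modular \<Phi> M (\<lambda>x. (u x + v x) / (2 * ?m)) \<le>
     orlicz_modular \<Phi> M (\<lambda>x. 2 * (u x / (2 * ?m))) + orlicz_modular \<Phi> M (\<lambda>x. 2 * (v x / (2 * ?m)))"
    using L by (intro orlicz_modular_sum_le[OF \<Phi>]) auto
  also have "\<dots> \<le> orlicz_modular \<Phi> M (\<lambda>x. u x / L) + orlicz_modular \<Phi> M (\<lambda>x. v x / K)"
    using L K by (intro add_mono orlicz_modular_mono[OF \<Phi>] AE_I2) (auto intro!: divide_left_mono mult_pos_pos)
  also have "\<dots> < \<infinity>" using L K by simp
  finally show "orlicz_modular \<Phi> M (\<lambda>x. (u x + v x) / (2 * ?m)) < \<infinity>" .
qed

text \<open>Finiteness at some scale survives sums and multiples by convexity, so it already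
  describes the linear hull. Membership is always checked in this form.\<close>

lemma orlicz_space_iff:
  assumes \<Phi>: "orlicz_function \<Phi>"
  shows "u \<in> orlicz_space \<Phi> M \<longleftrightarrow>
    u \<in> borel_measurable M \<and> (\<exists>L>0. orlicz_modular \<Phi> M (\<lambda>x. u x / L) < \<infinity>)"
proof
  assume "u \<in> orlicz_space \<Phi> M"
  then obtain k :: nat and c f where f: "\<forall>i<k. f i \<in> orlicz_class \<Phi> M" and u: "u = (\<lambda>x. \<Sum>i<k. c i * f i x)"
    unfolding orlicz_space_def by blast
  from f show "u \<in> borel_measurable M \<and> (\<exists>L>0. orlicz_modular \<Phi> M (\<lambda>x. u x / L) < \<infinity>)"
    unfolding u
  proof (induction k)
    case 0
    then show ?case
      by (auto simp: orlicz_modular_def orlicz_function_zero[OF \<Phi>] intro!: exI[of _ 1])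
  next
    case (Suc k)
    then have IH: "(\<lambda>x. \<Sum>i<k. c i * f i x) \<in> borel_measurable M"
        "\<exists>L>0. orlicz_modular \<Phi> M (\<lambda>x. (\<Sum>i<k. c i * f i x) / L) < \<infinity>"
      and fk: "f k \<in> borel_measurable M" "orlicz_modular \<Phi> M (f k) < \<infinity>"
      by (auto simp: orlicz_class_def)
    \<comment> \<open>The scale \<open>\<bar>c k\<bar> + 1\<close> stays positive when the
      coefficient vanishes.\<close>
    have "\<bar>c k * f k x / (\<bar>c k\<bar> + 1)\<bar> \<le> \<bar>f k x\<bar>" for x
    proof -
      have "\<bar>c k\<bar> / (\<bar>c k\<bar> + 1) * \<bar>f k x\<bar> \<le> 1 * \<bar>f k x\<bar>" by (intro mult_right_mono) auto
      then show ?thesis by (simp add: abs_mult)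
    qed
    then have "orlicz_modular \<Phi> M (\<lambda>x. c k * f k x / (\<bar>c k\<bar> + 1)) \<le> orlicz_modular \<Phi> M (f k)"
      by (intro orlicz_modular_mono[OF \<Phi>]) auto
    then have "orlicz_modular \<Phi> M (\<lambda>x. c k * f k x / (\<bar>c k\<bar> + 1)) < \<infinity>" using fk(2) by simp
    then have "\<exists>N>0. orlicz_modular \<Phi> M (\<lambda>x. ((\<Sum>i<k. c i * f i x) + c k * f k x) / N) < \<infinity>"
      using IH fk(1) by (elim exE conjE, intro orlicz_space_add_aux[OF \<Phi>, where K="\<bar>c k\<bar> + 1"]) auto
    then show ?case using IH(1) fk(1) by auto
  qed
next
  assume "u \<in> borel_measurable M \<and> (\<exists>L>0. orlicz_modular \<Phi> M (\<lambda>x. u x / L) < \<infinity>)"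
  then obtain L where L: "u \<in> borel_measurable M" "L > 0" "orlicz_modular \<Phi> M (\<lambda>x. u x / L) < \<infinity>"
    by blast
  then have "(\<lambda>x. u x / L) \<in> orlicz_class \<Phi> M" by (auto simp: orlicz_class_def)
  moreover have "u = (\<lambda>x. \<Sum>i<(1::nat). L * (u x / L))" using L by auto
  ultimately show "u \<in> orlicz_space \<Phi> M"
    unfolding orlicz_space_def
    by (intro CollectI exI[of _ 1] exI[of _ "\<lambda>_. L"] exI[of _ "\<lambda>_ x. u x / L"]) auto
qed

lemma orlicz_space_modular_le_1:
  assumes \<Phi>: "orlicz_function \<Phi>" and "u \<in> orlicz_space \<Phi> M"
  obtains L where "L > 0" "orlicz_modular \<Phi> M (\<lambda>x. u x / L) \<le> 1"
  using assms(2) ex_orlicz_modular_le_1[OF \<Phi>] unfolding orlicz_space_iff[OF \<Phi>] by blast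

lemma orlicz_space_measurable:
  "orlicz_function \<Phi> \<Longrightarrow> u \<in> orlicz_space \<Phi> M \<Longrightarrow> u \<in> borel_measurable M"
  by (simp add: orlicz_space_iff)

lemma orlicz_space_diff:
  assumes \<Phi>: "orlicz_function \<Phi>" and "u \<in> orlicz_space \<Phi> M" "v \<in> orlicz_space \<Phi> M"
  shows "(\<lambda>x. u x - v x) \<in> orlicz_space \<Phi> M"
proof -
  obtain L where L: "u \<in> borel_measurable M" "L > 0" "orlicz_modular \<Phi> M (\<lambda>x. u x / L) < \<infinity>"
    using assms(2) orlicz_space_iff[OF \<Phi>] by blast
  obtain K where K: "v \<in> borel_measurable M" "K > 0" "orlicz_modular \<Phi> M (\<lambda>x. v x / K) < \<infinity>"
    using assms(3) orlicz_space_iff[OF \<Phi>] by blast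
  have "orlicz_modular \<Phi> M (\<lambda>x. (- v x) / K) < \<infinity>" using K(3) by (simp add: orlicz_modular_def)
  then have "\<exists>N>0. orlicz_modular \<Phi> M (\<lambda>x. (u x + (- v x)) / N) < \<infinity>"
    using L K by (intro orlicz_space_add_aux[OF \<Phi>, where L=L and K=K]) auto
  then show ?thesis using L K by (simp add: orlicz_space_iff[OF \<Phi>])
qed

lemma bounded_finite_support_orlicz_space:
  assumes \<Phi>: "orlicz_function \<Phi>" and [measurable]: "u \<in> borel_measurable M"
    and B: "\<And>x. x \<in> space M \<Longrightarrow> \<bar>u x\<bar> \<le> B" and fin: "emeasure M {x \<in> space M. u x \<noteq> 0} < \<infinity>"
  shows "u \<in> orlicz_space \<Phi> M"
proof -
  have "orlicz_modular \<Phi> M u \<le> (\<integral>\<^sup>+x. ennreal (\<Phi> \<bar>B\<bar>) * indicator {x \<in> space M. u x \<noteq> 0} x \<partial>M)"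
    unfolding orlicz_modular_def
  proof (rule nn_integral_mono)
    fix x assume x: "x \<in> space M"
    show "ennreal (\<Phi> \<bar>u x\<bar>) \<le> ennreal (\<Phi> \<bar>B\<bar>) * indicator {x \<in> space M. u x \<noteq> 0} x"
      using x B[OF x] orlicz_function_zero[OF \<Phi>]
      by (cases "u x = 0") (auto intro!: ennreal_leI orlicz_function_mono[OF \<Phi>])
  qed
  also have "\<dots> = ennreal (\<Phi> \<bar>B\<bar>) * emeasure M {x \<in> space M. u x \<noteq> 0}"
    by (rule nn_integral_cmult_indicator) measurable
  also have "\<dots> < \<infinity>" using fin by (simp add: ennreal_mult_less_top)
  finally have "orlicz_modular \<Phi> M (\<lambda>x. u x / 1) < \<infinity>" by simp
  then show ?thesis unfolding orlicz_space_iff[OF \<Phi>] by (auto intro: exI[of _ 1])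
qed

lemma bounded_finite_support_orlicz_heart:
  assumes \<Phi>: "orlicz_function \<Phi>" and u: "u \<in> borel_measurable M"
    and B: "\<And>x. x \<in> space M \<Longrightarrow> \<bar>u x\<bar> \<le> B" and fin: "emeasure M {x \<in> space M. u x \<noteq> 0} < \<infinity>"
  shows "u \<in> orlicz_heart \<Phi> M"
  unfolding orlicz_heart_def
proof (intro CollectI conjI allI impI)
  show "u \<in> orlicz_space \<Phi> M" by (rule bounded_finite_support_orlicz_space[OF assms])
  fix e :: real assume e: "e > 0"
  \<comment> \<open>The function approximates itself. Every positive scale is admissible for the
    zero function, so \<open>e / 2\<close> bounds the infimum.\<close>
  have "luxemburg_norm \<Phi> M (\<lambda>x. u x - u x) \<le> e / 2"
    unfolding luxemburg_norm_def using e
    by (intro cInf_lower) (auto simp: orlicz_modular_def orlicz_function_zero[OF \<Phi>] intro!: bdd_belowI[of _ 0])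
  moreover have "bounded (u ` space M)"
    using B by (auto simp: bounded_iff intro!: exI[of _ B])
  ultimately show "\<exists>v\<in>borel_measurable M. bounded (v ` space M) \<and>
      emeasure M {x \<in> space M. v x \<noteq> 0} < \<infinity> \<and> luxemburg_norm \<Phi> M (\<lambda>x. u x - v x) < e"
    using u fin e by (intro bexI[of _ u]) auto
qed

lemma orlicz_heart_approx:
  assumes \<Phi>: "orlicz_function \<Phi>" and w: "w \<in> orlicz_heart \<Phi> M" and e: "e > 0"
  obtains v B l where "v \<in> borel_measurable M" "\<And>x. x \<in> space M \<Longrightarrow> \<bar>v x\<bar> \<le> B"
    "emeasure M {x \<in> space M. v x \<noteq> 0} < \<infinity>" "0 < l" "l < e"
    "orlicz_modular \<Phi> M (\<lambda>x. (w x - v x) / l) \<le> 1"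
proof -
  obtain v where v: "v \<in> borel_measurable M" "bounded (v ` space M)"
    "emeasure M {x \<in> space M. v x \<noteq> 0} < \<infinity>" "luxemburg_norm \<Phi> M (\<lambda>x. w x - v x) < e"
    and wL: "w \<in> orlicz_space \<Phi> M"
    using w e unfolding orlicz_heart_def by blast
  obtain B where B: "\<And>x. x \<in> space M \<Longrightarrow> \<bar>v x\<bar> \<le> B"
    using v(2) by (auto simp: bounded_iff)
  have "(\<lambda>x. w x - v x) \<in> orlicz_space \<Phi> M"
    by (intro orlicz_space_diff[OF \<Phi>] wL bounded_finite_support_orlicz_space[OF \<Phi> v(1) B v(3)])
  then obtain L where L: "L > 0" "orlicz_modular \<Phi> M (\<lambda>x. (w x - v x) / L) \<le> 1"
    using orlicz_space_modular_le_1[OF \<Phi>] by blast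
  \<comment> \<open>\<open>Inf\<close> of the empty set is a real number without meaning. A norm
    below \<open>e\<close> yields a scale below \<open>e\<close> only because the difference lies in
    the Orlicz space and some scale is admissible.\<close>
  have "{l. 0 < l \<and> orlicz_modular \<Phi> M (\<lambda>x. (w x - v x) / l) \<le> 1} \<noteq> {}"
    using L by auto
  from cInf_lessD[OF this v(4)[unfolded luxemburg_norm_def]]
  obtain l where "0 < l" "orlicz_modular \<Phi> M (\<lambda>x. (w x - v x) / l) \<le> 1" "l < e" by auto
  then show ?thesis using that[OF v(1) B v(3)] by blast
qed

text \<open>Young's inequality integrated at two independent scales. The product
  \<open>L * l\<close> stays in front because the application keeps both modulars bounded and makes
  \<open>l\<close> small.\<close>

lemma orlicz_Hoelder:
  assumes G: "young_function G" and [measurable]: "u \<in> borel_measurable M" "w \<in> borel_measurable M"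
    and L: "L > 0" "l > 0"
  shows "(\<integral>\<^sup>+x. ennreal \<bar>u x * w x\<bar> \<partial>M) \<le>
    ennreal (L * l) * (orlicz_modular G M (\<lambda>x. u x / L) + orlicz_modular (complementary G) M (\<lambda>x. w x / l))"
proof -
  note O = young_function_orlicz[OF G] complementary_orlicz[OF G]
  note [measurable] = borel_measurable_orlicz_function[OF O(1)] borel_measurable_orlicz_function[OF O(2)]
  have "ennreal \<bar>u x * w x\<bar> \<le> ennreal (L * l) * (ennreal (G \<bar>u x / L\<bar>) + ennreal (complementary G \<bar>w x / l\<bar>))" for x
  proof -
    have "\<bar>w x / l\<bar> * \<bar>u x / L\<bar> \<le> G \<bar>u x / L\<bar> + complementary G \<bar>w x / l\<bar>"
      by (rule young_inequality[OF G]) auto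
    then have "(L * l) * (\<bar>w x / l\<bar> * \<bar>u x / L\<bar>) \<le> (L * l) * (G \<bar>u x / L\<bar> + complementary G \<bar>w x / l\<bar>)"
      using L by (intro mult_left_mono) auto
    moreover have "(L * l) * (\<bar>w x / l\<bar> * \<bar>u x / L\<bar>) = \<bar>u x * w x\<bar>"
      using L by (simp add: abs_mult)
    ultimately have "ennreal \<bar>u x * w x\<bar> \<le> ennreal ((L * l) * (G \<bar>u x / L\<bar> + complementary G \<bar>w x / l\<bar>))"
      by (intro ennreal_leI) simp
    also have "\<dots> = ennreal (L * l) * (ennreal (G \<bar>u x / L\<bar>) + ennreal (complementary G \<bar>w x / l\<bar>))"
      using L orlicz_function_nonneg[OF O(1)] orlicz_function_nonneg[OF O(2)]
      by (simp add: ennreal_mult' ennreal_plus)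
    finally show ?thesis .
  qed
  then have "(\<integral>\<^sup>+x. ennreal \<bar>u x * w x\<bar> \<partial>M) \<le>
      (\<integral>\<^sup>+x. ennreal (L * l) * (ennreal (G \<bar>u x / L\<bar>) + ennreal (complementary G \<bar>w x / l\<bar>)) \<partial>M)"
    by (rule nn_integral_mono)
  also have "\<dots> = ennreal (L * l) * (\<integral>\<^sup>+x. ennreal (G \<bar>u x / L\<bar>) + ennreal (complementary G \<bar>w x / l\<bar>) \<partial>M)"
    by (rule nn_integral_cmult) measurable
  also have "(\<integral>\<^sup>+x. ennreal (G \<bar>u x / L\<bar>) + ennreal (complementary G \<bar>w x / l\<bar>) \<partial>M) =
      orlicz_modular G M (\<lambda>x. u x / L) + orlicz_modular (complementary G) M (\<lambda>x. w x / l)"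
    unfolding orlicz_modular_def by (rule nn_integral_add) measurable
  finally show ?thesis .
qed

text \<open>The half of Vitali's theorem opposite to Fatou's lemma. Functions cut at height
  \<open>m\<close> converge by domination on the set of finite measure, and what is cut off
  integrates to at most \<open>e\<close>; subtraction in \<open>ennreal\<close> stops at zero, so
  \<open>h k x - ennreal m\<close> is exactly that excess.\<close>

lemma limsup_nn_integral_le_uniformly_integrable:
  fixes h :: "nat \<Rightarrow> 'b \<Rightarrow> ennreal"
  assumes [measurable]: "\<And>k. h k \<in> borel_measurable M" "f \<in> borel_measurable M" "A \<in> sets M"
    and fin: "emeasure M A < \<infinity>" and lim: "AE x in M. (\<lambda>k. h k x) \<longlonglongrightarrow> f x"
    and UI: "\<And>e::real. e > 0 \<Longrightarrow> \<exists>m::real. \<forall>k. (\<integral>\<^sup>+x. (h k x - ennreal m) * indicator A x \<partial>M) \<le> ennreal e"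
  shows "limsup (\<lambda>k. \<integral>\<^sup>+x. h k x * indicator A x \<partial>M) \<le> (\<integral>\<^sup>+x. f x * indicator A x \<partial>M)"
proof (rule ennreal_le_epsilon)
  fix e :: real assume e: "e > 0"
  obtain m :: real where m: "\<And>k. (\<integral>\<^sup>+x. (h k x - ennreal m) * indicator A x \<partial>M) \<le> ennreal e"
    using UI[OF e] by blast
  let ?c = "\<lambda>k. \<integral>\<^sup>+x. min (h k x) (ennreal m) * indicator A x \<partial>M"
  have le: "(\<integral>\<^sup>+x. h k x * indicator A x \<partial>M) \<le> ?c k + ennreal e" for k
  proof -
    have "a \<le> min a b + (a - b)" for a b :: ennreal
    proof (cases "a \<le> b")
      case False
      then have "b \<le> a" by simp
      then have "b + (a - b) = a" by (metis diff_add_cancel_ennreal add.commute)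
      then show ?thesis using False by (simp only: min_def if_False order_refl)
    qed (simp add: min_def)
    then have "(\<integral>\<^sup>+x. h k x * indicator A x \<partial>M) \<le>
       (\<integral>\<^sup>+x. min (h k x) (ennreal m) * indicator A x + (h k x - ennreal m) * indicator A x \<partial>M)"
      by (intro nn_integral_mono) (auto simp: indicator_def)
    also have "\<dots> = ?c k + (\<integral>\<^sup>+x. (h k x - ennreal m) * indicator A x \<partial>M)"
      by (rule nn_integral_add) measurable
    also have "\<dots> \<le> ?c k + ennreal e" by (intro add_left_mono m)
    finally show ?thesis .
  qed
  have "?c \<longlonglongrightarrow> (\<integral>\<^sup>+x. min (f x) (ennreal m) * indicator A x \<partial>M)"
  proof (rule nn_integral_dominated_convergence[where w="\<lambda>x. ennreal m * indicator A x"])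
    show "(\<integral>\<^sup>+x. ennreal m * indicator A x \<partial>M) < \<infinity>"
      using fin by (simp add: nn_integral_cmult_indicator ennreal_mult_less_top)
    show "AE x in M. (\<lambda>k. min (h k x) (ennreal m) * indicator A x) \<longlonglongrightarrow> min (f x) (ennreal m) * indicator A x"
      using lim by eventually_elim (auto simp: indicator_def intro!: tendsto_min)
  qed (auto intro!: mult_right_mono)
  then have "(\<lambda>k. ?c k + ennreal e) \<longlonglongrightarrow> (\<integral>\<^sup>+x. min (f x) (ennreal m) * indicator A x \<partial>M) + ennreal e"
    by (intro tendsto_add) auto
  then have B: "limsup (\<lambda>k. ?c k + ennreal e) = (\<integral>\<^sup>+x. min (f x) (ennreal m) * indicator A x \<partial>M) + ennreal e"
    by (simp add: lim_imp_Limsup)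
  have A: "limsup (\<lambda>k. \<integral>\<^sup>+x. h k x * indicator A x \<partial>M) \<le> limsup (\<lambda>k. ?c k + ennreal e)"
    by (rule Limsup_mono) (use le in simp)
  have C: "(\<integral>\<^sup>+x. min (f x) (ennreal m) * indicator A x \<partial>M) \<le> (\<integral>\<^sup>+x. f x * indicator A x \<partial>M)"
    by (intro nn_integral_mono mult_right_mono) auto
  show "limsup (\<lambda>k. \<integral>\<^sup>+x. h k x * indicator A x \<partial>M) \<le> (\<integral>\<^sup>+x. f x * indicator A x \<partial>M) + ennreal e"
    by (rule order_trans[OF A[unfolded B] add_right_mono[OF C]])
qed

text \<open>The mechanism of de la Vallee Poussin's criterion: the excess over a high level costs
  only a small multiple \<open>d\<close> of the modular, whatever the scale.\<close>

lemma young_function_tail: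
  assumes G: "young_function G" and "L > 0" "d > 0"
  obtains T where "T \<ge> 0" "\<And>t. t \<ge> 0 \<Longrightarrow> t - T \<le> d * G (t / L)"
proof -
  obtain B where B: "B \<ge> 0" "\<And>t. t \<ge> 0 \<Longrightarrow> (L / d) * t \<le> G t + B"
    using young_function_affine_bound[OF G, of "L / d"] assms by (metis divide_nonneg_pos less_imp_le)
  show ?thesis
  proof (rule that[of "d * B"])
    fix t :: real assume "t \<ge> 0"
    then have "d * ((L / d) * (t / L)) \<le> d * (G (t / L) + B)"
      using assms by (intro mult_left_mono B) auto
    then show "t - d * B \<le> d * G (t / L)" using assms by (simp add: algebra_simps)
  qed (use B assms in auto)
qed

text \<open>Superlinear growth makes a sequence with bounded modulars uniformly integrable on sets
  of finite measure, which upgrades almost everywhere convergence to convergence in the mean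
  there.\<close>

lemma modular_bounded_tendsto_0_on:
  assumes G: "young_function G" and [measurable]: "\<And>k. f k \<in> borel_measurable M" "A \<in> sets M"
    and fin: "emeasure M A < \<infinity>" and lim: "AE x in M. (\<lambda>k. f k x) \<longlonglongrightarrow> 0"
    and L: "L > 0" "\<And>k. orlicz_modular G M (\<lambda>x. f k x / L) \<le> ennreal C"
  shows "(\<lambda>k. \<integral>\<^sup>+x. ennreal \<bar>f k x\<bar> * indicator A x \<partial>M) \<longlonglongrightarrow> 0"
proof -
  note O = young_function_orlicz[OF G]
  note [measurable] = borel_measurable_orlicz_function[OF O]
  have "limsup (\<lambda>k. \<integral>\<^sup>+x. ennreal \<bar>f k x\<bar> * indicator A x \<partial>M) \<le> (\<integral>\<^sup>+x. 0 * indicator A x \<partial>M)"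
  proof (rule limsup_nn_integral_le_uniformly_integrable[OF _ _ _ fin])
    show "AE x in M. (\<lambda>k. ennreal \<bar>f k x\<bar>) \<longlonglongrightarrow> 0"
      using lim by eventually_elim (auto simp: tendsto_rabs_zero ennreal_tendsto_0_iff)
    fix e :: real assume e: "e > 0"
    \<comment> \<open>Here \<open>C\<close> may be any real number, and \<open>ennreal C\<close> is
      zero for negative \<open>C\<close>; the absolute value keeps the denominator positive.\<close>
    define d where "d = e / (\<bar>C\<bar> + 1)"
    have d: "d > 0" using e by (simp add: d_def add_nonneg_pos)
    obtain T where T: "T \<ge> 0" "\<And>t. t \<ge> 0 \<Longrightarrow> t - T \<le> d * G (t / L)"
      using young_function_tail[OF G L(1) d] by blast
    have "(\<integral>\<^sup>+x. (ennreal \<bar>f k x\<bar> - ennreal T) * indicator A x \<partial>M) \<le> ennreal e" for k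
    proof -
      have "(\<integral>\<^sup>+x. (ennreal \<bar>f k x\<bar> - ennreal T) * indicator A x \<partial>M) \<le> (\<integral>\<^sup>+x. ennreal d * ennreal (G \<bar>f k x / L\<bar>) \<partial>M)"
      proof (rule nn_integral_mono)
        fix x
        have "\<bar>f k x\<bar> - T \<le> d * G \<bar>f k x / L\<bar>" using T(2)[of "\<bar>f k x\<bar>"] L by simp
        then have "ennreal (\<bar>f k x\<bar> - T) \<le> ennreal (d * G \<bar>f k x / L\<bar>)" by (rule ennreal_leI)
        then show "(ennreal \<bar>f k x\<bar> - ennreal T) * indicator A x \<le> ennreal d * ennreal (G \<bar>f k x / L\<bar>)"
          using d T(1) by (auto simp: indicator_def ennreal_minus ennreal_mult')
      qed
      also have "\<dots> = ennreal d * orlicz_modular G M (\<lambda>x. f k x / L)"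
        unfolding orlicz_modular_def by (rule nn_integral_cmult) measurable
      also have "\<dots> \<le> ennreal d * ennreal C" by (intro mult_left_mono L) auto
      also have "\<dots> = ennreal (d * C)" using d by (simp add: ennreal_mult')
      also have "d * C \<le> e"
      proof -
        have "e * (C / (\<bar>C\<bar> + 1)) \<le> e * 1"
          using e by (intro mult_left_mono) (auto simp: pos_divide_le_eq add_nonneg_pos)
        then show ?thesis by (simp add: d_def)
      qed
      finally show ?thesis by (simp add: ennreal_leI)
    qed
    then show "\<exists>m. \<forall>k. (\<integral>\<^sup>+x. (ennreal \<bar>f k x\<bar> - ennreal m) * indicator A x \<partial>M) \<le> ennreal e" by blast
  qed measurable
  then have "limsup (\<lambda>k. \<integral>\<^sup>+x. ennreal \<bar>f k x\<bar> * indicator A x \<partial>M) \<le> 0" by simp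
  then show ?thesis by (simp add: tendsto_0_if_Limsup_eq_0_ennreal le_zero_eq)
qed

text \<open>The test function is split into a bounded part with support of finite measure, against
  which convergence in the mean suffices, and a remainder at a small scale, which Hoelder's
  inequality makes small uniformly along the sequence.\<close>

lemma orlicz_heart_weak_convergence:
  assumes G: "young_function G" and [measurable]: "\<And>k. u k \<in> borel_measurable M" "v \<in> borel_measurable M"
    and lim: "AE x in M. (\<lambda>k. u k x) \<longlonglongrightarrow> v x"
    and L: "L > 0" "\<And>k. orlicz_modular G M (\<lambda>x. u k x / L) \<le> ennreal C"
    and w: "w \<in> orlicz_heart (complementary G) M"
  shows "(\<lambda>k. \<integral>x. u k x * w x \<partial>M) \<longlonglongrightarrow> (\<integral>x. v x * w x \<partial>M)"
proof -
  note O = young_function_orlicz[OF G] complementary_orlicz[OF G]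
  have wL: "w \<in> orlicz_space (complementary G) M" using w by (simp add: orlicz_heart_def)
  then have [measurable]: "w \<in> borel_measurable M" by (rule orlicz_space_measurable[OF O(2)])
  obtain K where K: "K > 0" "orlicz_modular (complementary G) M (\<lambda>x. w x / K) \<le> 1"
    using orlicz_space_modular_le_1[OF O(2) wL] by blast
  have vC: "orlicz_modular G M (\<lambda>x. v x / L) \<le> ennreal C"
    by (rule orlicz_modular_limit_le[OF G _ _ L(2)]) (use lim L(1) in \<open>auto elim!: eventually_mono intro!: tendsto_divide\<close>)
  have int: "integrable M (\<lambda>x. f x * w x)"
    if [measurable]: "f \<in> borel_measurable M" and f: "orlicz_modular G M (\<lambda>x. f x / L) \<le> ennreal C" for f
  proof (rule integrableI_bounded)
    have "(\<integral>\<^sup>+x. ennreal \<bar>f x * w x\<bar> \<partial>M) \<le> ennreal (L * K) * (ennreal C + 1)"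
      by (rule order_trans[OF orlicz_Hoelder[OF G _ _ L(1) K(1)]]) (auto intro!: mult_left_mono add_mono f K)
    also have "\<dots> < \<infinity>" by (simp add: ennreal_mult_less_top)
    finally show "(\<integral>\<^sup>+x. ennreal (norm (f x * w x)) \<partial>M) < \<infinity>" by simp
  qed measurable
  define f where "f k x = u k x - v x" for k x
  have [measurable]: "f k \<in> borel_measurable M" for k unfolding f_def by measurable
  have f0: "AE x in M. (\<lambda>k. f k x) \<longlonglongrightarrow> 0"
    using lim by eventually_elim (simp add: f_def LIM_zero)
  \<comment> \<open>Doubling the scale compensates the doubling in midpoint convexity, so the bound
    \<open>C\<close> is inherited unchanged.\<close>
  have fC: "orlicz_modular G M (\<lambda>x. f k x / (2 * L)) \<le> ennreal C" for k
  proof (rule orlicz_modular_le_of_half_sum[OF O(1), where u="\<lambda>x. u k x / (2 * L)" and v="\<lambda>x. v x / (2 * L)"])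
    show "AE x in M. \<bar>f k x / (2 * L)\<bar> \<le> \<bar>u k x / (2 * L)\<bar> + \<bar>v x / (2 * L)\<bar>"
      using L(1) by (intro AE_I2) (simp add: f_def abs_divide add_divide_distrib[symmetric] divide_right_mono abs_triangle_ineq4)
  qed (use L vC in auto)
  have small: "\<forall>\<^sub>F k in sequentially. (\<integral>\<^sup>+x. ennreal \<bar>f k x * w x\<bar> \<partial>M) \<le> ennreal e" if e: "e > 0" for e :: real
  proof -
    \<comment> \<open>Chosen so that the Hoelder factor \<open>2 * L * d\<close>, times the bound
      \<open>\<bar>C\<bar> + 1\<close> of the two modulars, is \<open>e / 2\<close>.\<close>
    define d where "d = e / (4 * L * (\<bar>C\<bar> + 1))"
    have d: "d > 0" using e L(1) by (simp add: d_def)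
    obtain b B l where b [measurable]: "b \<in> borel_measurable M" and B: "\<And>x. x \<in> space M \<Longrightarrow> \<bar>b x\<bar> \<le> B"
      and fin: "emeasure M {x \<in> space M. b x \<noteq> 0} < \<infinity>" and l: "0 < l" "l < d"
      "orlicz_modular (complementary G) M (\<lambda>x. (w x - b x) / l) \<le> 1"
      using orlicz_heart_approx[OF O(2) w d] by blast
    let ?A = "{x \<in> space M. b x \<noteq> 0}"
    have A [measurable]: "?A \<in> sets M" by measurable
    have "(\<lambda>k. \<integral>\<^sup>+x. ennreal \<bar>f k x\<bar> * indicator ?A x \<partial>M) \<longlonglongrightarrow> 0"
      by (rule modular_bounded_tendsto_0_on[OF G _ A fin f0, where L="2*L" and C=C]) (use L fC in auto)
    then have "(\<lambda>k. ennreal \<bar>B\<bar> * (\<integral>\<^sup>+x. ennreal \<bar>f k x\<bar> * indicator ?A x \<partial>M)) \<longlonglongrightarrow> ennreal \<bar>B\<bar> * 0"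
      by (intro tendsto_mult_ennreal tendsto_const) auto
    then have "\<forall>\<^sub>F k in sequentially. ennreal \<bar>B\<bar> * (\<integral>\<^sup>+x. ennreal \<bar>f k x\<bar> * indicator ?A x \<partial>M) < ennreal (e / 2)"
      using e by (intro order_tendstoD) auto
    then show ?thesis
    proof eventually_elim
      case (elim k)
      have "(\<integral>\<^sup>+x. ennreal \<bar>f k x * w x\<bar> \<partial>M) \<le>
          (\<integral>\<^sup>+x. ennreal \<bar>B\<bar> * (ennreal \<bar>f k x\<bar> * indicator ?A x) + ennreal \<bar>f k x * (w x - b x)\<bar> \<partial>M)"
      proof (rule nn_integral_mono)
        fix x assume x: "x \<in> space M"
        have "\<bar>f k x * w x\<bar> \<le> \<bar>f k x * b x\<bar> + \<bar>f k x * (w x - b x)\<bar>"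
          by (simp add: right_diff_distrib)
        also have "\<bar>f k x * b x\<bar> \<le> \<bar>B\<bar> * (\<bar>f k x\<bar> * indicator ?A x)"
          using B[OF x] x by (cases "b x = 0") (auto simp: abs_mult mult.commute intro!: mult_right_mono)
        finally have "ennreal \<bar>f k x * w x\<bar> \<le> ennreal (\<bar>B\<bar> * (\<bar>f k x\<bar> * indicator ?A x) + \<bar>f k x * (w x - b x)\<bar>)"
          by (intro ennreal_leI) simp
        also have "\<dots> = ennreal \<bar>B\<bar> * (ennreal \<bar>f k x\<bar> * indicator ?A x) + ennreal \<bar>f k x * (w x - b x)\<bar>"
          by (subst ennreal_plus) (auto simp: ennreal_mult ennreal_indicator)
        finally show "ennreal \<bar>f k x * w x\<bar> \<le> ennreal \<bar>B\<bar> * (ennreal \<bar>f k x\<bar> * indicator ?A x) + ennreal \<bar>f k x * (w x - b x)\<bar>" .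
      qed
      also have "\<dots> = ennreal \<bar>B\<bar> * (\<integral>\<^sup>+x. ennreal \<bar>f k x\<bar> * indicator ?A x \<partial>M) + (\<integral>\<^sup>+x. ennreal \<bar>f k x * (w x - b x)\<bar> \<partial>M)"
        by (simp add: nn_integral_add nn_integral_cmult)
      also have "(\<integral>\<^sup>+x. ennreal \<bar>f k x * (w x - b x)\<bar> \<partial>M) \<le> ennreal (2 * L * l) * (ennreal C + 1)"
        by (rule order_trans[OF orlicz_Hoelder[OF G, where L="2*L" and l=l]])
           (use L(1) l in \<open>auto intro!: mult_left_mono add_mono fC\<close>)
      also have "ennreal C + 1 \<le> ennreal (\<bar>C\<bar> + 1)"
        by (subst ennreal_plus) (auto intro: ennreal_leI)
      also have "ennreal (2 * L * l) * ennreal (\<bar>C\<bar> + 1) = ennreal (2 * L * l * (\<bar>C\<bar> + 1))"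
        by (rule ennreal_mult[symmetric]) (use L(1) l in auto)
      also have "2 * L * l * (\<bar>C\<bar> + 1) \<le> 2 * L * d * (\<bar>C\<bar> + 1)"
        using L(1) l by (intro mult_right_mono mult_left_mono) auto
      also have "2 * L * d * (\<bar>C\<bar> + 1) = e / 2"
        using L(1) by (simp add: d_def field_simps add_nonneg_eq_0_iff)
      finally have "(\<integral>\<^sup>+x. ennreal \<bar>f k x * w x\<bar> \<partial>M) \<le> ennreal \<bar>B\<bar> * (\<integral>\<^sup>+x. ennreal \<bar>f k x\<bar> * indicator ?A x \<partial>M) + ennreal (e / 2)"
        by (simp add: add_left_mono mult_left_mono ennreal_leI)
      also have "\<dots> \<le> ennreal (e / 2) + ennreal (e / 2)"
        using elim by (intro add_right_mono) auto
      also have "\<dots> = ennreal e" using e by (subst ennreal_plus[symmetric]) auto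
      finally show ?case .
    qed
  qed
  show ?thesis
  proof (rule LIM_zero_cancel, rule tendstoI)
    fix e :: real assume e: "e > 0"
    then have "0 < e / 2" by simp
    from small[OF this] show "\<forall>\<^sub>F k in sequentially. dist ((\<integral>x. u k x * w x \<partial>M) - (\<integral>x. v x * w x \<partial>M)) 0 < e"
    proof eventually_elim
      case (elim k)
      have iu: "integrable M (\<lambda>x. u k x * w x)" by (rule int) (use L(2) in auto)
      have iv: "integrable M (\<lambda>x. v x * w x)" by (rule int) (use vC in auto)
      have eq: "f k x * w x = u k x * w x - v x * w x" for x by (simp add: f_def left_diff_distrib)
      have D: "(\<integral>x. u k x * w x \<partial>M) - (\<integral>x. v x * w x \<partial>M) = (\<integral>x. f k x * w x \<partial>M)"
        unfolding eq by (rule Bochner_Integration.integral_diff[OF iu iv, symmetric])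
      have "ennreal (norm (\<integral>x. f k x * w x \<partial>M)) \<le> (\<integral>\<^sup>+x. ennreal (norm (f k x * w x)) \<partial>M)"
        unfolding eq by (rule integral_norm_bound_ennreal[OF Bochner_Integration.integrable_diff[OF iu iv]])
      also have "\<dots> \<le> ennreal (e / 2)" using elim by simp
      finally have "ennreal \<bar>(\<integral>x. u k x * w x \<partial>M) - (\<integral>x. v x * w x \<partial>M)\<bar> \<le> ennreal (e / 2)"
        unfolding D by simp
      then have "\<bar>(\<integral>x. u k x * w x \<partial>M) - (\<integral>x. v x * w x \<partial>M)\<bar> \<le> e / 2"
        using e by (simp add: ennreal_le_iff)
      then show ?case using e by (simp add: dist_real_def)
    qed
  qed
qed

section \<open>Smooth bumps and mollification\<close>

lemma C_k_SucI:
  assumes "\<And>x. (f has_derivative f' x) (at x)" "\<And>b. b \<in> Basis \<Longrightarrow> C_k k (\<lambda>x. f' x b)"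
  shows "C_k (Suc k) f"
proof -
  have "frechet_derivative f (at x) = f' x" for x
    using frechet_derivative_at[OF assms(1)] by simp
  moreover have "f differentiable_on UNIV"
    using assms(1) by (auto simp: differentiable_on_def differentiable_def)
  ultimately show ?thesis using assms(2) by simp
qed

lemma C_k_Suc_has_derivative:
  "C_k (Suc k) f \<Longrightarrow> (f has_derivative frechet_derivative f (at x)) (at x)"
  by (simp add: differentiable_on_def frechet_derivative_works)

lemma C_k_SucD: "C_k (Suc k) f \<Longrightarrow> C_k k f"
proof (induction k arbitrary: f)
  case 0
  then show ?case by (simp add: differentiable_imp_continuous_on)
next
  case (Suc k)
  then show ?case by simp
qed

lemma C_k_continuous: "C_k k f \<Longrightarrow> continuous_on UNIV f"
  by (cases k) (auto simp: differentiable_imp_continuous_on)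

lemma C_k_const: "C_k k (\<lambda>_. c)"
proof (induction k arbitrary: c)
  case (Suc k)
  show ?case by (rule C_k_SucI[OF has_derivative_const Suc])
qed auto

lemma C_k_inner: "C_k k (\<lambda>x. x \<bullet> b)"
proof (cases k)
  case (Suc j)
  show ?thesis unfolding Suc
    by (rule C_k_SucI[where f'="\<lambda>_ h. h \<bullet> b"]) (auto intro!: derivative_eq_intros C_k_const)
qed (auto intro!: continuous_intros)

lemma C_k_add: "C_k k f \<Longrightarrow> C_k k g \<Longrightarrow> C_k k (\<lambda>x. f x + g x)"
proof (induction k arbitrary: f g)
  case 0
  then show ?case by (auto intro!: continuous_intros)
next
  case (Suc k)
  show ?case
    by (rule C_k_SucI[OF has_derivative_add[OF C_k_Suc_has_derivative[OF Suc.prems(1)] C_k_Suc_has_derivative[OF Suc.prems(2)]]])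
       (use Suc in auto)
qed

lemma C_k_mult: "C_k k f \<Longrightarrow> C_k k g \<Longrightarrow> C_k k (\<lambda>x. f x * g x)"
proof (induction k arbitrary: f g)
  case 0
  then show ?case by (auto intro!: continuous_intros)
next
  case (Suc k)
  show ?case
    by (rule C_k_SucI[OF has_derivative_mult[OF C_k_Suc_has_derivative[OF Suc.prems(1)] C_k_Suc_has_derivative[OF Suc.prems(2)]]])
       (intro C_k_add Suc.IH C_k_SucD[OF Suc.prems(1)] C_k_SucD[OF Suc.prems(2)], use Suc.prems in auto)
qed

text \<open>The family of all \<open>exp (- 1 / t) / t ^ m\<close>, extended by zero, spans a space closed under
  differentiation.\<close>

definition flat_exp :: "nat \<Rightarrow> real \<Rightarrow> real" where
  "flat_exp m t = (if t > 0 then exp (- 1 / t) / t ^ m else 0)"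

lemma flat_exp_tendsto_0: "(flat_exp m \<longlongrightarrow> 0) (at_right 0)"
proof -
  have "((\<lambda>t. inverse t ^ m / exp (inverse t)) \<longlongrightarrow> 0) (at_right (0::real))"
    by (rule filterlim_compose[OF tendsto_power_div_exp_0 filterlim_inverse_at_top_right])
  then show ?thesis
  proof (rule Lim_transform_eventually)
    show "\<forall>\<^sub>F t in at_right 0. inverse t ^ m / exp (inverse t) = flat_exp m t"
      by (auto simp: eventually_at_filter flat_exp_def exp_minus field_simps)
  qed
qed

lemma flat_exp_has_derivative:
  "(flat_exp m has_real_derivative flat_exp (m + 2) t - real m * flat_exp (m + 1) t) (at t)"
proof -
  consider "t > 0" | "t < 0" | "t = 0" by linarith
  then show ?thesis
  proof cases
    case 1
    have "((\<lambda>t. exp (- 1 / t) / t ^ m) has_real_derivative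
        (exp (- 1 / t) * (1 / t\<^sup>2) * t ^ m - exp (- 1 / t) * (real m * t ^ (m - 1))) / (t ^ m * t ^ m)) (at t)"
      using 1 by (auto intro!: derivative_eq_intros simp: power2_eq_square)
    moreover have "(exp (- 1 / t) * (1 / t\<^sup>2) * t ^ m - exp (- 1 / t) * (real m * t ^ (m - 1))) / (t ^ m * t ^ m)
        = flat_exp (m + 2) t - real m * flat_exp (m + 1) t"
      using 1 by (cases m) (auto simp: flat_exp_def field_simps power2_eq_square)
    ultimately have "((\<lambda>t. exp (- 1 / t) / t ^ m) has_real_derivative flat_exp (m + 2) t - real m * flat_exp (m + 1) t) (at t)"
      by simp
    then show ?thesis
      by (rule has_field_derivative_transform_within_open[of _ _ _ "{0<..}"]) (use 1 in \<open>auto simp: flat_exp_def\<close>)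
  next
    case 2
    have "((\<lambda>t::real. 0) has_real_derivative 0) (at t)" by simp
    then have "(flat_exp m has_real_derivative 0) (at t)"
      by (rule has_field_derivative_transform_within_open[of _ _ _ "{..<0}"]) (use 2 in \<open>auto simp: flat_exp_def\<close>)
    then show ?thesis using 2 by (simp add: flat_exp_def)
  next
    case 3
    \<comment> \<open>To the right of the origin the difference quotient is
      \<open>flat_exp (m + 1)\<close> itself, so the derivative vanishes by flatness one index
      higher.\<close>
    have "((\<lambda>h. (flat_exp m (0 + h) - flat_exp m 0) / h) \<longlongrightarrow> 0) (at 0)"
    proof (rule filterlim_split_at)
      show "((\<lambda>h. (flat_exp m (0 + h) - flat_exp m 0) / h) \<longlongrightarrow> 0) (at_left 0)"
        by (rule Lim_transform_eventually[OF tendsto_const]) (auto simp: eventually_at_filter flat_exp_def)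
      show "((\<lambda>h. (flat_exp m (0 + h) - flat_exp m 0) / h) \<longlongrightarrow> 0) (at_right 0)"
        by (rule Lim_transform_eventually[OF flat_exp_tendsto_0[of "m + 1"]])
           (auto simp: eventually_at_filter flat_exp_def field_simps)
    qed
    then show ?thesis using 3 by (simp add: has_field_derivative_def field_has_derivative_at flat_exp_def DERIV_def)
  qed
qed

text \<open>The induction keeps \<open>m\<close> arbitrary because a derivative involves the indices
  \<open>m + 1\<close> and \<open>m + 2\<close>. The square \<open>x \<bullet> x\<close> is used
  since, unlike the norm, it is smooth at the origin.\<close>

lemma C_k_flat_exp: "C_k k (\<lambda>x::'a::euclidean_space. flat_exp m (1 - c * (x \<bullet> x)))"
proof (induction k arbitrary: m)
  case 0
  have "continuous_on UNIV (flat_exp m)"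
    using flat_exp_has_derivative[of m] by (meson DERIV_isCont continuous_at_imp_continuous_on)
  then have "continuous_on UNIV (\<lambda>x::'a. flat_exp m (1 - c * (x \<bullet> x)))"
    by (rule continuous_on_compose2) (auto intro!: continuous_intros)
  then show ?case by simp
next
  case (Suc k)
  let ?D = "\<lambda>x::'a. flat_exp (m + 2) (1 - c * (x \<bullet> x)) + (- real m) * flat_exp (m + 1) (1 - c * (x \<bullet> x))"
  show ?case
  proof (rule C_k_SucI[where f'="\<lambda>x h. ?D x * ((- 2 * c) * (x \<bullet> h))"])
    fix x :: 'a
    have "((\<lambda>x. 1 - c * (x \<bullet> x)) has_derivative (\<lambda>h. (- 2 * c) * (x \<bullet> h))) (at x)"
      by (auto intro!: derivative_eq_intros simp: inner_commute)
    from has_derivative_compose[OF this flat_exp_has_derivative[unfolded has_field_derivative_def]]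
    show "((\<lambda>x. flat_exp m (1 - c * (x \<bullet> x))) has_derivative (\<lambda>h. ?D x * ((- 2 * c) * (x \<bullet> h)))) (at x)"
      by (simp add: algebra_simps)
  next
    fix b :: 'a assume "b \<in> Basis"
    show "C_k k (\<lambda>x. ?D x * ((- 2 * c) * (x \<bullet> b)))"
      by (intro C_k_mult C_k_add C_k_const C_k_inner Suc)
  qed
qed

section \<open>Convolution with a smooth kernel\<close>

lemma bounded_of_continuous_support:
  fixes f :: "'a::euclidean_space \<Rightarrow> real"
  assumes "continuous_on UNIV f" "\<And>x. norm x > e \<Longrightarrow> f x = 0"
  obtains M where "M \<ge> 0" "\<And>x. \<bar>f x\<bar> \<le> M"
proof -
  have "compact (f ` cball 0 e)"
    by (intro compact_continuous_image continuous_on_subset[OF assms(1)]) auto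
  then have "bounded (f ` cball 0 e)" by (rule compact_imp_bounded)
  then obtain M where "\<forall>y\<in>f ` cball 0 e. norm y \<le> M"
    unfolding bounded_iff by blast
  then have M: "\<And>x. norm x \<le> e \<Longrightarrow> \<bar>f x\<bar> \<le> M" by simp
  have "\<bar>f x\<bar> \<le> max M 0" for x
    using assms(2)[of x] M[of x] by (cases "norm x \<le> e") (auto simp: le_max_iff_disj)
  then show ?thesis using that[of "max M 0"] by auto
qed

text \<open>Differentiation under the integral for a merely integrable \<open>v\<close>: the
  remainder quotient \<open>q h\<close> of the kernel tends to zero pointwise and is bounded by
  \<open>2 * M\<close>, with \<open>M\<close> a Lipschitz constant of \<open>\<psi>\<close>, so
  \<open>2 * M * \<bar>v y\<bar>\<close> dominates.\<close>

lemma convolution_has_derivative: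
  fixes v \<psi> :: "'a::euclidean_space \<Rightarrow> real"
  assumes v: "integrable lborel v"
    and D: "\<And>z. (\<psi> has_derivative \<psi>' z) (at z)"
    and cont: "\<And>b. b \<in> Basis \<Longrightarrow> continuous_on UNIV (\<lambda>z. \<psi>' z b)"
    and supp: "\<And>z. norm z > e \<Longrightarrow> \<psi> z = 0" "\<And>z b. norm z > e \<Longrightarrow> \<psi>' z b = 0"
  shows "((\<lambda>x. \<integral>y. v y * \<psi> (x - y) \<partial>lborel) has_derivative
    (\<lambda>h. \<Sum>b\<in>Basis. (h \<bullet> b) * (\<integral>y. v y * \<psi>' (x - y) b \<partial>lborel))) (at x)"
proof -
  have [measurable]: "v \<in> borel_measurable borel" using v by auto
  have c\<psi>: "continuous_on UNIV \<psi>"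
    using D by (meson has_derivative_continuous continuous_at_imp_continuous_on)
  have [measurable]: "\<psi> \<in> borel_measurable borel"
    using c\<psi> by (rule borel_measurable_continuous_onI)
  have m [measurable]: "(\<lambda>z. \<psi>' z b) \<in> borel_measurable borel" if "b \<in> Basis" for b
    using cont[OF that] by (rule borel_measurable_continuous_onI)
  \<comment> \<open>Continuity, and thus measurability and boundedness, of the derivative is given
    in basis directions only, so other directions are reduced to these.\<close>
  have expand: "\<psi>' z h = (\<Sum>b\<in>Basis. (h \<bullet> b) * \<psi>' z b)" for z h
  proof -
    have lin: "linear (\<psi>' z)" using D[of z] by (simp add: has_derivative_linear)
    have "\<psi>' z h = \<psi>' z (\<Sum>b\<in>Basis. (h \<bullet> b) *\<^sub>R b)" by (simp add: euclidean_representation)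
    also have "\<dots> = (\<Sum>b\<in>Basis. (h \<bullet> b) * \<psi>' z b)"
      by (simp add: linear_sum[OF lin] linear_scale[OF lin])
    finally show ?thesis .
  qed
  have "\<exists>M\<ge>0. \<forall>z. \<bar>\<psi>' z b\<bar> \<le> M" if "b \<in> Basis" for b
    using bounded_of_continuous_support[OF cont[OF that] supp(2)] by blast
  then obtain B where B: "\<And>b. b \<in> Basis \<Longrightarrow> B b \<ge> 0" "\<And>b z. b \<in> Basis \<Longrightarrow> \<bar>\<psi>' z b\<bar> \<le> B b"
    by metis
  define M where "M = sum B Basis"
  have M: "M \<ge> 0" unfolding M_def using B(1) by (rule sum_nonneg)
  have norm\<psi>': "\<bar>\<psi>' z h\<bar> \<le> M * norm h" for z h
  proof -
    have "\<bar>\<psi>' z h\<bar> \<le> (\<Sum>b\<in>Basis. \<bar>(h \<bullet> b) * \<psi>' z b\<bar>)"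
      unfolding expand[of z h] by (rule sum_abs)
    also have "\<dots> \<le> (\<Sum>b\<in>Basis. norm h * B b)"
      using B Basis_le_norm by (intro sum_mono) (auto simp: abs_mult intro!: mult_mono)
    also have "\<dots> = M * norm h" by (simp add: M_def sum_distrib_left mult.commute)
    finally show ?thesis .
  qed
  have lip: "\<bar>\<psi> a - \<psi> b\<bar> \<le> M * norm (a - b)" for a b
  proof -
    have "onorm (\<psi>' z) \<le> M" for z by (rule onorm_bound[OF M]) (simp add: norm\<psi>')
    then show ?thesis using differentiable_bound[of UNIV \<psi> \<psi>' M a b] D by simp
  qed
  obtain S where S: "S \<ge> 0" "\<And>z. \<bar>\<psi> z\<bar> \<le> S" using bounded_of_continuous_support[OF c\<psi> supp(1)] by blast
  have int: "integrable lborel (\<lambda>y. v y * \<psi> (x - y))" for x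
    by (rule Bochner_Integration.integrable_bound[where f="\<lambda>y. S * v y"])
       (use v S in \<open>auto simp: abs_mult mult.commute[of "\<bar>v _\<bar>"] intro!: mult_right_mono\<close>)
  have int': "integrable lborel (\<lambda>y. v y * \<psi>' (x - y) b)" if b: "b \<in> Basis" for x b
  proof (rule Bochner_Integration.integrable_bound[where f="\<lambda>y. B b * v y"])
    show "(\<lambda>y. v y * \<psi>' (x - y) b) \<in> borel_measurable lborel"
      using m[OF b] by measurable
    show "AE y in lborel. norm (v y * \<psi>' (x - y) b) \<le> norm (B b * v y)"
      using B[OF b] by (auto simp: abs_mult mult.commute[of "\<bar>v _\<bar>"] intro!: mult_right_mono)
  qed (use v in auto)
  define q where "q h z = (\<psi> (z + h) - \<psi> z - \<psi>' z h) / norm h" for h z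
  have [measurable]: "q h \<in> borel_measurable borel" for h
    unfolding q_def expand[of _ h] using m by measurable
  have q_bound: "\<bar>q h z\<bar> \<le> 2 * M" for h z
  proof (cases "h = 0")
    case False
    have "\<bar>\<psi> (z + h) - \<psi> z - \<psi>' z h\<bar> \<le> \<bar>\<psi> (z + h) - \<psi> z\<bar> + \<bar>\<psi>' z h\<bar>" by (rule abs_triangle_ineq4)
    also have "\<dots> \<le> M * norm h + M * norm h" using lip[of "z + h" z] norm\<psi>'[of z h] by (intro add_mono) auto
    finally show ?thesis using False by (simp add: q_def pos_divide_le_eq)
  qed (simp add: q_def M)
  have q_lim: "((\<lambda>h. q h z) \<longlongrightarrow> 0) (at 0)" for z
  proof -
    have "((\<lambda>h. norm (\<psi> (z + h) - \<psi> z - \<psi>' z h) / norm h) \<longlongrightarrow> 0) (at 0)"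
      using D[of z] by (simp add: has_derivative_at)
    then have "((\<lambda>h. \<bar>q h z\<bar>) \<longlongrightarrow> 0) (at 0)" by (simp add: q_def)
    then show ?thesis by (rule tendsto_rabs_zero_cancel)
  qed
  have conv_lim: "((\<lambda>h. \<integral>y. v y * q h (x - y) \<partial>lborel) \<longlongrightarrow> 0) (at 0)"
    unfolding tendsto_at_iff_sequentially comp_def
  proof (intro allI impI)
    fix X :: "nat \<Rightarrow> 'a" assume X: "\<forall>i. X i \<in> UNIV - {0}" "X \<longlonglongrightarrow> 0"
    have "(\<lambda>i. \<integral>y. v y * q (X i) (x - y) \<partial>lborel) \<longlonglongrightarrow> (\<integral>y. 0 \<partial>(lborel :: 'a measure))"
    proof (rule integral_dominated_convergence[where w="\<lambda>y. 2 * M * \<bar>v y\<bar>"])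
      show "AE y in lborel. (\<lambda>i. v y * q (X i) (x - y)) \<longlonglongrightarrow> 0"
      proof (rule AE_I2)
        fix y
        have "(\<lambda>i. q (X i) (x - y)) \<longlonglongrightarrow> 0"
          using q_lim[of "x - y", unfolded tendsto_at_iff_sequentially] X by (auto simp: comp_def)
        then show "(\<lambda>i. v y * q (X i) (x - y)) \<longlonglongrightarrow> 0" by (rule tendsto_mult_right_zero)
      qed
      show "AE y in lborel. norm (v y * q (X i) (x - y)) \<le> 2 * M * \<bar>v y\<bar>" for i
        using q_bound by (auto simp: abs_mult mult.commute[of "\<bar>v _\<bar>"] intro!: AE_I2 mult_right_mono)
    qed (use v in auto)
    then show "(\<lambda>i. \<integral>y. v y * q (X i) (x - y) \<partial>lborel) \<longlonglongrightarrow> 0" by simp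
  qed
  let ?F = "\<lambda>x. \<integral>y. v y * \<psi> (x - y) \<partial>lborel"
  let ?L = "\<lambda>h. \<Sum>b\<in>Basis. (h \<bullet> b) * (\<integral>y. v y * \<psi>' (x - y) b \<partial>lborel)"
  have eq: "(?F (x + h) - ?F x - ?L h) / norm h = (\<integral>y. v y * q h (x - y) \<partial>lborel)" for h
  proof -
    have "?L h = (\<integral>y. (\<Sum>b\<in>Basis. (h \<bullet> b) * (v y * \<psi>' (x - y) b)) \<partial>lborel)"
      using int' by simp
    moreover have "integrable lborel (\<lambda>y. \<Sum>b\<in>Basis. (h \<bullet> b) * (v y * \<psi>' (x - y) b))"
      using int' by simp
    ultimately have "?F (x + h) - ?F x - ?L h =
        (\<integral>y. v y * \<psi> (x + h - y) - v y * \<psi> (x - y) - (\<Sum>b\<in>Basis. (h \<bullet> b) * (v y * \<psi>' (x - y) b)) \<partial>lborel)"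
      using int by simp
    also have "\<dots> = (\<integral>y. v y * (\<psi> ((x - y) + h) - \<psi> (x - y) - \<psi>' (x - y) h) \<partial>lborel)"
    proof (intro Bochner_Integration.integral_cong refl)
      fix y
      have "x + h - y = (x - y) + h" by simp
      moreover have "(\<Sum>b\<in>Basis. (h \<bullet> b) * (v y * \<psi>' (x - y) b)) = v y * \<psi>' (x - y) h"
        unfolding expand[of "x - y" h] sum_distrib_left by (intro sum.cong refl) simp
      ultimately show "v y * \<psi> (x + h - y) - v y * \<psi> (x - y) - (\<Sum>b\<in>Basis. (h \<bullet> b) * (v y * \<psi>' (x - y) b))
          = v y * (\<psi> ((x - y) + h) - \<psi> (x - y) - \<psi>' (x - y) h)"
        by (simp only: right_diff_distrib)
    qed
    finally show ?thesis by (simp add: q_def)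
  qed
  have "((\<lambda>h. norm (?F (x + h) - ?F x - ?L h) / norm h) \<longlongrightarrow> 0) (at 0)"
  proof -
    have "norm (?F (x + h) - ?F x - ?L h) / norm h = \<bar>\<integral>y. v y * q h (x - y) \<partial>lborel\<bar>" for h
      unfolding eq[symmetric] by simp
    then show ?thesis using tendsto_rabs_zero[OF conv_lim] by simp
  qed
  moreover have "bounded_linear ?L"
    by (intro bounded_linear_sum bounded_linear_mult_const bounded_linear_inner_left)
  ultimately show ?thesis by (simp add: has_derivative_at)
qed

text \<open>A partial derivative of the convolution is a convolution with a partial derivative of
  the kernel, which is again smooth with support in the same ball. The induction therefore runs over
  all such kernels.\<close>

lemma convolution_C_k:
  fixes v \<psi> :: "'a::euclidean_space \<Rightarrow> real"
  assumes v: "integrable lborel v" and \<psi>: "\<And>j. C_k j \<psi>" "\<And>z. norm z > e \<Longrightarrow> \<psi> z = 0"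
  shows "C_k k (\<lambda>x. \<integral>y. v y * \<psi> (x - y) \<partial>lborel)"
  using \<psi>
proof (induction k arbitrary: \<psi>)
  let ?d = "\<lambda>\<psi>::'a \<Rightarrow> real. \<lambda>z. frechet_derivative \<psi> (at z)"
  have d: "((\<lambda>x. \<integral>y. v y * \<psi> (x - y) \<partial>lborel) has_derivative
    (\<lambda>h. \<Sum>b\<in>Basis. (h \<bullet> b) * (\<integral>y. v y * ?d \<psi> (x - y) b \<partial>lborel))) (at x)"
    and zero: "\<And>z b. norm z > e \<Longrightarrow> ?d \<psi> z b = 0"
    if \<psi>: "\<And>j. C_k j \<psi>" "\<And>z. norm z > e \<Longrightarrow> \<psi> z = 0" for \<psi> x
  proof -
    have D: "(\<psi> has_derivative ?d \<psi> z) (at z)" for z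
      using \<psi>(1)[of 1] C_k_Suc_has_derivative[of 0] by simp
    \<comment> \<open>The strict inequality makes the region where \<open>\<psi>\<close> is known to
      vanish open, so its derivative vanishes there as well.\<close>
    show z: "?d \<psi> z b = 0" if "norm z > e" for z b
    proof -
      have o: "open {z::'a. norm z > e}"
        by (intro open_Collect_less continuous_on_const continuous_on_norm continuous_on_id)
      have "((\<lambda>_. 0) has_derivative (\<lambda>_. 0)) (at z)" by simp
      then have "(\<psi> has_derivative (\<lambda>_. 0)) (at z)"
        by (rule has_derivative_transform_within_open[OF _ o]) (simp_all add: that \<psi>(2))
      then have "?d \<psi> z = (\<lambda>_. 0)" by (rule has_derivative_unique[OF D])
      then show ?thesis by simp
    qed
    show "((\<lambda>x. \<integral>y. v y * \<psi> (x - y) \<partial>lborel) has_derivative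
      (\<lambda>h. \<Sum>b\<in>Basis. (h \<bullet> b) * (\<integral>y. v y * ?d \<psi> (x - y) b \<partial>lborel))) (at x)"
      by (rule convolution_has_derivative[OF v D _ \<psi>(2) z]) (use \<psi>(1)[of 1] in auto)
  qed
  {
    case 0
    show ?case
      using d[OF 0] by (auto intro!: continuous_at_imp_continuous_on has_derivative_continuous)
  next
    case (Suc k)
    show ?case
    proof (rule C_k_SucI[OF d[OF Suc.prems]])
      fix b :: 'a assume b: "b \<in> Basis"
      have "C_k j (\<lambda>z. ?d \<psi> z b)" for j
        using Suc.prems(1)[of "Suc j"] b by simp
      then have "C_k k (\<lambda>x. \<integral>y. v y * ?d \<psi> (x - y) b \<partial>lborel)"
        by (rule Suc.IH) (rule zero[OF Suc.prems])
      moreover have "(\<Sum>c\<in>Basis. (b \<bullet> c) * (\<integral>y. v y * ?d \<psi> (x - y) c \<partial>lborel)) = (\<integral>y. v y * ?d \<psi> (x - y) b \<partial>lborel)" for x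
        using b by (subst sum.remove[OF _ b]) (auto simp: inner_Basis intro!: sum.neutral split: if_splits)
      ultimately show "C_k k (\<lambda>x. \<Sum>c\<in>Basis. (b \<bullet> c) * (\<integral>y. v y * ?d \<psi> (x - y) c \<partial>lborel))"
        by simp
    qed
  }
qed

text \<open>The support lies in the sum of \<open>K\<close> and the ball of radius \<open>e\<close>,
  which is compact and inside the domain.\<close>

lemma convolution_test_function:
  fixes v \<psi> :: "'a::euclidean_space \<Rightarrow> real"
  assumes v: "integrable lborel v" and K: "compact K" "\<And>x. x \<notin> K \<Longrightarrow> v x = 0"
    and \<psi>: "\<And>j. C_k j \<psi>" "\<And>z. norm z > e \<Longrightarrow> \<psi> z = 0"
    and sub: "\<And>x y. x \<in> K \<Longrightarrow> norm y \<le> e \<Longrightarrow> x + y \<in> \<Omega>"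
  shows "(\<lambda>x. \<integral>y. v y * \<psi> (x - y) \<partial>lborel) \<in> test_functions \<Omega>"
proof -
  let ?S = "{x + y |x y. x \<in> K \<and> y \<in> cball 0 e}"
  have S: "compact ?S" by (rule compact_sums[OF K(1) compact_cball])
  have sub': "{x. (\<integral>y. v y * \<psi> (x - y) \<partial>lborel) \<noteq> 0} \<subseteq> ?S"
  proof
    fix x assume "x \<in> {x. (\<integral>y. v y * \<psi> (x - y) \<partial>lborel) \<noteq> 0}"
    then have "\<exists>y. v y * \<psi> (x - y) \<noteq> 0"
      by (metis (mono_tags, lifting) Bochner_Integration.integral_cong integral_zero mem_Collect_eq)
    then obtain y where "v y \<noteq> 0" "\<psi> (x - y) \<noteq> 0" by auto
    then have "y \<in> K" "norm (x - y) \<le> e" using K(2) \<psi>(2)[of "x - y"] by (auto simp: not_le[symmetric])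
    then show "x \<in> ?S" by (intro CollectI exI[of _ y] exI[of _ "x - y"]) auto
  qed
  then have cl: "closure {x. (\<integral>y. v y * \<psi> (x - y) \<partial>lborel) \<noteq> 0} \<subseteq> ?S"
    by (rule closure_minimal) (use S compact_imp_closed in blast)
  have "compact (closure {x. (\<integral>y. v y * \<psi> (x - y) \<partial>lborel) \<noteq> 0})"
    using compact_closure bounded_subset[OF compact_imp_bounded[OF S] sub'] by blast
  moreover have "?S \<subseteq> \<Omega>" using sub by auto
  ultimately show ?thesis
    unfolding test_functions_def using cl convolution_C_k[OF v \<psi>] by blast
qed

text \<open>That \<open>C\<close> serves all radii matters: the height \<open>C / e ^ n\<close> of
  the kernel has to cancel the volume factor \<open>r ^ n\<close> of \<open>frac_L1_estimate\<close>
  at \<open>r = e\<close>.\<close>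

lemma ex_mollifier:
  obtains C where "C > 0"
    "\<And>e. e > 0 \<Longrightarrow> \<exists>\<rho>::'a::euclidean_space \<Rightarrow> real. (\<forall>k. C_k k \<rho>) \<and> (\<forall>x. 0 \<le> \<rho> x \<and> \<rho> x \<le> C / e ^ DIM('a)) \<and>
      (\<forall>x. norm x \<ge> e \<longrightarrow> \<rho> x = 0) \<and> (\<integral>\<^sup>+x. ennreal (\<rho> x) \<partial>lborel) = 1"
proof -
  define n where "n = DIM('a)"
  define V where "V = unit_ball_vol (real n)"
  have V: "V > 0" unfolding V_def by simp
  \<comment> \<open>On the ball of half the radius the argument of \<open>flat_exp 0\<close> is at
    least \<open>3/4\<close>, so the bump is at least \<open>exp (- 4/3)\<close> there.
    \<open>C / e ^ n\<close> is the reciprocal of this value times the volume of that ball.\<close>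
  define C where "C = 2 ^ n * exp (4/3) / V"
  show ?thesis
  proof (rule that[of C])
    show "C > 0" using V by (simp add: C_def)
    fix e :: real assume e: "e > 0"
    define f where "f x = flat_exp 0 (1 - (1 / e\<^sup>2) * (x \<bullet> x))" for x :: 'a
    have Cf: "C_k k f" for k unfolding f_def by (rule C_k_flat_exp)
    have [measurable]: "f \<in> borel_measurable borel"
      by (rule borel_measurable_continuous_onI[OF C_k_continuous[OF Cf[of 0]]])
    have f01: "0 \<le> f x" "f x \<le> 1" for x by (auto simp: f_def flat_exp_def)
    have f0: "f x = 0" if "norm x \<ge> e" for x
    proof -
      have "e\<^sup>2 \<le> x \<bullet> x" using that e by (simp add: power2_norm_eq_inner[symmetric] power_mono)
      then show ?thesis using e by (simp add: f_def flat_exp_def)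
    qed
    have fl: "exp (- 4/3) \<le> f x" if "x \<in> ball 0 (e / 2)" for x
    proof -
      have "(norm x)\<^sup>2 \<le> (e / 2)\<^sup>2" using that by (intro power_mono) auto
      then have "x \<bullet> x \<le> e\<^sup>2 / 4" by (simp add: power2_norm_eq_inner power_divide)
      then have t: "1 - (1 / e\<^sup>2) * (x \<bullet> x) \<ge> 3/4" using e by (simp add: field_simps)
      define t where "t = 1 - (1 / e\<^sup>2) * (x \<bullet> x)"
      have "t \<ge> 3/4" using t by (simp add: t_def)
      then have "exp (- 4/3) \<le> exp (- 1 / t)" by (simp add: field_simps)
      then have "exp (- 4/3) \<le> flat_exp 0 t" using \<open>t \<ge> 3/4\<close> by (simp add: flat_exp_def)
      then show ?thesis by (simp only: f_def t_def)
    qed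
    let ?I = "\<integral>\<^sup>+x. ennreal (f x) \<partial>lborel"
    have "?I \<le> (\<integral>\<^sup>+x. indicator (ball 0 e) x \<partial>(lborel :: 'a measure))"
      using f01 f0 by (intro nn_integral_mono) (auto simp: indicator_def)
    also have "\<dots> < \<infinity>" by (simp add: emeasure_ball e less_imp_le)
    finally have "?I < \<infinity>" .
    then obtain I where I: "I \<ge> 0" "?I = ennreal I" by (cases ?I) auto
    have "ennreal (exp (- 4/3) * (V * (e / 2) ^ n)) = (\<integral>\<^sup>+x. ennreal (exp (- 4/3)) * indicator (ball 0 (e / 2)) x \<partial>(lborel :: 'a measure))"
      using e V by (simp add: nn_integral_cmult_indicator emeasure_ball V_def n_def ennreal_mult)
    also have "\<dots> \<le> ?I"
      using fl f01 by (intro nn_integral_mono) (auto simp: indicator_def intro!: ennreal_leI)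
    finally have IV: "exp (- 4/3) * (V * (e / 2) ^ n) \<le> I" using I by (simp add: ennreal_le_iff)
    moreover have "0 < exp (- 4/3 :: real) * (V * (e / 2) ^ n)" using V e by simp
    ultimately have Ip: "I > 0" by linarith
    have "1 / I \<le> 1 / (exp (- 4/3) * (V * (e / 2) ^ n))"
      using IV V e Ip by (intro divide_left_mono) auto
    also have "\<dots> = C / e ^ n" using V e by (simp add: C_def field_simps exp_minus power_divide)
    finally have IC: "1 / I \<le> C / e ^ n" .
    let ?r = "\<lambda>x. (1 / I) * f x"
    have "?r x \<le> C / e ^ n" for x
    proof -
      have "(1 / I) * f x \<le> (1 / I) * 1" using Ip f01(2) by (intro mult_left_mono) auto
      then show ?thesis using IC by simp
    qed
    moreover have "(\<integral>\<^sup>+x. ennreal (?r x) \<partial>lborel) = 1"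
    proof -
      have "(\<integral>\<^sup>+x. ennreal (?r x) \<partial>lborel) = (\<integral>\<^sup>+x. ennreal (1 / I) * ennreal (f x) \<partial>lborel)"
        using Ip by (intro nn_integral_cong ennreal_mult') simp
      also have "\<dots> = ennreal (1 / I) * ennreal I"
        by (subst nn_integral_cmult) (auto simp: I)
      also have "\<dots> = 1" using Ip by (simp add: ennreal_mult'[symmetric])
      finally show ?thesis .
    qed
    moreover have "C_k k ?r" for k by (intro C_k_mult C_k_const Cf)
    ultimately show "\<exists>\<rho>::'a \<Rightarrow> real. (\<forall>k. C_k k \<rho>) \<and> (\<forall>x. 0 \<le> \<rho> x \<and> \<rho> x \<le> C / e ^ DIM('a)) \<and>
      (\<forall>x. norm x \<ge> e \<longrightarrow> \<rho> x = 0) \<and> (\<integral>\<^sup>+x. ennreal (\<rho> x) \<partial>lborel) = 1"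
      using Ip f01(1) f0 unfolding n_def by (intro exI[of _ ?r]) auto
  qed
qed

section \<open>The singular measure\<close>

lemma frac_density_measurable:
  "(\<lambda>(x, y). ennreal (1 / norm (x - y) ^ DIM('a))) \<in> borel_measurable (borel :: ('a::euclidean_space \<times> 'a) measure)"
  unfolding borel_prod[symmetric] by measurable

text \<open>Completion does not change the integral of a Borel function, so the energy becomes an
  iterated integral over \<open>lborel\<close>, the form in which it is estimated.\<close>

lemma nn_integral_frac_measure:
  fixes f :: "'a::euclidean_space \<times> 'a \<Rightarrow> ennreal"
  assumes [measurable]: "f \<in> borel_measurable borel"
  shows "(\<integral>\<^sup>+z. f z \<partial>frac_measure) =
    (\<integral>\<^sup>+x. \<integral>\<^sup>+y. ennreal (1 / norm (x - y) ^ DIM('a)) * f (x, y) \<partial>lborel \<partial>lborel)"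
proof -
  let ?d = "\<lambda>(x, y). ennreal (1 / norm (x - y) ^ DIM('a))"
  note [measurable] = frac_density_measurable
  have "(\<integral>\<^sup>+z. f z \<partial>frac_measure) = (\<integral>\<^sup>+z. ?d z * f z \<partial>lebesgue)"
    unfolding frac_measure_def
    by (rule nn_integral_density) (auto intro!: measurable_completion)
  also have "\<dots> = (\<integral>\<^sup>+z. ?d z * f z \<partial>(lborel \<Otimes>\<^sub>M lborel))"
    by (simp add: nn_integral_completion lborel_prod)
  also have "\<dots> = (\<integral>\<^sup>+x. \<integral>\<^sup>+y. ?d (x, y) * f (x, y) \<partial>lborel \<partial>lborel)"
    by (rule lborel.nn_integral_fst[symmetric]) (simp add: lborel_prod)
  finally show ?thesis by simp
qed

lemma sets_frac_measure [measurable_cong, simp]: "sets frac_measure = sets lebesgue"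
  and space_frac_measure [simp]: "space frac_measure = UNIV"
  by (auto simp: frac_measure_def)

lemma borel_measurable_frac_measureI:
  "f \<in> borel_measurable borel \<Longrightarrow> f \<in> borel_measurable frac_measure"
  unfolding measurable_cong_sets[OF sets_frac_measure refl] by (auto intro!: measurable_completion)

text \<open>A null set times the whole space is null. Hence changing \<open>u\<close> on a null set
  changes its difference quotient only on a null set of pairs.\<close>

lemma AE_lebesgue_fst:
  assumes "AE x in (lebesgue :: 'a::euclidean_space measure). P x"
  shows "AE z in (lebesgue :: ('a \<times> 'b::euclidean_space) measure). P (fst z)"
    and "AE z in (lebesgue :: ('b \<times> 'a) measure). P (snd z)"
proof -
  have "AE x in (lborel :: 'a measure). P x" using assms by (simp add: AE_completion_iff)
  then obtain N where N: "{x. \<not> P x} \<subseteq> N" "N \<in> null_sets lborel"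
    by (auto elim!: AE_E simp: null_sets_def)
  have "N \<times> UNIV \<in> null_sets (lborel \<Otimes>\<^sub>M (lborel :: 'b measure))"
    using N by (intro lborel.times_in_null_sets1) auto
  then have "AE z in (lborel :: ('a \<times> 'b) measure). P (fst z)"
    using N by (intro AE_I'[of "N \<times> UNIV"]) (auto simp: lborel_prod)
  then show "AE z in (lebesgue :: ('a \<times> 'b) measure). P (fst z)" by (rule AE_completion)
  have "UNIV \<times> N \<in> null_sets ((lborel :: 'b measure) \<Otimes>\<^sub>M lborel)"
    using N by (intro lborel.times_in_null_sets2) auto
  then have "AE z in (lborel :: ('b \<times> 'a) measure). P (snd z)"
    using N by (intro AE_I'[of "UNIV \<times> N"]) (auto simp: lborel_prod)
  then show "AE z in (lebesgue :: ('b \<times> 'a) measure). P (snd z)" by (rule AE_completion)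
qed

lemma AE_frac_measure:
  assumes "AE x in lebesgue. P x"
  shows "AE z in frac_measure. P (fst z) \<and> P (snd z)"
proof -
  have "(\<lambda>(x, y). ennreal (1 / norm (x - y) ^ DIM('a))) \<in> borel_measurable (lebesgue :: ('a \<times> 'a) measure)"
    using frac_density_measurable by (auto intro!: measurable_completion)
  moreover have "AE z in lebesgue. P (fst z) \<and> P (snd z)"
    using AE_lebesgue_fst[OF assms, where 'b='a] by eventually_elim simp
  ultimately show ?thesis
    unfolding frac_measure_def by (subst AE_density) (auto elim: eventually_mono)
qed

lemma borel_representative:
  assumes "u \<in> borel_measurable lebesgue"
  obtains v :: "'a::euclidean_space \<Rightarrow> real" where "v \<in> borel_measurable borel" "AE x in lebesgue. u x = v x"
  using completion_ex_borel_measurable_real[OF assms] by (auto simp: AE_completion_iff)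

lemma frac_quot_borel_measurable [measurable]:
  assumes [measurable]: "u \<in> borel_measurable borel"
  shows "frac_quot s u \<in> borel_measurable borel"
  unfolding frac_quot_def borel_prod[symmetric] by measurable

lemma frac_quot_cong_AE:
  assumes "AE x in lebesgue. u x = v x"
  shows "AE z in frac_measure. frac_quot s u z = frac_quot s v z"
  using AE_frac_measure[OF assms] by eventually_elim (auto simp: frac_quot_def split: prod.splits)

text \<open>For a Borel representative this is composition with the projections; completeness of
  \<open>lebesgue\<close> carries measurability over to functions that agree almost
  everywhere.\<close>

lemma frac_quot_measurable:
  fixes u :: "'a::euclidean_space \<Rightarrow> real"
  assumes "u \<in> borel_measurable lebesgue"
  shows "frac_quot s u \<in> borel_measurable frac_measure"
proof -
  obtain v where v: "v \<in> borel_measurable borel" "AE x in lebesgue. u x = v x"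
    using borel_representative[OF assms] by blast
  have m: "frac_quot s v \<in> borel_measurable lebesgue"
    using frac_quot_borel_measurable[OF v(1)] by (auto intro!: measurable_completion)
  have "AE z in lebesgue. frac_quot s v z = frac_quot s u z"
    using AE_lebesgue_fst[OF v(2), where 'b='a] by eventually_elim (auto simp: frac_quot_def split: prod.splits)
  then have "frac_quot s u \<in> borel_measurable lebesgue"
    by (rule borel_measurable_AE[OF m])
  then show ?thesis by (simp cong: measurable_cong_sets)
qed

lemma frac_modular_cong_AE:
  assumes "AE x in lebesgue. u x = v x"
  shows "orlicz_modular G frac_measure (\<lambda>z. frac_quot s u z / L) = orlicz_modular G frac_measure (\<lambda>z. frac_quot s v z / L)"
  by (rule orlicz_modular_cong, use frac_quot_cong_AE[OF assms, of s] in eventually_elim) simp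

lemma frac_quot_tendsto:
  assumes "AE x in lebesgue. (\<lambda>k. u k x) \<longlonglongrightarrow> v x"
  shows "AE z in frac_measure. (\<lambda>k. frac_quot s (u k) z) \<longlonglongrightarrow> frac_quot s v z"
  using AE_frac_measure[OF assms]
proof eventually_elim
  case (elim z)
  show ?case unfolding frac_quot_def case_prod_beta divide_inverse
    by (intro tendsto_intros) (use elim in auto)
qed

lemma frac_modular_eq:
  fixes u :: "'a::euclidean_space \<Rightarrow> real"
  assumes \<Phi>: "orlicz_function \<Phi>" and [measurable]: "u \<in> borel_measurable borel"
  shows "orlicz_modular \<Phi> frac_measure (\<lambda>z. frac_quot s u z / L) =
    (\<integral>\<^sup>+x. \<integral>\<^sup>+y. ennreal (1 / norm (x - y) ^ DIM('a)) * ennreal (\<Phi> \<bar>(u x - u y) / norm (x - y) powr s / L\<bar>) \<partial>lborel \<partial>lborel)"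
proof -
  note [measurable] = borel_measurable_orlicz_function[OF \<Phi>]
  have "(\<lambda>z. ennreal (\<Phi> \<bar>frac_quot s u z / L\<bar>)) \<in> borel_measurable borel" by measurable
  from nn_integral_frac_measure[OF this] show ?thesis
    by (simp add: orlicz_modular_def frac_quot_def)
qed

section \<open>Radial kernels\<close>

lemma ex_dyadic:
  fixes x :: real
  assumes "x \<ge> 1"
  obtains j :: nat where "2 ^ j \<le> x" "x < 2 ^ Suc j"
proof -
  obtain m :: nat where m: "x < 2 ^ m" using real_arch_pow[of 2 x] by auto
  define k where "k = (LEAST m::nat. x < 2 ^ m)"
  have k: "x < 2 ^ k" unfolding k_def using m by (rule LeastI)
  have "k \<noteq> 0" using k assms by (intro notI) simp
  then obtain j where j: "k = Suc j" by (cases k) auto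
  have "\<not> x < 2 ^ j" using not_less_Least[of j "\<lambda>m. x < 2 ^ m"] j by (simp add: k_def)
  then show ?thesis using that[of j] k j by simp
qed

text \<open>A substitute for polar coordinates: \<open>c j\<close> bounds \<open>f\<close> on the
  shell number \<open>j\<close>, and the shell is enlarged to the full ball of radius
  \<open>\<rho> j\<close>. Geometric decay of the products makes this generosity harmless.\<close>

lemma nn_integral_dyadic:
  fixes f :: "'a::euclidean_space \<Rightarrow> ennreal"
  assumes q: "0 \<le> q" "q < 1" and K: "0 \<le> K"
    and \<rho>: "\<And>j. 0 \<le> \<rho> j" "\<And>j. 0 \<le> c j" "\<And>j. c j * \<rho> j ^ DIM('a) \<le> K * q ^ j"
    and f: "\<And>z. f z \<noteq> 0 \<Longrightarrow> \<exists>j::nat. norm z < \<rho> j \<and> f z \<le> ennreal (c j)"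
  shows "(\<integral>\<^sup>+z. f z \<partial>lborel) \<le> ennreal (unit_ball_vol DIM('a) * K / (1 - q))"
proof -
  let ?V = "unit_ball_vol (real DIM('a))"
  have "(\<integral>\<^sup>+z. f z \<partial>lborel) \<le> (\<integral>\<^sup>+z. (\<Sum>j. ennreal (c j) * indicator (ball 0 (\<rho> j)) z) \<partial>(lborel :: 'a measure))"
  proof (rule nn_integral_mono)
    fix z :: 'a
    show "f z \<le> (\<Sum>j. ennreal (c j) * indicator (ball 0 (\<rho> j)) z)"
    proof (cases "f z = 0")
      case False
      then obtain j where j: "norm z < \<rho> j" "f z \<le> ennreal (c j)" using f by blast
      then have "f z \<le> (\<Sum>i\<in>{j}. ennreal (c i) * indicator (ball 0 (\<rho> i)) z)" by simp
      also have "\<dots> \<le> (\<Sum>j. ennreal (c j) * indicator (ball 0 (\<rho> j)) z)"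
        by (rule sum_le_suminf) auto
      finally show ?thesis .
    qed simp
  qed
  also have "\<dots> = (\<Sum>j. ennreal (c j) * emeasure lborel (ball (0::'a) (\<rho> j)))"
    by (subst nn_integral_suminf)
       (auto simp: nn_integral_cmult_indicator intro!: borel_measurable_times_ennreal borel_measurable_indicator)
  also have "\<dots> \<le> (\<Sum>j. ennreal (?V * K * q ^ j))"
  proof (intro suminf_le summableI)
    fix j
    have "ennreal (c j) * emeasure lborel (ball (0::'a) (\<rho> j)) = ennreal (?V * (c j * \<rho> j ^ DIM('a)))"
      using \<rho> by (simp add: emeasure_ball ennreal_mult'[symmetric] mult_ac)
    also have "\<dots> \<le> ennreal (?V * (K * q ^ j))"
      by (intro ennreal_leI mult_left_mono \<rho>) simp
    finally show "ennreal (c j) * emeasure lborel (ball (0::'a) (\<rho> j)) \<le> ennreal (?V * K * q ^ j)"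
      by (simp add: mult_ac)
  qed
  also have "\<dots> = ennreal (\<Sum>j. ?V * K * q ^ j)"
    using q K by (intro suminf_ennreal2 summable_mult summable_geometric) auto
  also have "(\<Sum>j. ?V * K * q ^ j) = ?V * K / (1 - q)"
    using q by (simp add: suminf_mult[OF summable_geometric] suminf_geometric)
  finally show ?thesis .
qed

lemma nn_integral_lborel_minus:
  fixes y :: "'a::euclidean_space"
  assumes [measurable]: "f \<in> borel_measurable borel"
  shows "(\<integral>\<^sup>+x. f (x - y) \<partial>lborel) = (\<integral>\<^sup>+x. f x \<partial>lborel)"
proof -
  have "(\<integral>\<^sup>+x. f x \<partial>lborel) = (\<integral>\<^sup>+x. f x \<partial>distr lborel borel ((+) (- y)))"
    by (simp only: lborel_distr_plus)
  also have "\<dots> = (\<integral>\<^sup>+x. f (x - y) \<partial>lborel)"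
    by (subst nn_integral_distr) auto
  finally show ?thesis by simp
qed

lemma half_powr_power: "((1/2::real) ^ j) powr a = ((1/2) powr a) ^ j"
  by (simp add: powr_realpow[symmetric] powr_powr mult.commute del: powr_realpow)

text \<open>On the shell between \<open>2 ^ j * d\<close> and \<open>2 ^ Suc j * d\<close> the
  integrand is largest at the inner radius, which gives \<open>c j\<close>, while
  \<open>\<rho> j\<close> is the outer radius. Scaling invariance makes the bound independent of
  \<open>d\<close>.\<close>

lemma radial_tail_integral:
  fixes s d :: real
  assumes s: "s > 0" and d: "d > 0"
  shows "(\<integral>\<^sup>+z. ennreal ((d / norm z) powr s / norm z ^ DIM('a)) * indicator {z. norm z \<ge> d} z \<partial>(lborel :: 'a::euclidean_space measure))
    \<le> ennreal (unit_ball_vol DIM('a) * 2 ^ DIM('a) / (1 - (1/2) powr s))"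
proof (rule nn_integral_dyadic[where \<rho>="\<lambda>j. 2 ^ Suc j * d" and c="\<lambda>j. ((1/2) powr s) ^ j / (2 ^ j * d) ^ DIM('a)"])
  show "(1 / 2) powr s < 1" using powr_less_mono2[of s "1/2" 1] s by simp
  show "((1/2) powr s) ^ j / (2 ^ j * d) ^ DIM('a) * (2 ^ Suc j * d) ^ DIM('a) \<le> 2 ^ DIM('a) * ((1/2) powr s) ^ j" for j
    using d by (simp add: power_mult_distrib)
  fix z :: 'a
  assume "ennreal ((d / norm z) powr s / norm z ^ DIM('a)) * indicator {z. norm z \<ge> d} z \<noteq> 0"
  then have z: "norm z \<ge> d" by (auto simp: indicator_def split: if_splits)
  then obtain j where j: "2 ^ j \<le> norm z / d" "norm z / d < 2 ^ Suc j"
    using ex_dyadic[of "norm z / d"] d by (auto simp: field_simps)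
  then have j': "2 ^ j * d \<le> norm z" "norm z < 2 ^ Suc j * d" using d by (auto simp: field_simps)
  have "norm z > 0" using z d by linarith
  then have "d / norm z \<le> d / (2 ^ j * d)" using j' d by (intro divide_left_mono mult_pos_pos) auto
  also have "\<dots> = (1/2) ^ j" using d by (simp add: power_one_over field_simps)
  finally have "(d / norm z) powr s \<le> ((1/2) ^ j) powr s" using s d by (intro powr_mono2) auto
  then have "(d / norm z) powr s / norm z ^ DIM('a) \<le> ((1/2) powr s) ^ j / (2 ^ j * d) ^ DIM('a)"
    unfolding half_powr_power using j' d by (intro frac_le power_mono) auto
  then show "\<exists>j. norm z < 2 ^ Suc j * d \<and>
      ennreal ((d / norm z) powr s / norm z ^ DIM('a)) * indicator {z. norm z \<ge> d} z \<le> ennreal (((1/2) powr s) ^ j / (2 ^ j * d) ^ DIM('a))"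
    using j' z by (intro exI[of _ j]) (auto intro: ennreal_leI)
qed (use d in auto)

text \<open>Here the shells shrink to the origin. The outer radius \<open>(1/2) ^ j * d\<close> can
  be attained, so the ball is taken twice as large to obtain a strict inequality; this turns the
  \<open>2 ^ n\<close> of the tail into \<open>4 ^ n\<close>.\<close>

lemma radial_core_integral:
  fixes a d :: real
  assumes a: "a > 0" and d: "d > 0"
  shows "(\<integral>\<^sup>+z. ennreal ((norm z / d) powr a / norm z ^ DIM('a)) * indicator {z. norm z < d} z \<partial>(lborel :: 'a::euclidean_space measure))
    \<le> ennreal (unit_ball_vol DIM('a) * 4 ^ DIM('a) / (1 - (1/2) powr a))"
proof (rule nn_integral_dyadic[where \<rho>="\<lambda>j. 2 * (1/2) ^ j * d" and c="\<lambda>j. ((1/2) powr a) ^ j / ((1/2) ^ Suc j * d) ^ DIM('a)"])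
  show "(1 / 2) powr a < 1" using powr_less_mono2[of a "1/2" 1] a by simp
  show "((1/2) powr a) ^ j / ((1/2) ^ Suc j * d) ^ DIM('a) * (2 * (1/2) ^ j * d) ^ DIM('a) \<le> 4 ^ DIM('a) * ((1/2) powr a) ^ j" for j
  proof -
    have "2 * (1/2) ^ j * d = 4 * ((1/2) ^ Suc j * d)" by simp
    then have "(2 * (1/2) ^ j * d) ^ DIM('a) = 4 ^ DIM('a) * ((1/2) ^ Suc j * d) ^ DIM('a)"
      by (metis power_mult_distrib)
    then show ?thesis using d by simp
  qed
  fix z :: 'a
  assume "ennreal ((norm z / d) powr a / norm z ^ DIM('a)) * indicator {z. norm z < d} z \<noteq> 0"
  then have z: "norm z < d" "norm z > 0" by (auto simp: indicator_def split: if_splits)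
  then obtain j where j: "2 ^ j \<le> d / norm z" "d / norm z < 2 ^ Suc j"
    using ex_dyadic[of "d / norm z"] by (auto simp: field_simps)
  have j1: "norm z / d \<le> (1/2) ^ j" using j(1) z d by (simp add: power_one_over field_simps)
  have j2: "(1/2) ^ Suc j * d \<le> norm z" using j(2) z d by (simp add: power_one_over field_simps)
  have "(norm z / d) powr a \<le> ((1/2) ^ j) powr a" using a d j1 by (intro powr_mono2) auto
  then have "(norm z / d) powr a / norm z ^ DIM('a) \<le> ((1/2) powr a) ^ j / ((1/2) ^ Suc j * d) ^ DIM('a)"
    unfolding half_powr_power using j2 d by (intro frac_le power_mono) auto
  moreover have "norm z < 2 * (1/2) ^ j * d"
  proof -
    have "norm z \<le> (1/2) ^ j * d" using j1 d by (simp add: field_simps)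
    also have "\<dots> < 2 * (1/2) ^ j * d" using d by simp
    finally show ?thesis .
  qed
  ultimately show "\<exists>j. norm z < 2 * (1/2) ^ j * d \<and>
      ennreal ((norm z / d) powr a / norm z ^ DIM('a)) * indicator {z. norm z < d} z \<le> ennreal (((1/2) powr a) ^ j / ((1/2) ^ Suc j * d) ^ DIM('a))"
    by (intro exI[of _ j]) (auto simp: indicator_def intro: ennreal_leI)
qed (use d in auto)

text \<open>Convexity extracts the kernel from \<open>\<Phi>\<close>. With \<open>r\<close> the
  distance, the argument is \<open>A / d powr s\<close> times a factor
  \<open>\<theta> \<le> 1\<close>, namely \<open>(d / r) powr s\<close> far away and
  \<open>(r / d) powr (1 - s)\<close> nearby. Then \<open>\<theta> / r ^ n\<close> is integrable at
  infinity because \<open>s > 0\<close> and at the origin because \<open>s < 1\<close>.\<close>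

lemma radial_kernel_bound:
  fixes s :: real
  assumes s: "0 < s" "s < 1"
  obtains C where "C \<ge> 0"
    "\<And>\<Phi> A d (y::'a::euclidean_space). orlicz_function \<Phi> \<Longrightarrow> A \<ge> 0 \<Longrightarrow> d > 0 \<Longrightarrow>
      (\<integral>\<^sup>+x. ennreal (1 / norm (x - y) ^ DIM('a)) * ennreal (\<Phi> (A * min 1 (norm (x - y) / d) / norm (x - y) powr s)) \<partial>lborel)
        \<le> ennreal (C * \<Phi> (A / d powr s))"
proof -
  define C1 where "C1 = unit_ball_vol DIM('a) * 2 ^ DIM('a) / (1 - (1/2) powr s)"
  define C2 where "C2 = unit_ball_vol DIM('a) * 4 ^ DIM('a) / (1 - (1/2) powr (1 - s))"
  have C: "C1 \<ge> 0" "C2 \<ge> 0"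
    unfolding C1_def C2_def using s powr_mono2[of s "1/2" 1] powr_mono2[of "1 - s" "1/2" 1]
    by (auto intro!: divide_nonneg_nonneg)
  show ?thesis
  proof (rule that[of "C1 + C2"])
    show "C1 + C2 \<ge> 0" using C by simp
    fix \<Phi> :: "real \<Rightarrow> real" and A d :: real and y :: 'a
    assume \<Phi>: "orlicz_function \<Phi>" and A: "A \<ge> 0" and d: "d > 0"
    let ?n = "DIM('a)" and ?P = "\<Phi> (A / d powr s)"
    have P: "?P \<ge> 0" using A by (intro orlicz_function_nonneg[OF \<Phi>]) simp
    define f1 where "f1 z = ennreal ((d / norm z) powr s / norm z ^ ?n) * indicator {z. norm z \<ge> d} z" for z :: 'a
    define f2 where "f2 z = ennreal ((norm z / d) powr (1 - s) / norm z ^ ?n) * indicator {z. norm z < d} z" for z :: 'a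
    have [measurable]: "f1 \<in> borel_measurable borel" "f2 \<in> borel_measurable borel"
      unfolding f1_def f2_def by measurable
    have "ennreal (1 / norm z ^ ?n) * ennreal (\<Phi> (A * min 1 (norm z / d) / norm z powr s)) \<le> ennreal ?P * (f1 z + f2 z)" for z :: 'a
    proof (cases "z = 0")
      case True
      then show ?thesis by (simp add: orlicz_function_zero[OF \<Phi>])
    next
      case False
      define r where "r = norm z"
      have r: "r > 0" using False by (simp add: r_def)
      define \<theta> where "\<theta> = min 1 (r / d) * (d / r) powr s"
      have eq: "A * min 1 (r / d) / r powr s = \<theta> * (A / d powr s)"
        using r d by (simp add: \<theta>_def powr_divide)
      have \<theta>: "\<theta> = (if r \<ge> d then (d / r) powr s else (r / d) powr (1 - s))"
      proof (cases "r \<ge> d")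
        case False
        have "(r / d) * (d / r) powr s = (r / d) powr 1 * (r / d) powr (- s)"
          using r d by (simp add: powr_minus powr_divide field_simps)
        also have "\<dots> = (r / d) powr (1 + (- s))" by (rule powr_add[symmetric])
        finally show ?thesis using False d by (simp add: \<theta>_def min_def)
      qed (use d in \<open>simp add: \<theta>_def min_def\<close>)
      have \<theta>1: "0 \<le> \<theta>" "\<theta> \<le> 1"
        unfolding \<theta> using r d s by (auto intro!: powr_le1)
      have "\<Phi> (A * min 1 (r / d) / r powr s) \<le> \<theta> * ?P"
        unfolding eq using A by (intro orlicz_function_scale[OF \<Phi> \<theta>1]) simp
      then have "1 / r ^ ?n * \<Phi> (A * min 1 (r / d) / r powr s) \<le> 1 / r ^ ?n * (\<theta> * ?P)"
        using r by (intro mult_left_mono) auto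
      then have "ennreal (1 / r ^ ?n * \<Phi> (A * min 1 (r / d) / r powr s)) \<le> ennreal (?P * (\<theta> / r ^ ?n))"
        by (intro ennreal_leI) (simp add: mult_ac)
      also have "\<dots> = ennreal ?P * ennreal (\<theta> / r ^ ?n)" using P by (rule ennreal_mult')
      also have "ennreal (\<theta> / r ^ ?n) = f1 z + f2 z"
        by (simp add: \<theta> f1_def f2_def r_def indicator_def)
      finally show ?thesis using r by (subst ennreal_mult'[symmetric]) (simp_all add: r_def)
    qed
    then have "(\<integral>\<^sup>+x. ennreal (1 / norm (x - y) ^ ?n) * ennreal (\<Phi> (A * min 1 (norm (x - y) / d) / norm (x - y) powr s)) \<partial>lborel)
        \<le> (\<integral>\<^sup>+x. ennreal ?P * (f1 (x - y) + f2 (x - y)) \<partial>lborel)"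
      by (intro nn_integral_mono)
    also have "\<dots> = ennreal ?P * ((\<integral>\<^sup>+x. f1 (x - y) \<partial>lborel) + (\<integral>\<^sup>+x. f2 (x - y) \<partial>lborel))"
      by (simp add: nn_integral_cmult nn_integral_add)
    also have "\<dots> = ennreal ?P * ((\<integral>\<^sup>+x. f1 x \<partial>lborel) + (\<integral>\<^sup>+x. f2 x \<partial>lborel))"
      by (simp add: nn_integral_lborel_minus)
    also have "\<dots> \<le> ennreal ?P * (ennreal C1 + ennreal C2)"
      unfolding f1_def f2_def C1_def C2_def
      by (intro mult_left_mono add_mono radial_tail_integral radial_core_integral) (use s d in auto)
    also have "\<dots> = ennreal ((C1 + C2) * ?P)"
      using C P by (simp add: ennreal_plus[symmetric] ennreal_mult'[symmetric] mult.commute del: ennreal_plus)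
    finally show "(\<integral>\<^sup>+x. ennreal (1 / norm (x - y) ^ ?n) * ennreal (\<Phi> (A * min 1 (norm (x - y) / d) / norm (x - y) powr s)) \<partial>lborel)
        \<le> ennreal ((C1 + C2) * ?P)" .
  qed
qed

section \<open>Estimates by the fractional modular\<close>

text \<open>An increment is \<open>L * norm (x - y) powr s\<close> times the argument of
  \<open>G\<close> in the energy, and that argument is at most its \<open>G\<close>-value plus a
  constant. The factor \<open>r ^ n\<close> is of the order of the volume of the ball, so after
  averaging the oscillation at radius \<open>r\<close> is of order \<open>r powr s\<close>.\<close>

lemma frac_L1_estimate:
  fixes s R :: real
  assumes G: "young_function G" and s: "0 < s" and R: "R \<ge> 0"
  obtains K where "K \<ge> 0"
    "\<And>(u :: 'a::euclidean_space \<Rightarrow> real) L r. u \<in> borel_measurable borel \<Longrightarrow> (\<And>x. norm x > R \<Longrightarrow> u x = 0) \<Longrightarrow>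
      L > 0 \<Longrightarrow> 0 < r \<Longrightarrow> r \<le> 1 \<Longrightarrow>
      (\<integral>\<^sup>+x. \<integral>\<^sup>+y. ennreal \<bar>u x - u y\<bar> * indicator (cball 0 r) (x - y) \<partial>lborel \<partial>lborel)
        \<le> ennreal (L * r powr s * r ^ DIM('a)) *
          (orlicz_modular G frac_measure (\<lambda>z. frac_quot s u z / L) + ennreal K)"
proof -
  note O = young_function_orlicz[OF G]
  obtain B where B: "B \<ge> 0" "\<And>t. t \<ge> 0 \<Longrightarrow> 1 * t \<le> G t + B"
    using young_function_affine_bound[OF G zero_le_one] by metis
  let ?n = "DIM('a)" and ?V = "unit_ball_vol (real DIM('a))"
  \<comment> \<open>The constant term is integrated over pairs with
    \<open>norm x \<le> R + 1\<close>: if \<open>x\<close> is farther out and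
    \<open>norm (x - y) \<le> r \<le> 1\<close>, both values of \<open>u\<close> vanish.\<close>
  define K where "K = B * (?V * (R + 1) ^ ?n) * ?V"
  have K: "K \<ge> 0" using B R by (simp add: K_def)
  show ?thesis
  proof (rule that[OF K])
    fix u :: "'a \<Rightarrow> real" and L r :: real
    assume u [measurable]: "u \<in> borel_measurable borel" and u0: "\<And>x. norm x > R \<Longrightarrow> u x = 0"
      and L: "L > 0" and r: "0 < r" "r \<le> 1"
    note [measurable] = borel_measurable_orlicz_function[OF O]
    define D where "D x y = ennreal (1 / norm (x - y) ^ ?n) * ennreal (G \<bar>(u x - u y) / norm (x - y) powr s / L\<bar>)" for x y :: 'a
    define c where "c = L * r powr s"
    have c: "c \<ge> 0" using L by (simp add: c_def)
    have pt: "ennreal \<bar>u x - u y\<bar> * indicator (cball 0 r) (x - y) \<le>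
        ennreal (c * r ^ ?n) * D x y + ennreal (c * B) * (indicator (cball 0 (R + 1)) x * indicator (cball 0 r) (x - y))" for x y
    proof (cases "x = y \<or> norm (x - y) > r \<or> norm x > R + 1")
      case True
      have "\<bar>u x - u y\<bar> * indicator (cball 0 r) (x - y) = 0"
      proof (cases "x = y \<or> norm (x - y) > r")
        case False
        with True have "norm x > R + 1" "norm (x - y) \<le> r" by auto
        moreover have "norm x - norm (x - y) \<le> norm y" using norm_triangle_ineq2[of x "x - y"] by simp
        ultimately have "norm y > R" using r by linarith
        then show ?thesis using u0[of x] u0[of y] \<open>norm x > R + 1\<close> by simp
      qed auto
      then have "ennreal \<bar>u x - u y\<bar> * indicator (cball 0 r) (x - y) = 0"
        by (auto simp: indicator_def split: if_splits)
      then show ?thesis by (simp only: zero_le)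
    next
      case False
      define \<rho> where "\<rho> = norm (x - y)"
      have \<rho>: "0 < \<rho>" "\<rho> \<le> r" "norm x \<le> R + 1" using False by (auto simp: \<rho>_def)
      define t where "t = \<bar>(u x - u y) / \<rho> powr s / L\<bar>"
      have t: "t \<ge> 0" "G t \<ge> 0" by (auto simp: t_def intro: orlicz_function_nonneg[OF O])
      have "\<bar>u x - u y\<bar> = L * \<rho> powr s * t" using \<rho> L by (simp add: t_def abs_divide)
      also have "\<dots> \<le> c * t"
        unfolding c_def using \<rho> L t s by (intro mult_right_mono mult_left_mono powr_mono2) auto
      also have "\<dots> \<le> c * (G t + B)" using B(2)[OF t(1)] c by (intro mult_left_mono) auto
      \<comment> \<open>The factor \<open>(r / \<rho>) ^ n \<ge> 1\<close> is inserted to create the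
        singular density \<open>1 / \<rho> ^ n\<close>; what remains of it is the
        \<open>r ^ n\<close> of the conclusion.\<close>
      also have "\<dots> \<le> c * ((r / \<rho>) ^ ?n * G t + B)"
      proof -
        have "1 \<le> (r / \<rho>) ^ ?n" using \<rho> by (intro one_le_power) simp
        then have "1 * G t \<le> (r / \<rho>) ^ ?n * G t" using t by (intro mult_right_mono) auto
        then show ?thesis using c by (intro mult_left_mono) auto
      qed
      also have "\<dots> = (c * r ^ ?n) * (1 / \<rho> ^ ?n * G t) + c * B"
        by (simp add: algebra_simps power_divide)
      finally have "ennreal \<bar>u x - u y\<bar> \<le> ennreal ((c * r ^ ?n) * (1 / \<rho> ^ ?n * G t) + c * B)"
        by (rule ennreal_leI)
      also have "\<dots> = ennreal ((c * r ^ ?n) * (1 / \<rho> ^ ?n * G t)) + ennreal (c * B)"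
        using c r t \<rho> B by (intro ennreal_plus) auto
      also have "ennreal ((c * r ^ ?n) * (1 / \<rho> ^ ?n * G t)) = ennreal (c * r ^ ?n) * ennreal (1 / \<rho> ^ ?n * G t)"
        using c r by (intro ennreal_mult') simp
      also have "ennreal (1 / \<rho> ^ ?n * G t) = ennreal (1 / \<rho> ^ ?n) * ennreal (G t)"
        using \<rho> by (intro ennreal_mult') simp
      finally show ?thesis
        using \<rho> by (simp add: D_def t_def \<rho>_def indicator_def)
    qed
    have [measurable]: "(\<lambda>y. D x y) \<in> borel_measurable borel" "(\<lambda>(x, y). D x y) \<in> borel_measurable (lborel \<Otimes>\<^sub>M lborel)" for x
      unfolding D_def by measurable
    have ballx: "(\<integral>\<^sup>+y. indicator (cball 0 r) (x - y) \<partial>lborel) = ennreal (?V * r ^ ?n)" for x :: 'a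
    proof -
      have "(\<integral>\<^sup>+y. indicator (cball 0 r) (x - y) \<partial>lborel) = (\<integral>\<^sup>+y. indicator (cball x r) y \<partial>lborel)"
        by (intro nn_integral_cong) (auto simp: indicator_def dist_norm norm_minus_commute)
      then show ?thesis using r by (simp add: emeasure_cball)
    qed
    have "(\<integral>\<^sup>+x. \<integral>\<^sup>+y. ennreal \<bar>u x - u y\<bar> * indicator (cball 0 r) (x - y) \<partial>lborel \<partial>lborel)
      \<le> (\<integral>\<^sup>+x. \<integral>\<^sup>+y. ennreal (c * r ^ ?n) * D x y + ennreal (c * B) * (indicator (cball 0 (R + 1)) x * indicator (cball 0 r) (x - y)) \<partial>lborel \<partial>lborel)"
      by (intro nn_integral_mono pt)
    also have "\<dots> = (\<integral>\<^sup>+x. ennreal (c * r ^ ?n) * (\<integral>\<^sup>+y. D x y \<partial>lborel) +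
        ennreal (c * B) * (indicator (cball 0 (R + 1)) x * ennreal (?V * r ^ ?n)) \<partial>lborel)"
    proof (intro nn_integral_cong)
      fix x :: 'a
      let ?i = "\<lambda>y. indicator (cball 0 r) (x - y) :: ennreal"
      have [measurable]: "cball (0::'a) r \<in> sets borel" by simp
      have "(\<integral>\<^sup>+y. ennreal (c * r ^ ?n) * D x y + ennreal (c * B) * (indicator (cball 0 (R + 1)) x * ?i y) \<partial>lborel)
          = (\<integral>\<^sup>+y. ennreal (c * r ^ ?n) * D x y \<partial>lborel) + (\<integral>\<^sup>+y. ennreal (c * B) * (indicator (cball 0 (R + 1)) x * ?i y) \<partial>lborel)"
        by (rule nn_integral_add) measurable
      also have "(\<integral>\<^sup>+y. ennreal (c * r ^ ?n) * D x y \<partial>lborel) = ennreal (c * r ^ ?n) * (\<integral>\<^sup>+y. D x y \<partial>lborel)"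
        by (rule nn_integral_cmult) measurable
      also have "(\<integral>\<^sup>+y. ennreal (c * B) * (indicator (cball 0 (R + 1)) x * ?i y) \<partial>lborel)
          = ennreal (c * B) * (\<integral>\<^sup>+y. indicator (cball 0 (R + 1)) x * ?i y \<partial>lborel)"
        by (rule nn_integral_cmult) measurable
      also have "(\<integral>\<^sup>+y. indicator (cball 0 (R + 1)) x * ?i y \<partial>lborel) = indicator (cball 0 (R + 1)) x * (\<integral>\<^sup>+y. ?i y \<partial>lborel)"
        by (rule nn_integral_cmult) measurable
      finally show "(\<integral>\<^sup>+y. ennreal (c * r ^ ?n) * D x y + ennreal (c * B) * (indicator (cball 0 (R + 1)) x * ?i y) \<partial>lborel)
          = ennreal (c * r ^ ?n) * (\<integral>\<^sup>+y. D x y \<partial>lborel) + ennreal (c * B) * (indicator (cball 0 (R + 1)) x * ennreal (?V * r ^ ?n))"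
        by (simp add: ballx)
    qed
    also have "\<dots> = ennreal (c * r ^ ?n) * (\<integral>\<^sup>+x. \<integral>\<^sup>+y. D x y \<partial>lborel \<partial>lborel) +
        ennreal (c * B) * (emeasure lborel (cball (0::'a) (R + 1)) * ennreal (?V * r ^ ?n))"
    proof -
      have [measurable]: "cball (0::'a) (R + 1) \<in> sets borel" "(\<lambda>x. \<integral>\<^sup>+y. D x y \<partial>lborel) \<in> borel_measurable borel"
        unfolding D_def by measurable
      show ?thesis by (simp add: nn_integral_add nn_integral_cmult nn_integral_multc)
    qed
    also have "(\<integral>\<^sup>+x. \<integral>\<^sup>+y. D x y \<partial>lborel \<partial>lborel) = orlicz_modular G frac_measure (\<lambda>z. frac_quot s u z / L)"
      unfolding D_def by (rule frac_modular_eq[OF O u, symmetric])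
    also have "ennreal (c * B) * (emeasure lborel (cball (0::'a) (R + 1)) * ennreal (?V * r ^ ?n)) = ennreal (c * r ^ ?n) * ennreal K"
      using R c B r by (simp add: emeasure_cball ennreal_mult[symmetric] K_def mult_ac)
    finally show "(\<integral>\<^sup>+x. \<integral>\<^sup>+y. ennreal \<bar>u x - u y\<bar> * indicator (cball 0 r) (x - y) \<partial>lborel \<partial>lborel)
        \<le> ennreal (L * r powr s * r ^ ?n) * (orlicz_modular G frac_measure (\<lambda>z. frac_quot s u z / L) + ennreal K)"
      by (simp add: c_def distrib_left)
  qed
qed

text \<open>Where \<open>\<bar>u\<bar>\<close> exceeds \<open>2 t\<close>, half of a ball of small radius \<open>r\<close> lies in \<open>{\<bar>u\<bar> \<le> t}\<close>, because
  \<open>{\<bar>u\<bar> > t}\<close> has small measure; on that half the difference quotient is at least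
  \<open>\<bar>u\<bar> / (2 * r powr s)\<close>, and \<open>r powr s\<close> is as small as we please.\<close>

lemma frac_modular_uniform_integrability:
  fixes s \<alpha> C \<epsilon> :: real
  assumes G: "young_function G" and s: "0 < s" and \<alpha>: "\<alpha> \<ge> 0" and C: "C \<ge> 0" and \<epsilon>: "\<epsilon> > 0"
  obtains T where "T \<ge> 0"
    "\<And>u :: 'a::euclidean_space \<Rightarrow> real. u \<in> borel_measurable borel \<Longrightarrow> orlicz_modular G lborel u \<le> ennreal \<alpha> \<Longrightarrow>
      orlicz_modular G frac_measure (frac_quot s u) \<le> ennreal C \<Longrightarrow>
      (\<integral>\<^sup>+x. ennreal (G \<bar>u x\<bar>) * indicator {x. \<bar>u x\<bar> > T} x \<partial>lborel) \<le> ennreal \<epsilon>"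
proof -
  note O = young_function_orlicz[OF G]
  let ?n = "DIM('a)"
  define V where "V = unit_ball_vol (real ?n)"
  have V: "V > 0" by (simp add: V_def)
  \<comment> \<open>The value of \<open>r powr s\<close>. The first bound makes \<open>2 * q\<close>
    admissible as a convexity factor, the second makes the final constant \<open>C / c\<close>, with
    \<open>c = V / (4 * q)\<close>, at most \<open>\<epsilon>\<close>.\<close>
  define q where "q = min (1/2) (\<epsilon> * V / (4 * (C + 1)))"
  have q: "0 < q" "q \<le> 1/2" "q \<le> \<epsilon> * V / (4 * (C + 1))"
    using \<epsilon> V C by (simp add: q_def, simp only: q_def min.cobounded1, simp only: q_def min.cobounded2)
  define r where "r = q powr (1 / s)"
  have r: "r > 0" "r powr s = q" using q s by (auto simp: r_def powr_powr)
  obtain T0 where T0: "T0 > 0" "\<And>t. t \<ge> T0 \<Longrightarrow> 1 * t \<le> G t"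
    using young_function_superlinear[OF G] by metis
  \<comment> \<open>Since \<open>G t \<ge> t\<close>, Chebyshev's inequality bounds the measure of
    \<open>{\<bar>u\<bar> > t}\<close> by half the volume of a ball of radius
    \<open>r\<close>.\<close>
  define t where "t = max T0 (2 * \<alpha> / (V * r ^ ?n))"
  have t: "t > 0" "G t \<ge> 2 * \<alpha> / (V * r ^ ?n)" "G t > 0"
    using T0 T0(2)[of t] by (auto simp: t_def)
  show ?thesis
  proof (rule that[of "2 * t"])
    fix u :: "'a \<Rightarrow> real"
    assume u [measurable]: "u \<in> borel_measurable borel" and J: "orlicz_modular G lborel u \<le> ennreal \<alpha>"
      and F: "orlicz_modular G frac_measure (frac_quot s u) \<le> ennreal C"
    note [measurable] = borel_measurable_orlicz_function[OF O]
    define E where "E = {x. \<bar>u x\<bar> > t}"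
    have E [measurable]: "E \<in> sets borel" unfolding E_def by measurable
    have Esmall: "emeasure lborel E \<le> ennreal (V * r ^ ?n / 2)"
    proof -
      have "ennreal (G t) * emeasure lborel E = (\<integral>\<^sup>+x. ennreal (G t) * indicator E x \<partial>lborel)"
        by (simp add: nn_integral_cmult_indicator)
      also have "\<dots> \<le> orlicz_modular G lborel u"
        unfolding orlicz_modular_def
        using t(1) by (intro nn_integral_mono) (auto simp: indicator_def E_def intro!: ennreal_leI orlicz_function_mono[OF O])
      also note J
      also have "ennreal \<alpha> \<le> ennreal (G t * (V * r ^ ?n / 2))"
        using t V r by (intro ennreal_leI) (simp add: field_simps)
      also have "\<dots> = ennreal (G t) * ennreal (V * r ^ ?n / 2)" using t by (intro ennreal_mult') simp
      finally show ?thesis using t by (simp add: ennreal_mult_le_mult_iff)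
    qed
    have half: "emeasure lborel (ball x r - E) \<ge> ennreal (V * r ^ ?n / 2)" for x
    proof -
      have "ennreal (V * r ^ ?n) = emeasure lborel (ball x r)" using r by (simp add: emeasure_ball V_def)
      also have "\<dots> \<le> emeasure lborel ((ball x r - E) \<union> E)" by (intro emeasure_mono) auto
      also have "\<dots> \<le> emeasure lborel (ball x r - E) + emeasure lborel E" by (intro emeasure_subadditive) auto
      also have "\<dots> \<le> emeasure lborel (ball x r - E) + ennreal (V * r ^ ?n / 2)" by (intro add_left_mono Esmall)
      finally have le: "ennreal (V * r ^ ?n) \<le> emeasure lborel (ball x r - E) + ennreal (V * r ^ ?n / 2)" .
      have "ennreal (V * r ^ ?n) = ennreal (V * r ^ ?n / 2) + ennreal (V * r ^ ?n / 2)"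
        using V r by (subst ennreal_plus[symmetric]) auto
      with le show ?thesis by (simp add: ennreal_add_left_cancel_le add.commute)
    qed
    let ?D = "\<lambda>x y. ennreal (1 / norm (x - y) ^ ?n) * ennreal (G \<bar>(u x - u y) / norm (x - y) powr s\<bar>)"
    \<comment> \<open>The product of half the volume of the ball, the density
      \<open>1 / r ^ n\<close>, and the gain \<open>1 / (2 * q)\<close> from convexity.\<close>
    define c where "c = V / (4 * q)"
    have c: "c > 0" using V q by (simp add: c_def)
    have pt: "ennreal c * (ennreal (G \<bar>u x\<bar>) * indicator {x. \<bar>u x\<bar> > 2 * t} x) \<le> (\<integral>\<^sup>+y. ?D x y \<partial>lborel)" for x
    proof (cases "\<bar>u x\<bar> > 2 * t")
      case True
      have Gx: "G \<bar>u x\<bar> / (2 * q) \<le> G (\<bar>u x\<bar> / (2 * q))"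
      proof -
        have "G ((2 * q) * (\<bar>u x\<bar> / (2 * q))) \<le> (2 * q) * G (\<bar>u x\<bar> / (2 * q))"
          using q by (intro orlicz_function_scale[OF O]) auto
        then show ?thesis using q by (simp add: field_simps)
      qed
      have "ennreal c * ennreal (G \<bar>u x\<bar>) = ennreal (c * G \<bar>u x\<bar>)"
        by (rule ennreal_mult'[symmetric]) (use c in simp)
      also have "c * G \<bar>u x\<bar> = (1 / r ^ ?n * (G \<bar>u x\<bar> / (2 * q))) * (V * r ^ ?n / 2)"
        using r(1) by (simp add: c_def)
      also have "\<dots> \<le> ennreal ((1 / r ^ ?n * G (\<bar>u x\<bar> / (2 * q))) * (V * r ^ ?n / 2))"
        using r V Gx by (intro ennreal_leI mult_right_mono mult_left_mono) auto
      also have "\<dots> = ennreal (1 / r ^ ?n * G (\<bar>u x\<bar> / (2 * q))) * ennreal (V * r ^ ?n / 2)"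
        using r V by (intro ennreal_mult'') auto
      also have "\<dots> \<le> ennreal (1 / r ^ ?n * G (\<bar>u x\<bar> / (2 * q))) * emeasure lborel (ball x r - E)"
        by (intro mult_left_mono half) simp
      also have "\<dots> = (\<integral>\<^sup>+y. ennreal (1 / r ^ ?n * G (\<bar>u x\<bar> / (2 * q))) * indicator (ball x r - E) y \<partial>lborel)"
        by (subst nn_integral_cmult_indicator) auto
      also have "\<dots> \<le> (\<integral>\<^sup>+y. ?D x y \<partial>lborel)"
      proof (rule nn_integral_mono)
        fix y
        show "ennreal (1 / r ^ ?n * G (\<bar>u x\<bar> / (2 * q))) * indicator (ball x r - E) y \<le> ?D x y"
        proof (cases "y \<in> ball x r - E")
          case True2: True
          have y: "norm (x - y) < r" "\<bar>u y\<bar> \<le> t" using True2 by (auto simp: E_def dist_norm)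
          have "x \<noteq> y" using y(2) True t by auto
          then have \<rho>: "norm (x - y) > 0" by simp
          have ps: "norm (x - y) powr s \<le> q" using y s \<rho> r(2) powr_mono2[of s "norm (x - y)" r] by simp
          have "\<bar>u x\<bar> / 2 \<le> \<bar>u x - u y\<bar>" using True y by linarith
          then have "\<bar>u x\<bar> / 2 / q \<le> \<bar>u x - u y\<bar> / norm (x - y) powr s"
            using ps \<rho> q by (intro frac_le) auto
          then have "G (\<bar>u x\<bar> / (2 * q)) \<le> G \<bar>(u x - u y) / norm (x - y) powr s\<bar>"
            using q by (intro orlicz_function_mono[OF O]) (auto simp: abs_divide)
          moreover have "1 / r ^ ?n \<le> 1 / norm (x - y) ^ ?n"
            using \<rho> y r(1) by (intro divide_left_mono power_mono mult_pos_pos) auto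
          ultimately have "1 / r ^ ?n * G (\<bar>u x\<bar> / (2 * q)) \<le> 1 / norm (x - y) ^ ?n * G \<bar>(u x - u y) / norm (x - y) powr s\<bar>"
            using q by (intro mult_mono orlicz_function_nonneg[OF O]) auto
          then have "ennreal (1 / r ^ ?n * G (\<bar>u x\<bar> / (2 * q))) \<le> ennreal (1 / norm (x - y) ^ ?n * G \<bar>(u x - u y) / norm (x - y) powr s\<bar>)"
            by (rule ennreal_leI)
          also have "\<dots> = ?D x y" by (rule ennreal_mult') simp
          finally show ?thesis using True2 by simp
        qed simp
      qed
      finally show ?thesis using True by simp
    qed simp
    have "ennreal c * (\<integral>\<^sup>+x. ennreal (G \<bar>u x\<bar>) * indicator {x. \<bar>u x\<bar> > 2 * t} x \<partial>lborel)
        = (\<integral>\<^sup>+x. ennreal c * (ennreal (G \<bar>u x\<bar>) * indicator {x. \<bar>u x\<bar> > 2 * t} x) \<partial>lborel)"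
      by (rule nn_integral_cmult[symmetric]) measurable
    also have "\<dots> \<le> (\<integral>\<^sup>+x. \<integral>\<^sup>+y. ?D x y \<partial>lborel \<partial>lborel)" by (intro nn_integral_mono pt)
    also have "\<dots> = orlicz_modular G frac_measure (frac_quot s u)"
      using frac_modular_eq[OF O u, where L=1 and s=s] by simp
    also note F
    also have "ennreal C \<le> ennreal c * ennreal \<epsilon>"
    proof -
      have "q * (4 * (C + 1)) \<le> \<epsilon> * V" using q C by (simp add: pos_le_divide_eq)
      then have "4 * (q * C) \<le> \<epsilon> * V" using q by (simp add: algebra_simps)
      then have "C \<le> c * \<epsilon>" using q by (simp add: c_def field_simps)
      then show ?thesis using c by (simp add: ennreal_mult'[symmetric] ennreal_leI)
    qed
    finally show "(\<integral>\<^sup>+x. ennreal (G \<bar>u x\<bar>) * indicator {x. \<bar>u x\<bar> > 2 * t} x \<partial>lborel) \<le> ennreal \<epsilon>"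
      using c by (simp add: ennreal_mult_le_mult_iff)
  qed (use t in simp)
qed

text \<open>The supporting line at the mean \<open>a\<close> of \<open>\<bar>f\<bar>\<close>,
  integrated against the probability weight. The finite term \<open>g a * a\<close> is carried on
  both sides and cancelled at the end, which avoids subtraction in \<open>ennreal\<close>.\<close>

lemma Jensen_weight:
  assumes G: "young_function G" and [measurable]: "f \<in> borel_measurable M" "\<eta> \<in> borel_measurable M"
    and \<eta>: "\<And>x. 0 \<le> \<eta> x" "(\<integral>\<^sup>+x. ennreal (\<eta> x) \<partial>M) = 1"
  shows "ennreal (G \<bar>\<integral>x. f x * \<eta> x \<partial>M\<bar>) \<le> (\<integral>\<^sup>+x. ennreal (G \<bar>f x\<bar>) * ennreal (\<eta> x) \<partial>M)"
proof (cases "integrable M (\<lambda>x. f x * \<eta> x)")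
  case False
  \<comment> \<open>The integral of a function that is not integrable is zero by convention, and
    \<open>G 0 = 0\<close>.\<close>
  then show ?thesis
    using orlicz_function_zero[OF young_function_orlicz[OF G]] by (simp add: not_integrable_integral_eq)
next
  case True
  note O = young_function_orlicz[OF G]
  note [measurable] = borel_measurable_orlicz_function[OF O]
  obtain g where g: "\<And>t. t > 0 \<Longrightarrow> 0 < g t" "g 0 = 0"
      "\<And>a t. 0 \<le> a \<Longrightarrow> 0 \<le> t \<Longrightarrow> G t \<ge> G a + g a * (t - a)"
    using young_function_subgradient[OF G] by metis
  define a where "a = (\<integral>x. \<bar>f x\<bar> * \<eta> x \<partial>M)"
  have int: "integrable M (\<lambda>x. \<bar>f x\<bar> * \<eta> x)"
    using integrable_abs[OF True] \<eta>(1) by (simp add: abs_mult)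
  have a: "a \<ge> 0" unfolding a_def using \<eta>(1) by simp
  have ga: "g a \<ge> 0" using g(1)[of a] g(2) a by (cases "a = 0") auto
  have "\<bar>\<integral>x. f x * \<eta> x \<partial>M\<bar> \<le> a"
    using integral_abs_bound[of M "\<lambda>x. f x * \<eta> x"] \<eta>(1) by (simp add: a_def abs_mult)
  then have "ennreal (G \<bar>\<integral>x. f x * \<eta> x \<partial>M\<bar>) \<le> ennreal (G a)"
    by (intro ennreal_leI orlicz_function_mono[OF O]) auto
  also have "ennreal (G a) \<le> (\<integral>\<^sup>+x. ennreal (G \<bar>f x\<bar>) * ennreal (\<eta> x) \<partial>M)"
  proof -
    have Ia: "(\<integral>\<^sup>+x. ennreal (\<bar>f x\<bar> * \<eta> x) \<partial>M) = ennreal a"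
      unfolding a_def using \<eta>(1) by (intro nn_integral_eq_integral int) auto
    have "ennreal (G a) + ennreal (g a * a) = (\<integral>\<^sup>+x. ennreal (G a) * ennreal (\<eta> x) + ennreal (g a) * ennreal (\<bar>f x\<bar> * \<eta> x) \<partial>M)"
      using \<eta>(2) Ia ga a by (simp add: nn_integral_add nn_integral_cmult ennreal_mult)
    also have "\<dots> \<le> (\<integral>\<^sup>+x. ennreal (G \<bar>f x\<bar>) * ennreal (\<eta> x) + ennreal (g a * a) * ennreal (\<eta> x) \<partial>M)"
    proof (rule nn_integral_mono)
      fix x
      have "(G a + g a * \<bar>f x\<bar>) * \<eta> x \<le> (G \<bar>f x\<bar> + g a * a) * \<eta> x"
        using g(3)[OF a, of "\<bar>f x\<bar>"] \<eta>(1) by (intro mult_right_mono) (auto simp: algebra_simps)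
      then have "ennreal (G a * \<eta> x + g a * (\<bar>f x\<bar> * \<eta> x)) \<le> ennreal (G \<bar>f x\<bar> * \<eta> x + (g a * a) * \<eta> x)"
        by (intro ennreal_leI) (simp add: algebra_simps)
      then show "ennreal (G a) * ennreal (\<eta> x) + ennreal (g a) * ennreal (\<bar>f x\<bar> * \<eta> x) \<le>
          ennreal (G \<bar>f x\<bar>) * ennreal (\<eta> x) + ennreal (g a * a) * ennreal (\<eta> x)"
        using \<eta>(1) ga a orlicz_function_nonneg[OF O]
        by (simp add: ennreal_mult[symmetric] ennreal_plus[symmetric] del: ennreal_plus)
    qed
    also have "\<dots> = (\<integral>\<^sup>+x. ennreal (G \<bar>f x\<bar>) * ennreal (\<eta> x) \<partial>M) + ennreal (g a * a)"
      using \<eta>(2) by (simp add: nn_integral_add nn_integral_cmult)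
    finally show ?thesis by (simp add: add.commute[of _ "ennreal (g a * a)"] ennreal_add_left_cancel_le)
  qed
  finally show ?thesis .
qed

section \<open>Mollification and modulars\<close>

lemma lborel_distr_reflect: "distr lborel borel (\<lambda>z. x - z) = (lborel :: 'a::euclidean_space measure)"
  using lborel_affine[of "-1" x] by (simp add: density_1)

lemma convolution_commute:
  fixes v \<rho> :: "'a::euclidean_space \<Rightarrow> real"
  assumes [measurable]: "v \<in> borel_measurable borel" "\<rho> \<in> borel_measurable borel"
  shows "(\<integral>y. v y * \<rho> (x - y) \<partial>lborel) = (\<integral>z. v (x - z) * \<rho> z \<partial>lborel)"
proof -
  have "(\<integral>y. v y * \<rho> (x - y) \<partial>lborel) = (\<integral>y. v y * \<rho> (x - y) \<partial>distr lborel borel (\<lambda>z. x - z))"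
    by (simp only: lborel_distr_reflect)
  also have "\<dots> = (\<integral>z. v (x - z) * \<rho> z \<partial>lborel)"
    by (subst integral_distr) auto
  finally show ?thesis .
qed

lemma nn_integral_lborel_reflect:
  fixes f :: "'a::euclidean_space \<Rightarrow> ennreal"
  assumes [measurable]: "f \<in> borel_measurable borel"
  shows "(\<integral>\<^sup>+y. f (x - y) \<partial>lborel) = (\<integral>\<^sup>+y. f y \<partial>lborel)"
proof -
  have "(\<integral>\<^sup>+y. f y \<partial>lborel) = (\<integral>\<^sup>+y. f y \<partial>distr lborel borel (\<lambda>z. x - z))"
    by (simp only: lborel_distr_reflect)
  also have "\<dots> = (\<integral>\<^sup>+y. f (x - y) \<partial>lborel)"
    by (subst nn_integral_distr) auto
  finally show ?thesis by simp
qed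

context
  fixes G :: "real \<Rightarrow> real" and v \<rho> :: "'a::euclidean_space \<Rightarrow> real" and M :: real
  assumes G: "young_function G" and v: "integrable lborel v"
    and \<rho>_meas [measurable]: "\<rho> \<in> borel_measurable borel"
    and \<rho>: "\<And>x. 0 \<le> \<rho> x" "\<And>x. \<rho> x \<le> M" "(\<integral>\<^sup>+x. ennreal (\<rho> x) \<partial>lborel) = 1"
begin

lemma convolution_integrable: "integrable lborel (\<lambda>z. v (x - z) * \<rho> z)"
proof -
  have [measurable]: "v \<in> borel_measurable borel" using v by auto
  have M: "M \<ge> 0" using \<rho>(1,2) order_trans by blast
  have "integrable (distr lborel borel (\<lambda>z. x - z)) v" by (simp add: lborel_distr_reflect v)
  then have "integrable lborel (\<lambda>z. v (x - z))" by (subst (asm) integrable_distr_eq) auto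
  then have "integrable lborel (\<lambda>z. M * v (x - z))" by simp
  then show ?thesis
    by (rule Bochner_Integration.integrable_bound)
       (use \<rho> M in \<open>auto simp: abs_mult mult.commute[of _ "\<rho> _"] intro!: mult_right_mono\<close>)
qed

text \<open>The convolution is an average of translates of \<open>v\<close>, and translation does
  not change the integral. The scale \<open>L\<close> stays the same, so no doubling condition
  enters.\<close>

lemma convolution_modular_le:
  "orlicz_modular G lborel (\<lambda>x. (\<integral>y. v y * \<rho> (x - y) \<partial>lborel) / L) \<le> orlicz_modular G lborel (\<lambda>x. v x / L)"
proof -
  have [measurable]: "v \<in> borel_measurable borel" using v by auto
  note O = young_function_orlicz[OF G]
  note [measurable] = borel_measurable_orlicz_function[OF O]
  let ?f = "\<lambda>x. ennreal (G \<bar>v x / L\<bar>)"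
  have "orlicz_modular G lborel (\<lambda>x. (\<integral>y. v y * \<rho> (x - y) \<partial>lborel) / L)
      = (\<integral>\<^sup>+x. ennreal (G \<bar>\<integral>z. (v (x - z) / L) * \<rho> z \<partial>lborel\<bar>) \<partial>lborel)"
    unfolding orlicz_modular_def by (simp add: convolution_commute)
  also have "\<dots> \<le> (\<integral>\<^sup>+x. \<integral>\<^sup>+z. ?f (x - z) * ennreal (\<rho> z) \<partial>lborel \<partial>lborel)"
    by (intro nn_integral_mono Jensen_weight[OF G]) (auto simp: \<rho>)
  also have "\<dots> = (\<integral>\<^sup>+z. \<integral>\<^sup>+x. ?f (x - z) * ennreal (\<rho> z) \<partial>lborel \<partial>lborel)"
    by (rule lborel_pair.Fubini'[symmetric]) measurable
  also have "\<dots> = (\<integral>\<^sup>+z. (\<integral>\<^sup>+x. ?f x \<partial>lborel) * ennreal (\<rho> z) \<partial>lborel)"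
  proof (rule nn_integral_cong)
    fix z
    have "(\<integral>\<^sup>+x. ?f (x - z) * ennreal (\<rho> z) \<partial>lborel) = (\<integral>\<^sup>+x. ?f (x - z) \<partial>lborel) * ennreal (\<rho> z)"
      by (rule nn_integral_multc) measurable
    also have "(\<integral>\<^sup>+x. ?f (x - z) \<partial>lborel) = (\<integral>\<^sup>+x. ?f x \<partial>lborel)"
      by (rule nn_integral_lborel_minus[of ?f]) measurable
    finally show "(\<integral>\<^sup>+x. ?f (x - z) * ennreal (\<rho> z) \<partial>lborel) = (\<integral>\<^sup>+x. ?f x \<partial>lborel) * ennreal (\<rho> z)" .
  qed
  also have "\<dots> = (\<integral>\<^sup>+x. ?f x \<partial>lborel)"
    by (subst nn_integral_cmult) (auto simp: \<rho>)
  finally show ?thesis by (simp add: orlicz_modular_def)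
qed

text \<open>The difference quotient of an average of translates is the average of their difference
  quotients. The singular density depends only on \<open>x - y\<close>, so translating both
  variables together preserves the energy.\<close>

lemma convolution_frac_modular_le:
  "orlicz_modular G frac_measure (\<lambda>z. frac_quot s (\<lambda>x. \<integral>y. v y * \<rho> (x - y) \<partial>lborel) z / L)
    \<le> orlicz_modular G frac_measure (\<lambda>z. frac_quot s v z / L)"
proof -
  have [measurable]: "v \<in> borel_measurable borel" using v by auto
  note O = young_function_orlicz[OF G]
  note [measurable] = borel_measurable_orlicz_function[OF O]
  define F where "F p q = ennreal (1 / norm (p - q) ^ DIM('a)) * ennreal (G \<bar>(v p - v q) / norm (p - q) powr s / L\<bar>)" for p q :: 'a
  have Fm: "(\<lambda>(p, q). F p q) \<in> borel_measurable (lborel \<Otimes>\<^sub>M lborel)"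
    unfolding F_def by measurable
  note [measurable] = Fm
  let ?w = "\<lambda>x. \<integral>y. v y * \<rho> (x - y) \<partial>lborel"
  have [measurable]: "?w \<in> borel_measurable borel" by measurable
  have "orlicz_modular G frac_measure (\<lambda>z. frac_quot s ?w z / L)
      = (\<integral>\<^sup>+x. \<integral>\<^sup>+y. ennreal (1 / norm (x - y) ^ DIM('a)) * ennreal (G \<bar>(?w x - ?w y) / norm (x - y) powr s / L\<bar>) \<partial>lborel \<partial>lborel)"
    by (rule frac_modular_eq[OF O]) measurable
  also have "\<dots> \<le> (\<integral>\<^sup>+x. \<integral>\<^sup>+y. \<integral>\<^sup>+z. F (x - z) (y - z) * ennreal (\<rho> z) \<partial>lborel \<partial>lborel \<partial>lborel)"
  proof (intro nn_integral_mono)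
    fix x y :: 'a
    let ?c = "norm (x - y) powr s * L"
    have "(?w x - ?w y) / norm (x - y) powr s / L = (\<integral>z. v (x - z) * \<rho> z - v (y - z) * \<rho> z \<partial>lborel) / ?c"
      using convolution_integrable[of x] convolution_integrable[of y] by (simp add: convolution_commute)
    also have "\<dots> = (\<integral>z. (v (x - z) - v (y - z)) / ?c * \<rho> z \<partial>lborel)"
      by (simp add: integral_divide_zero[symmetric] left_diff_distrib diff_divide_distrib del: integral_divide_zero)
    finally have eq: "(?w x - ?w y) / norm (x - y) powr s / L = (\<integral>z. (v (x - z) - v (y - z)) / ?c * \<rho> z \<partial>lborel)" .
    have "ennreal (G \<bar>(?w x - ?w y) / norm (x - y) powr s / L\<bar>) \<le>
        (\<integral>\<^sup>+z. ennreal (G \<bar>(v (x - z) - v (y - z)) / ?c\<bar>) * ennreal (\<rho> z) \<partial>lborel)"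
      unfolding eq by (rule Jensen_weight[OF G]) (auto simp: \<rho>)
    then have "ennreal (1 / norm (x - y) ^ DIM('a)) * ennreal (G \<bar>(?w x - ?w y) / norm (x - y) powr s / L\<bar>) \<le>
        ennreal (1 / norm (x - y) ^ DIM('a)) * (\<integral>\<^sup>+z. ennreal (G \<bar>(v (x - z) - v (y - z)) / ?c\<bar>) * ennreal (\<rho> z) \<partial>lborel)"
      by (intro mult_left_mono) auto
    also have "\<dots> = (\<integral>\<^sup>+z. ennreal (1 / norm (x - y) ^ DIM('a)) * (ennreal (G \<bar>(v (x - z) - v (y - z)) / ?c\<bar>) * ennreal (\<rho> z)) \<partial>lborel)"
      by (rule nn_integral_cmult[symmetric]) measurable
    also have "\<dots> = (\<integral>\<^sup>+z. F (x - z) (y - z) * ennreal (\<rho> z) \<partial>lborel)"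
      by (simp add: F_def mult.assoc)
    finally show "ennreal (1 / norm (x - y) ^ DIM('a)) * ennreal (G \<bar>(?w x - ?w y) / norm (x - y) powr s / L\<bar>) \<le>
        (\<integral>\<^sup>+z. F (x - z) (y - z) * ennreal (\<rho> z) \<partial>lborel)" .
  qed
  also have "\<dots> = (\<integral>\<^sup>+x. \<integral>\<^sup>+z. \<integral>\<^sup>+y. F (x - z) (y - z) * ennreal (\<rho> z) \<partial>lborel \<partial>lborel \<partial>lborel)"
    by (intro nn_integral_cong lborel_pair.Fubini'[symmetric]) (unfold F_def, measurable)
  also have "\<dots> = (\<integral>\<^sup>+x. \<integral>\<^sup>+z. (\<integral>\<^sup>+y. F (x - z) y \<partial>lborel) * ennreal (\<rho> z) \<partial>lborel \<partial>lborel)"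
  proof (intro nn_integral_cong)
    fix x z :: 'a
    have [measurable]: "(\<lambda>y. F p y) \<in> borel_measurable borel" for p unfolding F_def by measurable
    have "(\<integral>\<^sup>+y. F (x - z) (y - z) * ennreal (\<rho> z) \<partial>lborel) = (\<integral>\<^sup>+y. F (x - z) (y - z) \<partial>lborel) * ennreal (\<rho> z)"
      by (rule nn_integral_multc) measurable
    also have "(\<integral>\<^sup>+y. F (x - z) (y - z) \<partial>lborel) = (\<integral>\<^sup>+y. F (x - z) y \<partial>lborel)"
      by (rule nn_integral_lborel_minus[of "F (x - z)"]) measurable
    finally show "(\<integral>\<^sup>+y. F (x - z) (y - z) * ennreal (\<rho> z) \<partial>lborel) = (\<integral>\<^sup>+y. F (x - z) y \<partial>lborel) * ennreal (\<rho> z)" .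
  qed
  also have "\<dots> = (\<integral>\<^sup>+z. \<integral>\<^sup>+x. (\<integral>\<^sup>+y. F (x - z) y \<partial>lborel) * ennreal (\<rho> z) \<partial>lborel \<partial>lborel)"
    by (rule lborel_pair.Fubini'[symmetric]) (unfold F_def, measurable)
  also have "\<dots> = (\<integral>\<^sup>+z. (\<integral>\<^sup>+x. \<integral>\<^sup>+y. F x y \<partial>lborel \<partial>lborel) * ennreal (\<rho> z) \<partial>lborel)"
  proof (intro nn_integral_cong)
    fix z :: 'a
    have m [measurable]: "(\<lambda>x. \<integral>\<^sup>+y. F x y \<partial>lborel) \<in> borel_measurable borel" unfolding F_def by measurable
    have "(\<integral>\<^sup>+x. (\<integral>\<^sup>+y. F (x - z) y \<partial>lborel) * ennreal (\<rho> z) \<partial>lborel) = (\<integral>\<^sup>+x. (\<integral>\<^sup>+y. F (x - z) y \<partial>lborel) \<partial>lborel) * ennreal (\<rho> z)"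
      by (rule nn_integral_multc) (use measurable_compose[OF _ m, of "\<lambda>x. x - z"] in simp)
    also have "(\<integral>\<^sup>+x. (\<integral>\<^sup>+y. F (x - z) y \<partial>lborel) \<partial>lborel) = (\<integral>\<^sup>+x. (\<integral>\<^sup>+y. F x y \<partial>lborel) \<partial>lborel)"
      by (rule nn_integral_lborel_minus[OF m])
    finally show "(\<integral>\<^sup>+x. (\<integral>\<^sup>+y. F (x - z) y \<partial>lborel) * ennreal (\<rho> z) \<partial>lborel) = (\<integral>\<^sup>+x. \<integral>\<^sup>+y. F x y \<partial>lborel \<partial>lborel) * ennreal (\<rho> z)" .
  qed
  also have "\<dots> = (\<integral>\<^sup>+x. \<integral>\<^sup>+y. F x y \<partial>lborel \<partial>lborel)"
    by (subst nn_integral_cmult) (auto simp: \<rho>)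
  also have "\<dots> = orlicz_modular G frac_measure (\<lambda>z. frac_quot s v z / L)"
    unfolding F_def by (rule frac_modular_eq[OF O, symmetric]) measurable
  finally show ?thesis .
qed

text \<open>Replacing the kernel by its maximum \<open>M\<close> on the ball leaves the local
  oscillation estimated in \<open>frac_L1_estimate\<close>.\<close>

lemma convolution_L1_distance:
  assumes supp: "\<And>z. norm z > e \<Longrightarrow> \<rho> z = 0"
  shows "(\<integral>\<^sup>+x. ennreal \<bar>(\<integral>y. v y * \<rho> (x - y) \<partial>lborel) - v x\<bar> \<partial>lborel) \<le>
    ennreal M * (\<integral>\<^sup>+x. \<integral>\<^sup>+y. ennreal \<bar>v x - v y\<bar> * indicator (cball 0 e) (x - y) \<partial>lborel \<partial>lborel)"
proof -
  have [measurable]: "v \<in> borel_measurable borel" "cball (0::'a) e \<in> sets borel" using v by auto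
  have M: "M \<ge> 0" using \<rho>(1,2) order_trans by blast
  have pt: "ennreal \<bar>(\<integral>y. v y * \<rho> (x - y) \<partial>lborel) - v x\<bar> \<le>
      ennreal M * (\<integral>\<^sup>+y. ennreal \<bar>v x - v y\<bar> * indicator (cball 0 e) (x - y) \<partial>lborel)" for x
  proof -
    have i1: "integrable lborel \<rho>"
      using \<rho> by (intro integrableI_nonneg) auto
    have I1: "(\<integral>z. \<rho> z \<partial>lborel) = 1"
      using \<rho> by (subst integral_eq_nn_integral) auto
    have "(\<integral>y. v y * \<rho> (x - y) \<partial>lborel) - v x = (\<integral>z. v (x - z) * \<rho> z \<partial>lborel) - (\<integral>z. v x * \<rho> z \<partial>lborel)"
      using I1 by (simp add: convolution_commute)
    also have "\<dots> = (\<integral>z. v (x - z) * \<rho> z - v x * \<rho> z \<partial>lborel)"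
      using convolution_integrable[of x] i1 by simp
    finally have eq: "(\<integral>y. v y * \<rho> (x - y) \<partial>lborel) - v x = (\<integral>z. v (x - z) * \<rho> z - v x * \<rho> z \<partial>lborel)" .
    have "ennreal \<bar>(\<integral>y. v y * \<rho> (x - y) \<partial>lborel) - v x\<bar> \<le> (\<integral>\<^sup>+z. ennreal (norm (v (x - z) * \<rho> z - v x * \<rho> z)) \<partial>lborel)"
      unfolding eq real_norm_def[symmetric]
      by (rule integral_norm_bound_ennreal) (use convolution_integrable[of x] i1 in simp)
    also have "\<dots> \<le> (\<integral>\<^sup>+z. ennreal M * (ennreal \<bar>v x - v (x - z)\<bar> * indicator (cball 0 e) z) \<partial>lborel)"
    proof (intro nn_integral_mono)
      fix z
      have "norm (v (x - z) * \<rho> z - v x * \<rho> z) = \<bar>v x - v (x - z)\<bar> * \<rho> z"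
        using \<rho>(1) by (simp add: left_diff_distrib[symmetric] abs_mult abs_minus_commute)
      also have "\<dots> \<le> M * (\<bar>v x - v (x - z)\<bar> * indicator (cball 0 e) z)"
        using \<rho>(2)[of z] supp[of z] by (cases "norm z \<le> e") (auto simp: mult.commute intro!: mult_right_mono)
      finally have "ennreal (norm (v (x - z) * \<rho> z - v x * \<rho> z)) \<le> ennreal (M * (\<bar>v x - v (x - z)\<bar> * indicator (cball 0 e) z))"
        by (rule ennreal_leI)
      also have "\<dots> = ennreal M * (ennreal \<bar>v x - v (x - z)\<bar> * indicator (cball 0 e) z)"
        using M by (simp add: ennreal_mult ennreal_indicator)
      finally show "ennreal (norm (v (x - z) * \<rho> z - v x * \<rho> z)) \<le> ennreal M * (ennreal \<bar>v x - v (x - z)\<bar> * indicator (cball 0 e) z)" .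
    qed
    also have "\<dots> = ennreal M * (\<integral>\<^sup>+z. ennreal \<bar>v x - v (x - z)\<bar> * indicator (cball 0 e) z \<partial>lborel)"
      by (rule nn_integral_cmult) measurable
    also have "(\<integral>\<^sup>+z. ennreal \<bar>v x - v (x - z)\<bar> * indicator (cball 0 e) z \<partial>lborel)
        = (\<integral>\<^sup>+y. ennreal \<bar>v x - v y\<bar> * indicator (cball 0 e) (x - y) \<partial>lborel)"
    proof -
      have "(\<lambda>z. ennreal \<bar>v x - v (x - z)\<bar> * indicator (cball 0 e) z) \<in> borel_measurable borel" by measurable
      from nn_integral_lborel_reflect[OF this, of x] show ?thesis by simp
    qed
    finally show ?thesis .
  qed
  have "(\<integral>\<^sup>+x. ennreal \<bar>(\<integral>y. v y * \<rho> (x - y) \<partial>lborel) - v x\<bar> \<partial>lborel) \<le>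
     (\<integral>\<^sup>+x. ennreal M * (\<integral>\<^sup>+y. ennreal \<bar>v x - v y\<bar> * indicator (cball 0 e) (x - y) \<partial>lborel) \<partial>lborel)"
    by (intro nn_integral_mono pt)
  also have "\<dots> = ennreal M * (\<integral>\<^sup>+x. \<integral>\<^sup>+y. ennreal \<bar>v x - v y\<bar> * indicator (cball 0 e) (x - y) \<partial>lborel \<partial>lborel)"
    by (rule nn_integral_cmult) measurable
  finally show ?thesis .
qed

end

section \<open>Exterior balls and Hardy's inequality\<close>

text \<open>From a boundary point one moves against \<open>e\<close> below the graph; the Lipschitz
  bound keeps a ball of proportional radius below it. Compactness of the boundary makes the
  proportion uniform.\<close>

lemma lipschitz_boundary_exterior_ball:
  fixes \<Omega> :: "'a::euclidean_space set"
  assumes "open \<Omega>" "bounded \<Omega>" "lipschitz_boundary \<Omega>" "D > 0"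
  obtains \<kappa> where "0 < \<kappa>" "\<kappa> \<le> 1"
    "\<And>q t. q \<in> frontier \<Omega> \<Longrightarrow> 0 < t \<Longrightarrow> t \<le> D \<Longrightarrow> \<exists>z. norm (z - q) \<le> t \<and> ball z (\<kappa> * t) \<inter> \<Omega> = {}"
proof -
  have local: "\<exists>r \<kappa>. r > 0 \<and> 0 < \<kappa> \<and> \<kappa> \<le> 1 \<and> (\<forall>q t. q \<in> frontier \<Omega> \<longrightarrow> q \<in> ball p r \<longrightarrow> 0 < t \<longrightarrow> t \<le> D \<longrightarrow>
      (\<exists>z. norm (z - q) \<le> t \<and> ball z (\<kappa> * t) \<inter> \<Omega> = {}))" if p: "p \<in> frontier \<Omega>" for p
  proof -
    obtain r e \<gamma> L where r: "r > 0" and e: "norm e = 1" and lip: "L-lipschitz_on {y. y \<bullet> e = 0} \<gamma>"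
      and \<Omega>: "\<Omega> \<inter> ball p r = {x \<in> ball p r. x \<bullet> e > \<gamma> (x - (x \<bullet> e) *\<^sub>R e)}"
      using assms(3) p unfolding lipschitz_boundary_def by blast
    have L: "L \<ge> 0" using lip by (rule lipschitz_on_nonneg)
    have ee: "e \<bullet> e = 1" using e by (simp add: norm_eq_1)
    define P where "P x = x - (x \<bullet> e) *\<^sub>R e" for x
    have P0: "P x \<bullet> e = 0" for x using ee by (simp add: P_def inner_diff_left)
    have Pnorm: "norm (P x) \<le> norm x" for x
    proof -
      have "(norm (P x))\<^sup>2 = (norm x)\<^sup>2 - (x \<bullet> e)\<^sup>2"
        unfolding power2_norm_eq_inner using ee
        by (simp add: P_def inner_diff_left inner_diff_right inner_commute power2_eq_square)
      then have "(norm (P x))\<^sup>2 \<le> (norm x)\<^sup>2" by simp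
      then show ?thesis by (rule power2_le_imp_le) simp
    qed
    \<comment> \<open>Shrinks the displacement so that even for the largest \<open>t = D\<close> it
      is at most \<open>r / 4\<close>, and the ball around the new centre remains in the
      chart.\<close>
    define c where "c = min 1 (r / (4 * D))"
    have c: "0 < c" "c \<le> 1" "c * D \<le> r / 4"
    proof -
      show "0 < c" "c \<le> 1" using r assms(4) by (auto simp: c_def)
      have "c * D \<le> r / (4 * D) * D" unfolding c_def using assms(4) by (intro mult_right_mono) auto
      then show "c * D \<le> r / 4" using assms(4) by simp
    qed
    \<comment> \<open>Moving by \<open>h\<close> raises a point by at most \<open>norm h\<close> and
      lowers the graph by at most \<open>L * norm h\<close>; together this must not exceed the depth
      \<open>c * t\<close>.\<close>
    define \<kappa> where "\<kappa> = c / (1 + L)"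
    have \<kappa>: "0 < \<kappa>" "\<kappa> \<le> 1" using c L by (auto simp: \<kappa>_def pos_divide_le_eq)
    have "\<exists>z. norm (z - q) \<le> t \<and> ball z (\<kappa> * t) \<inter> \<Omega> = {}"
      if q: "q \<in> frontier \<Omega>" "q \<in> ball p (r / 2)" and t: "0 < t" "t \<le> D" for q t
    proof (intro exI conjI)
      let ?\<tau> = "c * t"
      have \<tau>: "0 < ?\<tau>" "?\<tau> \<le> t" "?\<tau> \<le> r / 4"
      proof -
        have "c * t \<le> c * D" using c t by (intro mult_left_mono) auto
        then show "?\<tau> \<le> r / 4" using c(3) by linarith
        have "c * t \<le> 1 * t" using c t by (intro mult_right_mono) auto
        then show "?\<tau> \<le> t" by simp
        show "0 < ?\<tau>" using c t by simp
      qed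
      let ?z = "q - ?\<tau> *\<^sub>R e"
      show "norm (?z - q) \<le> t" using \<tau> e by simp
      have q\<Omega>: "q \<notin> \<Omega>" using q(1) assms(1) by (auto simp: frontier_def interior_open)
      have "q \<in> ball p r" using q(2) r by auto
      then have q\<gamma>: "q \<bullet> e \<le> \<gamma> (P q)" using q\<Omega> arg_cong[OF \<Omega>, of "\<lambda>A. q \<in> A"] by (simp add: P_def not_less)
      show "ball ?z (\<kappa> * t) \<inter> \<Omega> = {}"
      proof (rule ccontr)
        assume "ball ?z (\<kappa> * t) \<inter> \<Omega> \<noteq> {}"
        then obtain y where y: "y \<in> ball ?z (\<kappa> * t)" "y \<in> \<Omega>" by blast
        define h where "h = y - ?z"
        have yh: "y = q - ?\<tau> *\<^sub>R e + h" by (simp add: h_def)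
        have h: "norm h < \<kappa> * t" using y(1) by (simp add: h_def dist_norm norm_minus_commute)
        have h1: "(1 + L) * norm h \<le> ?\<tau>"
        proof -
          have "(1 + L) * norm h \<le> (1 + L) * (\<kappa> * t)" using h L by (intro mult_left_mono) auto
          also have "\<dots> = ?\<tau>" using L by (simp add: \<kappa>_def)
          finally show ?thesis .
        qed
        have h2: "norm h \<le> ?\<tau>" using h1[unfolded distrib_right] mult_nonneg_nonneg[OF L norm_ge_zero[of h]] by linarith
        have "y - q = h - ?\<tau> *\<^sub>R e" by (simp add: yh)
        then have "norm (y - q) \<le> norm h + norm (?\<tau> *\<^sub>R e)" by (simp only: norm_triangle_ineq4)
        also have "norm (?\<tau> *\<^sub>R e) = ?\<tau>" using \<tau>(1) e by simp
        finally have "dist q y \<le> norm h + ?\<tau>" by (simp add: dist_norm norm_minus_commute)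
        moreover have "dist p q < r / 2" using q(2) by simp
        ultimately have "dist p y < r" using \<tau>(3) h2 dist_triangle[of p y q] by linarith
        then have "y \<in> {x \<in> ball p r. x \<bullet> e > \<gamma> (x - (x \<bullet> e) *\<^sub>R e)}"
          unfolding \<Omega>[symmetric] using y(2) by simp
        then have "y \<bullet> e > \<gamma> (P y)" by (simp add: P_def)
        moreover have "y \<bullet> e \<le> q \<bullet> e - ?\<tau> + norm h"
          using norm_cauchy_schwarz[of h e] e ee by (simp add: yh inner_add_left inner_diff_left)
        moreover have "\<gamma> (P q) \<le> \<gamma> (P y) + L * norm h"
        proof -
          have "P y - P q = P h" using ee by (simp add: P_def yh inner_add_left inner_diff_left algebra_simps)
          then have "dist (P q) (P y) = norm (P h)" by (metis dist_norm dist_commute)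
          then have "dist (\<gamma> (P q)) (\<gamma> (P y)) \<le> L * norm (P h)"
            using lipschitz_onD[OF lip, of "P q" "P y"] P0 by simp
          also have "\<dots> \<le> L * norm h" using Pnorm L by (intro mult_left_mono)
          finally show ?thesis by (simp add: dist_real_def)
        qed
        ultimately show False using q\<gamma> h1 by (simp add: algebra_simps)
      qed
    qed
    then show ?thesis using r \<kappa> by (intro exI[of _ "r / 2"] exI[of _ \<kappa>]) auto
  qed
  then obtain r \<kappa> where rk: "\<And>p. p \<in> frontier \<Omega> \<Longrightarrow> r p > 0 \<and> 0 < \<kappa> p \<and> \<kappa> p \<le> 1 \<and> (\<forall>q t. q \<in> frontier \<Omega> \<longrightarrow> q \<in> ball p (r p) \<longrightarrow> 0 < t \<longrightarrow> t \<le> D \<longrightarrow>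
      (\<exists>z. norm (z - q) \<le> t \<and> ball z (\<kappa> p * t) \<inter> \<Omega> = {}))"
    by metis
  have "compact (frontier \<Omega>)" using assms(2) by (rule compact_frontier_bounded)
  then obtain S where S: "S \<subseteq> frontier \<Omega>" "finite S" "frontier \<Omega> \<subseteq> (\<Union>p\<in>S. ball p (r p))"
    by (rule compactE_image[of _ "frontier \<Omega>" "\<lambda>p. ball p (r p)"]) (use rk in auto)
  define k where "k = Min (insert 1 (\<kappa> ` S))"
  have k: "0 < k" "k \<le> 1" "\<And>p. p \<in> S \<Longrightarrow> k \<le> \<kappa> p"
    using S rk by (auto simp: k_def)
  show ?thesis
  proof (rule that[OF k(1,2)])
    fix q t assume q: "q \<in> frontier \<Omega>" and t: "0 < t" "t \<le> D"
    then obtain p where p: "p \<in> S" "q \<in> ball p (r p)" using S(3) by blast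
    then obtain z where z: "norm (z - q) \<le> t" "ball z (\<kappa> p * t) \<inter> \<Omega> = {}" using rk[of p] S(1) q t by blast
    have "ball z (k * t) \<subseteq> ball z (\<kappa> p * t)" using k(3)[OF p(1)] t by (intro subset_ball mult_right_mono) auto
    then show "\<exists>z. norm (z - q) \<le> t \<and> ball z (k * t) \<inter> \<Omega> = {}" using z by blast
  qed
qed

section \<open>Distance to the complement\<close>

abbreviation bdist :: "'a::euclidean_space set \<Rightarrow> 'a \<Rightarrow> real" where
  "bdist \<Omega> x \<equiv> infdist x (- \<Omega>)"

text \<open>Excludes the empty complement, for which \<open>infdist\<close> would be zero by
  convention and \<open>bdist\<close> useless as a depth.\<close>

lemma bounded_Compl_nonempty:
  fixes \<Omega> :: "'a::euclidean_space set"
  assumes "bounded \<Omega>" shows "- \<Omega> \<noteq> {}"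
  using assms not_bounded_UNIV by (metis Compl_empty_eq double_compl)

lemma bdist_pos:
  fixes \<Omega> :: "'a::euclidean_space set"
  assumes "open \<Omega>" "bounded \<Omega>"
  shows "bdist \<Omega> x > 0 \<longleftrightarrow> x \<in> \<Omega>"
proof -
  have "closed (- \<Omega>)" using assms(1) by auto
  then have "x \<in> - \<Omega> \<longleftrightarrow> bdist \<Omega> x = 0"
    by (rule in_closed_iff_infdist_zero) (rule bounded_Compl_nonempty[OF assms(2)])
  then show ?thesis using infdist_nonneg[of x "- \<Omega>"] by auto
qed

text \<open>The segment from \<open>x\<close> to the nearest point of the complement meets the
  boundary. Reaching that point and then the centre of its exterior ball costs the depth
  twice.\<close>

lemma exterior_ball:
  fixes \<Omega> :: "'a::euclidean_space set"
  assumes "open \<Omega>" "bounded \<Omega>" "lipschitz_boundary \<Omega>"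
  obtains \<kappa> where "0 < \<kappa>" "\<kappa> \<le> 1"
    "\<And>x. x \<in> \<Omega> \<Longrightarrow> \<exists>z. norm (z - x) \<le> 2 * bdist \<Omega> x \<and> ball z (\<kappa> * bdist \<Omega> x) \<inter> \<Omega> = {}"
proof -
  obtain R where R: "R > 0" "\<And>x. x \<in> \<Omega> \<Longrightarrow> norm x \<le> R"
    using assms(2) unfolding bounded_pos by blast
  obtain w :: 'a where w: "norm w = R + 1" using vector_choose_size[of "R + 1"] R by auto
  have "w \<notin> \<Omega>" using R(2)[of w] w by auto
  \<comment> \<open>The auxiliary point \<open>w\<close> outside the domain bounds all depths at
    once, as the uniform exterior ball condition requires an upper bound for
    \<open>t\<close>.\<close>
  have D: "bdist \<Omega> x \<le> 2 * R + 1" if "x \<in> \<Omega>" for x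
  proof -
    have "bdist \<Omega> x \<le> dist x w" using \<open>w \<notin> \<Omega>\<close> by (intro infdist_le) auto
    also have "\<dots> \<le> norm x + norm w" by (simp add: dist_norm norm_triangle_ineq4)
    finally show ?thesis using R(2)[OF that] w by simp
  qed
  obtain \<kappa> where \<kappa>: "0 < \<kappa>" "\<kappa> \<le> 1"
    "\<And>q t. q \<in> frontier \<Omega> \<Longrightarrow> 0 < t \<Longrightarrow> t \<le> 2 * R + 1 \<Longrightarrow> \<exists>z. norm (z - q) \<le> t \<and> ball z (\<kappa> * t) \<inter> \<Omega> = {}"
    using lipschitz_boundary_exterior_ball[OF assms, of "2 * R + 1"] R by auto
  show ?thesis
  proof (rule that[OF \<kappa>(1,2)])
    fix x assume x: "x \<in> \<Omega>"
    have "closed (- \<Omega>)" using assms(1) by auto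
    then obtain y where y: "y \<in> - \<Omega>" "bdist \<Omega> x = dist x y"
      using infdist_attains_inf[of "- \<Omega>" x] bounded_Compl_nonempty[OF assms(2)] by blast
    have "closed_segment x y \<inter> frontier \<Omega> \<noteq> {}"
      by (rule connected_Int_frontier) (use x y in auto)
    then obtain q where q: "q \<in> closed_segment x y" "q \<in> frontier \<Omega>" by blast
    have qx: "norm (q - x) \<le> bdist \<Omega> x"
      using segment_bound(1)[OF q(1)] y(2) by (simp add: dist_norm norm_minus_commute)
    obtain z where z: "norm (z - q) \<le> bdist \<Omega> x" "ball z (\<kappa> * bdist \<Omega> x) \<inter> \<Omega> = {}"
    proof -
      have "0 < bdist \<Omega> x" using bdist_pos[OF assms(1,2)] x by simp
      then show ?thesis using \<kappa>(3)[OF q(2) _ D[OF x]] that by blast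
    qed
    have "norm (z - x) \<le> norm (z - q) + norm (q - x)"
      using norm_triangle_ineq[of "z - q" "q - x"] by simp
    then have "norm (z - x) \<le> 2 * bdist \<Omega> x" using z(1) qx by simp
    then show "\<exists>z. norm (z - x) \<le> 2 * bdist \<Omega> x \<and> ball z (\<kappa> * bdist \<Omega> x) \<inter> \<Omega> = {}"
      using z(2) by blast
  qed
qed

lemma bdist_measurable [measurable]: "bdist \<Omega> \<in> borel_measurable borel"
  by (intro borel_measurable_continuous_onI continuous_on_infdist continuous_on_id)

text \<open>Hardy's inequality is immediate for functions vanishing outside \<open>\<Omega>\<close>: the exterior ball
  near \<open>x\<close> already contributes the integrand.\<close>

lemma fractional_Hardy:
  fixes \<Omega> :: "'a::euclidean_space set" and s :: real
  assumes \<Omega>: "open \<Omega>" "bounded \<Omega>" "lipschitz_boundary \<Omega>" and s: "0 < s" and \<Phi>: "orlicz_function \<Phi>"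
  obtains C where "C \<ge> 0"
    "\<And>u L. u \<in> borel_measurable borel \<Longrightarrow> (\<And>x. x \<notin> \<Omega> \<Longrightarrow> u x = 0) \<Longrightarrow> L > 0 \<Longrightarrow>
      (\<integral>\<^sup>+x. ennreal (\<Phi> (\<bar>u x\<bar> / (3 * bdist \<Omega> x) powr s / L)) * indicator \<Omega> x \<partial>lborel)
        \<le> ennreal C * orlicz_modular \<Phi> frac_measure (\<lambda>z. frac_quot s u z / L)"
proof -
  obtain \<kappa> where \<kappa>: "0 < \<kappa>" "\<kappa> \<le> 1"
    "\<And>x. x \<in> \<Omega> \<Longrightarrow> \<exists>z. norm (z - x) \<le> 2 * bdist \<Omega> x \<and> ball z (\<kappa> * bdist \<Omega> x) \<inter> \<Omega> = {}"
    using exterior_ball[OF \<Omega>] by blast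
  let ?n = "DIM('a)"
  \<comment> \<open>Points of the exterior ball have distance at most
    \<open>2 * d + \<kappa> * d \<le> 3 * d\<close> from \<open>x\<close>, where \<open>d\<close> is
    the depth of \<open>x\<close>; \<open>c\<close> is the volume of that ball times the density
    \<open>1 / (3 * d) ^ n\<close>.\<close>
  define c where "c = unit_ball_vol (real ?n) * (\<kappa> / 3) ^ ?n"
  have c: "c > 0" using \<kappa> by (simp add: c_def)
  show ?thesis
  proof (rule that[of "1 / c"])
    show "0 \<le> 1 / c" using c by simp
    fix u :: "'a \<Rightarrow> real" and L :: real
    assume u [measurable]: "u \<in> borel_measurable borel" and u0: "\<And>x. x \<notin> \<Omega> \<Longrightarrow> u x = 0" and L: "L > 0"
    note [measurable] = borel_measurable_orlicz_function[OF \<Phi>]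
    let ?D = "\<lambda>x y. ennreal (1 / norm (x - y) ^ ?n) * ennreal (\<Phi> \<bar>(u x - u y) / norm (x - y) powr s / L\<bar>)"
    let ?h = "\<lambda>x. \<Phi> (\<bar>u x\<bar> / (3 * bdist \<Omega> x) powr s / L)"
    have pt: "ennreal (?h x) * indicator \<Omega> x \<le> ennreal (1 / c) * (\<integral>\<^sup>+y. ?D x y \<partial>lborel)" for x
    proof (cases "x \<in> \<Omega>")
      case True
      define d where "d = bdist \<Omega> x"
      have d: "d > 0" using True bdist_pos[OF \<Omega>(1,2)] by (simp add: d_def)
      obtain z where z: "norm (z - x) \<le> 2 * d" "ball z (\<kappa> * d) \<inter> \<Omega> = {}"
        using \<kappa>(3)[OF True] by (auto simp: d_def)
      have h: "?h x \<ge> 0" using L by (intro orlicz_function_nonneg[OF \<Phi>]) simp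
      have "c * ?h x = (1 / (3 * d) ^ ?n * ?h x) * (unit_ball_vol (real ?n) * (\<kappa> * d) ^ ?n)"
        using d by (simp add: c_def power_mult_distrib power_divide)
      then have "ennreal (c * ?h x) = ennreal (1 / (3 * d) ^ ?n * ?h x * (unit_ball_vol (real ?n) * (\<kappa> * d) ^ ?n))"
        by simp
      also have "\<dots> = ennreal (1 / (3 * d) ^ ?n * ?h x) * emeasure lborel (ball z (\<kappa> * d))"
        using d \<kappa> by (subst ennreal_mult'') (auto simp: emeasure_ball)
      also have "\<dots> = (\<integral>\<^sup>+y. ennreal (1 / (3 * d) ^ ?n * ?h x) * indicator (ball z (\<kappa> * d)) y \<partial>lborel)"
        by (subst nn_integral_cmult_indicator) auto
      also have "\<dots> \<le> (\<integral>\<^sup>+y. ?D x y \<partial>lborel)"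
      proof (rule nn_integral_mono)
        fix y
        show "ennreal (1 / (3 * d) ^ ?n * ?h x) * indicator (ball z (\<kappa> * d)) y \<le> ?D x y"
        proof (cases "y \<in> ball z (\<kappa> * d)")
          case y: True
          then have "y \<notin> \<Omega>" using z(2) by blast
          then have "u y = 0" "x \<noteq> y" using u0 True by auto
          then have \<rho>: "norm (x - y) > 0" by simp
          have "norm (z - y) < d"
          proof -
            have "\<kappa> * d \<le> 1 * d" using \<kappa>(2) d by (intro mult_right_mono) auto
            then show ?thesis using y by (simp add: dist_norm)
          qed
          then have le: "norm (x - y) \<le> 3 * d"
            using z(1) norm_triangle_ineq[of "x - z" "z - y"] by (simp add: norm_minus_commute)
          have "?h x \<le> \<Phi> \<bar>(u x - u y) / norm (x - y) powr s / L\<bar>"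
          proof (rule orlicz_function_mono[OF \<Phi>])
            have "norm (x - y) powr s \<le> (3 * d) powr s" using le s by (intro powr_mono2) auto
            then have "\<bar>u x\<bar> / (3 * d) powr s / L \<le> \<bar>u x\<bar> / norm (x - y) powr s / L"
              using \<rho> L d by (intro divide_right_mono divide_left_mono mult_pos_pos) auto
            then show "\<bar>u x\<bar> / (3 * bdist \<Omega> x) powr s / L \<le> \<bar>(u x - u y) / norm (x - y) powr s / L\<bar>"
              using L by (simp add: \<open>u y = 0\<close> abs_divide d_def)
          qed (use L in simp)
          moreover have "1 / (3 * d) ^ ?n \<le> 1 / norm (x - y) ^ ?n"
            using \<rho> le d by (intro divide_left_mono power_mono mult_pos_pos) auto
          ultimately have "1 / (3 * d) ^ ?n * ?h x \<le> 1 / norm (x - y) ^ ?n * \<Phi> \<bar>(u x - u y) / norm (x - y) powr s / L\<bar>"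
            using h by (intro mult_mono) auto
          then have "ennreal (1 / (3 * d) ^ ?n * ?h x) \<le> ennreal (1 / norm (x - y) ^ ?n * \<Phi> \<bar>(u x - u y) / norm (x - y) powr s / L\<bar>)"
            by (rule ennreal_leI)
          also have "\<dots> = ?D x y" by (rule ennreal_mult') simp
          finally show ?thesis using y by simp
        qed simp
      qed
      finally have "ennreal (1 / c) * ennreal (c * ?h x) \<le> ennreal (1 / c) * (\<integral>\<^sup>+y. ?D x y \<partial>lborel)"
        by (rule mult_left_mono) simp
      moreover have "ennreal (1 / c) * ennreal (c * ?h x) = ennreal (?h x)"
        using c by (subst ennreal_mult'[symmetric]) auto
      ultimately show ?thesis using True by simp
    qed simp
    have "(\<integral>\<^sup>+x. ennreal (?h x) * indicator \<Omega> x \<partial>lborel) \<le> (\<integral>\<^sup>+x. ennreal (1 / c) * (\<integral>\<^sup>+y. ?D x y \<partial>lborel) \<partial>lborel)"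
      by (intro nn_integral_mono pt)
    also have "\<dots> = ennreal (1 / c) * (\<integral>\<^sup>+x. \<integral>\<^sup>+y. ?D x y \<partial>lborel \<partial>lborel)"
      by (rule nn_integral_cmult) measurable
    also have "(\<integral>\<^sup>+x. \<integral>\<^sup>+y. ?D x y \<partial>lborel \<partial>lborel) = orlicz_modular \<Phi> frac_measure (\<lambda>z. frac_quot s u z / L)"
      by (rule frac_modular_eq[OF \<Phi> u, symmetric])
    finally show "(\<integral>\<^sup>+x. ennreal (?h x) * indicator \<Omega> x \<partial>lborel) \<le>
        ennreal (1 / c) * orlicz_modular \<Phi> frac_measure (\<lambda>z. frac_quot s u z / L)" .
  qed
qed

section \<open>Cutoff functions\<close>

text \<open>Piecewise linear in the depth with slope \<open>k\<close>. The zero layer up to depth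
  \<open>1 / k\<close> makes the support compact and leaves room for mollification.\<close>

definition cutoff :: "'a::euclidean_space set \<Rightarrow> real \<Rightarrow> 'a \<Rightarrow> real" where
  "cutoff \<Omega> k x = min 1 (max 0 (k * bdist \<Omega> x - 1))"

lemma cutoff_range: "0 \<le> cutoff \<Omega> k x" "cutoff \<Omega> k x \<le> 1"
  by (auto simp: cutoff_def)

lemma cutoff_measurable [measurable]: "cutoff \<Omega> k \<in> borel_measurable borel"
  unfolding cutoff_def[abs_def] by measurable

lemma cutoff_lipschitz:
  assumes "k \<ge> 0" shows "\<bar>cutoff \<Omega> k x - cutoff \<Omega> k y\<bar> \<le> k * norm (x - y)"
proof -
  have "\<bar>min 1 (max 0 (a - 1)) - min 1 (max 0 (b - 1))\<bar> \<le> \<bar>a - b\<bar>" for a b :: real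
    by (auto simp: min_def max_def)
  then have "\<bar>cutoff \<Omega> k x - cutoff \<Omega> k y\<bar> \<le> \<bar>k * bdist \<Omega> x - k * bdist \<Omega> y\<bar>"
    by (simp add: cutoff_def)
  also have "\<dots> = k * \<bar>bdist \<Omega> x - bdist \<Omega> y\<bar>"
    using assms by (simp add: right_diff_distrib[symmetric] abs_mult)
  also have "\<dots> \<le> k * norm (x - y)"
    using assms infdist_triangle_abs[of x "- \<Omega>" y] by (intro mult_left_mono) (auto simp: dist_norm)
  finally show ?thesis .
qed

lemma cutoff_diff_le_1: "\<bar>cutoff \<Omega> k x - cutoff \<Omega> k y\<bar> \<le> 1"
  using cutoff_range[of \<Omega> k x] cutoff_range[of \<Omega> k y] by linarith

lemma cutoff_eq_0: "k > 0 \<Longrightarrow> bdist \<Omega> x < 1 / k \<Longrightarrow> cutoff \<Omega> k x = 0"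
  by (simp add: cutoff_def field_simps)

lemma cutoff_eq_1: "k > 0 \<Longrightarrow> 2 / k \<le> bdist \<Omega> x \<Longrightarrow> cutoff \<Omega> k x = 1"
  by (simp add: cutoff_def field_simps)

lemma cutoff_outside: "k > 0 \<Longrightarrow> x \<notin> \<Omega> \<Longrightarrow> cutoff \<Omega> k x = 0"
  by (intro cutoff_eq_0) auto

text \<open>The bound is free of \<open>k\<close>. If \<open>y\<close> has depth at most
  \<open>4 / k\<close>, the Lipschitz constant \<open>k\<close> is at most four times its inverse
  depth. If \<open>y\<close> is deeper, the cutoff equals 1 there, and it can differ at
  \<open>x\<close> only if \<open>x\<close> lies at less than half that depth, hence far
  away.\<close>

lemma cutoff_difference_bound:
  assumes k: "k > 0" and d: "bdist \<Omega> y > 0"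
  shows "\<bar>cutoff \<Omega> k x - cutoff \<Omega> k y\<bar> \<le> min 1 (norm (x - y) / (bdist \<Omega> y / 4))"
proof -
  have "\<bar>cutoff \<Omega> k x - cutoff \<Omega> k y\<bar> \<le> norm (x - y) / (bdist \<Omega> y / 4)"
  proof (cases "bdist \<Omega> y \<le> 4 / k")
    case True
    then have "k \<le> 4 / bdist \<Omega> y" using k d by (simp add: field_simps)
    then have "k * norm (x - y) \<le> 4 / bdist \<Omega> y * norm (x - y)" by (intro mult_right_mono) auto
    also have "\<dots> = norm (x - y) / (bdist \<Omega> y / 4)" by simp
    finally show ?thesis using cutoff_lipschitz[of k \<Omega> x y] k by linarith
  next
    case False
    show ?thesis
    proof (cases "2 / k \<le> bdist \<Omega> x")
      case True
      have "2 / k \<le> bdist \<Omega> y" using False k divide_right_mono[of 2 4 k] by linarith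
      then show ?thesis using True k d by (simp add: cutoff_eq_1)
    next
      case F2: False
      have "bdist \<Omega> y - bdist \<Omega> x \<le> norm (x - y)"
        using infdist_triangle_abs[of y "- \<Omega>" x] by (simp add: dist_norm norm_minus_commute)
      moreover have "4 / k = 2 * (2 / k)" by simp
      ultimately have "bdist \<Omega> y / 2 \<le> norm (x - y)" using False F2 by linarith
      then have "1 \<le> norm (x - y) / (bdist \<Omega> y / 4)" using d by (simp add: field_simps)
      then show ?thesis using cutoff_diff_le_1[of \<Omega> k x y] by linarith
    qed
  qed
  then show ?thesis using cutoff_diff_le_1[of \<Omega> k x y] by simp
qed

lemma cutoff_tendsto_1:
  fixes \<Omega> :: "'a::euclidean_space set"
  assumes "open \<Omega>" "bounded \<Omega>" "x \<in> \<Omega>"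
  shows "(\<lambda>k. cutoff \<Omega> (real (Suc k)) x) \<longlonglongrightarrow> 1"
proof (rule tendsto_eventually)
  have d: "bdist \<Omega> x > 0" using assms bdist_pos by blast
  have "eventually (\<lambda>k. real k \<ge> 2 / bdist \<Omega> x) sequentially"
    using filterlim_real_sequentially by (simp add: filterlim_at_top)
  then show "\<forall>\<^sub>F k in sequentially. cutoff \<Omega> (real (Suc k)) x = 1"
  proof eventually_elim
    case (elim k)
    then have "2 / bdist \<Omega> x \<le> real (Suc k)" by simp
    then show ?case using d by (intro cutoff_eq_1) (auto simp: field_simps simp del: of_nat_Suc)
  qed
qed

lemma cutoff_support_compact:
  fixes \<Omega> :: "'a::euclidean_space set"
  assumes "open \<Omega>" "bounded \<Omega>" "k > 0"
  shows "compact {x. 1 / k \<le> bdist \<Omega> x}" "{x. 1 / k \<le> bdist \<Omega> x} \<subseteq> \<Omega>"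
proof -
  show sub: "{x. 1 / k \<le> bdist \<Omega> x} \<subseteq> \<Omega>"
  proof
    fix x assume "x \<in> {x. 1 / k \<le> bdist \<Omega> x}"
    moreover have "0 < 1 / k" using assms(3) by simp
    ultimately have "0 < bdist \<Omega> x" by (simp only: mem_Collect_eq less_le_trans)
    then show "x \<in> \<Omega>" by (simp only: bdist_pos[OF assms(1,2)])
  qed
  have "closed {x. 1 / k \<le> bdist \<Omega> x}"
    by (intro closed_Collect_le continuous_on_infdist continuous_on_id continuous_on_const)
  then show "compact {x. 1 / k \<le> bdist \<Omega> x}"
    using bounded_subset[OF assms(2) sub] by (simp add: compact_eq_bounded_closed)
qed

text \<open>The discrete product rule splits the increment into one of \<open>u\<close> and one of
  the cutoff, weighted by \<open>u y\<close>. For the latter the radial kernel bound, at a radius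
  proportional to the depth of \<open>y\<close>, leaves exactly the integrand of Hardy's inequality.
  All constants are independent of \<open>k\<close>.\<close>

lemma cutoff_modular_bound:
  fixes \<Omega> :: "'a::euclidean_space set" and s :: real
  assumes \<Omega>: "open \<Omega>" "bounded \<Omega>" "lipschitz_boundary \<Omega>" and s: "0 < s" "s < 1" and \<Phi>: "orlicz_function \<Phi>"
    and u [measurable]: "u \<in> borel_measurable borel" and u0: "\<And>x. x \<notin> \<Omega> \<Longrightarrow> u x = 0" and L: "L > 0"
    and le1: "orlicz_modular \<Phi> frac_measure (\<lambda>z. frac_quot s u z / L) \<le> 1"
  obtains C where "\<And>k. k > 0 \<Longrightarrow>
    orlicz_modular \<Phi> frac_measure (\<lambda>z. frac_quot s (\<lambda>x. u x * cutoff \<Omega> k x) z / (24 * L)) \<le> ennreal C"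
proof -
  let ?n = "DIM('a)"
  obtain C1 where C1_nonneg: "C1 \<ge> 0" and C1_bound:
    "\<And>u L. u \<in> borel_measurable borel \<Longrightarrow> (\<And>x. x \<notin> \<Omega> \<Longrightarrow> u x = 0) \<Longrightarrow> L > 0 \<Longrightarrow>
      (\<integral>\<^sup>+x. ennreal (\<Phi> (\<bar>u x\<bar> / (3 * bdist \<Omega> x) powr s / L)) * indicator \<Omega> x \<partial>lborel)
        \<le> ennreal C1 * orlicz_modular \<Phi> frac_measure (\<lambda>z. frac_quot s u z / L)"
    by (rule fractional_Hardy[OF \<Omega> s(1) \<Phi>]) blast
  note C1 = C1_nonneg C1_bound[OF u u0 L]
  obtain C2 where C2_nonneg: "C2 \<ge> 0" and C2_bound: "\<And>\<Phi> A d (y::'a). orlicz_function \<Phi> \<Longrightarrow> A \<ge> 0 \<Longrightarrow> d > 0 \<Longrightarrow>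
      (\<integral>\<^sup>+x. ennreal (1 / norm (x - y) ^ ?n) * ennreal (\<Phi> (A * min 1 (norm (x - y) / d) / norm (x - y) powr s)) \<partial>lborel)
        \<le> ennreal (C2 * \<Phi> (A / d powr s))"
    by (rule radial_kernel_bound[OF s, where 'a='a]) blast
  note C2 = C2_nonneg C2_bound[OF \<Phi>]
  note [measurable] = borel_measurable_orlicz_function[OF \<Phi>]
  show ?thesis
  proof (rule that[of "1 + C2 * C1"])
    fix k :: real assume k: "k > 0"
    let ?\<psi> = "cutoff \<Omega> k"
    let ?v = "\<lambda>x. u x * ?\<psi> x"
    \<comment> \<open>The scale is enlarged by 2 for midpoint convexity and by 12 because
      \<open>(3 * d) powr s \<le> 12 * (d / 4) powr s\<close>, which passes from the radius
      \<open>d / 4\<close> of the cutoff estimate to the \<open>3 * d\<close> of Hardy's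
      inequality.\<close>
    define a where "a z = frac_quot s u z / (24 * L)" for z
    define b where "b = (\<lambda>(x, y). u y * (?\<psi> x - ?\<psi> y) / norm (x - y) powr s / (24 * L))"
    have bm: "b \<in> borel_measurable borel" unfolding b_def borel_prod[symmetric] by measurable
    have am: "a \<in> borel_measurable borel" unfolding a_def by measurable
    have vm: "(\<lambda>z. frac_quot s ?v z / (24 * L)) \<in> borel_measurable borel" by measurable
    have pt: "\<bar>frac_quot s ?v z / (24 * L)\<bar> \<le> \<bar>a z\<bar> + \<bar>b z\<bar>" for z
    proof (cases z)
      case (Pair x y)
      have "\<bar>?v x - ?v y\<bar> \<le> \<bar>u x - u y\<bar> + \<bar>u y * (?\<psi> x - ?\<psi> y)\<bar>"
      proof -
        have "?v x - ?v y = (u x - u y) * ?\<psi> x + u y * (?\<psi> x - ?\<psi> y)" by (simp add: algebra_simps)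
        moreover have "\<bar>(u x - u y) * ?\<psi> x\<bar> \<le> \<bar>u x - u y\<bar>"
          using cutoff_range[of \<Omega> k x] by (simp add: abs_mult mult_left_le)
        ultimately show ?thesis using abs_triangle_ineq[of "(u x - u y) * ?\<psi> x" "u y * (?\<psi> x - ?\<psi> y)"] by linarith
      qed
      then have "\<bar>?v x - ?v y\<bar> / (norm (x - y) powr s * (24 * L)) \<le>
          (\<bar>u x - u y\<bar> + \<bar>u y * (?\<psi> x - ?\<psi> y)\<bar>) / (norm (x - y) powr s * (24 * L))"
        using L by (intro divide_right_mono) auto
      moreover have "\<bar>frac_quot s ?v z / (24 * L)\<bar> = \<bar>?v x - ?v y\<bar> / (norm (x - y) powr s * (24 * L))"
        using L by (simp add: Pair frac_quot_def abs_divide)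
      moreover have "\<bar>a z\<bar> = \<bar>u x - u y\<bar> / (norm (x - y) powr s * (24 * L))"
        using L by (simp add: Pair a_def frac_quot_def abs_divide)
      moreover have "\<bar>b z\<bar> = \<bar>u y * (?\<psi> x - ?\<psi> y)\<bar> / (norm (x - y) powr s * (24 * L))"
        using L by (simp add: Pair b_def abs_divide)
      ultimately show ?thesis by (simp only: add_divide_distrib)
    qed
    have "orlicz_modular \<Phi> frac_measure (\<lambda>z. frac_quot s ?v z / (24 * L)) \<le>
        orlicz_modular \<Phi> frac_measure (\<lambda>z. 2 * a z) + orlicz_modular \<Phi> frac_measure (\<lambda>z. 2 * b z)"
      by (rule orlicz_modular_sum_le[OF \<Phi> borel_measurable_frac_measureI[OF am] borel_measurable_frac_measureI[OF bm] AE_I2 borel_measurable_frac_measureI[OF vm]]) (rule pt)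
    also have "orlicz_modular \<Phi> frac_measure (\<lambda>z. 2 * a z) \<le> 1"
    proof (rule order_trans[OF orlicz_modular_mono[OF \<Phi>] le1], rule AE_I2)
      fix z show "\<bar>2 * a z\<bar> \<le> \<bar>frac_quot s u z / L\<bar>"
        using L by (simp add: a_def abs_mult abs_divide divide_left_mono)
    qed
    also have "orlicz_modular \<Phi> frac_measure (\<lambda>z. 2 * b z) \<le> ennreal (C2 * C1)"
    proof -
      have "(\<lambda>z. ennreal (\<Phi> \<bar>2 * b z\<bar>)) \<in> borel_measurable borel" using bm by measurable
      from nn_integral_frac_measure[OF this]
      have "orlicz_modular \<Phi> frac_measure (\<lambda>z. 2 * b z) =
          (\<integral>\<^sup>+x. \<integral>\<^sup>+y. ennreal (1 / norm (x - y) ^ ?n) * ennreal (\<Phi> \<bar>2 * b (x, y)\<bar>) \<partial>lborel \<partial>lborel)"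
        by (simp add: orlicz_modular_def)
      \<comment> \<open>The weight \<open>u y\<close> and the depth of \<open>y\<close> are fixed
        parameters of the kernel bound, so \<open>x\<close> has to be integrated first.\<close>
      also have "\<dots> = (\<integral>\<^sup>+y. \<integral>\<^sup>+x. ennreal (1 / norm (x - y) ^ ?n) * ennreal (\<Phi> \<bar>2 * b (x, y)\<bar>) \<partial>lborel \<partial>lborel)"
        unfolding b_def prod.case by (rule lborel_pair.Fubini'[symmetric]) measurable
      also have "\<dots> \<le> (\<integral>\<^sup>+y. ennreal C2 * (ennreal (\<Phi> (\<bar>u y\<bar> / (3 * bdist \<Omega> y) powr s / L)) * indicator \<Omega> y) \<partial>lborel)"
      proof (rule nn_integral_mono)
        fix y :: 'a
        show "(\<integral>\<^sup>+x. ennreal (1 / norm (x - y) ^ ?n) * ennreal (\<Phi> \<bar>2 * b (x, y)\<bar>) \<partial>lborel) \<le>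
            ennreal C2 * (ennreal (\<Phi> (\<bar>u y\<bar> / (3 * bdist \<Omega> y) powr s / L)) * indicator \<Omega> y)"
        proof (cases "y \<in> \<Omega>")
          case False
          then show ?thesis by (simp add: b_def u0 orlicz_function_zero[OF \<Phi>])
        next
          case True
          define d where "d = bdist \<Omega> y"
          have d: "d > 0" using True bdist_pos[OF \<Omega>(1,2)] by (simp add: d_def)
          define A where "A = \<bar>u y\<bar> / (12 * L)"
          have A: "A \<ge> 0" using L by (simp add: A_def)
          have "(\<integral>\<^sup>+x. ennreal (1 / norm (x - y) ^ ?n) * ennreal (\<Phi> \<bar>2 * b (x, y)\<bar>) \<partial>lborel) \<le>
            (\<integral>\<^sup>+x. ennreal (1 / norm (x - y) ^ ?n) * ennreal (\<Phi> (A * min 1 (norm (x - y) / (d / 4)) / norm (x - y) powr s)) \<partial>lborel)"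
          proof (intro nn_integral_mono mult_left_mono ennreal_leI orlicz_function_mono[OF \<Phi>])
            fix x
            have "\<bar>2 * b (x, y)\<bar> = A * \<bar>?\<psi> x - ?\<psi> y\<bar> / norm (x - y) powr s"
              using L by (simp add: b_def A_def abs_mult abs_divide)
            also have "\<dots> \<le> A * min 1 (norm (x - y) / (d / 4)) / norm (x - y) powr s"
              using A d cutoff_difference_bound[OF k, of y \<Omega> x] unfolding d_def
              by (intro divide_right_mono mult_left_mono) auto
            finally show "\<bar>2 * b (x, y)\<bar> \<le> A * min 1 (norm (x - y) / (d / 4)) / norm (x - y) powr s" .
          qed auto
          also have "\<dots> \<le> ennreal (C2 * \<Phi> (A / (d / 4) powr s))"
            using A d by (intro C2) auto
          also have "\<dots> \<le> ennreal (C2 * \<Phi> (\<bar>u y\<bar> / (3 * d) powr s / L))"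
          proof (intro ennreal_leI mult_left_mono orlicz_function_mono[OF \<Phi>] C2)
            have "(12::real) powr s \<le> 12 powr 1" using s by (intro powr_mono) auto
            then have "(3 * d) powr s * 4 powr s \<le> 12 * d powr s"
              using d by (simp add: powr_mult[symmetric]) (simp add: powr_mult)
            then have "(3 * d) powr s \<le> 12 * (d / 4) powr s"
              using d by (simp add: powr_divide field_simps)
            then have "\<bar>u y\<bar> / (12 * (d / 4) powr s) / L \<le> \<bar>u y\<bar> / (3 * d) powr s / L"
              using L d by (intro divide_right_mono divide_left_mono mult_pos_pos) auto
            then show "A / (d / 4) powr s \<le> \<bar>u y\<bar> / (3 * d) powr s / L"
              by (simp add: A_def mult_ac)
          qed (use A in auto)
          also have "\<dots> = ennreal C2 * ennreal (\<Phi> (\<bar>u y\<bar> / (3 * d) powr s / L))"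
            using C2(1) by (rule ennreal_mult')
          finally show ?thesis using True by (simp add: d_def)
        qed
      qed
      also have "\<dots> = ennreal C2 * (\<integral>\<^sup>+y. ennreal (\<Phi> (\<bar>u y\<bar> / (3 * bdist \<Omega> y) powr s / L)) * indicator \<Omega> y \<partial>lborel)"
      proof (rule nn_integral_cmult)
        have [measurable]: "\<Omega> \<in> sets borel" using \<Omega>(1) by simp
        have "(\<lambda>y. ennreal (\<Phi> \<bar>\<bar>u y\<bar> / (3 * bdist \<Omega> y) powr s / L\<bar>) * indicator \<Omega> y) \<in> borel_measurable lborel" by measurable
        then show "(\<lambda>y. ennreal (\<Phi> (\<bar>u y\<bar> / (3 * bdist \<Omega> y) powr s / L)) * indicator \<Omega> y) \<in> borel_measurable lborel"
          using L by (simp add: abs_divide)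
      qed
      also have "\<dots> \<le> ennreal C2 * (ennreal C1 * 1)"
        by (intro mult_left_mono order_trans[OF C1(2)] le1) auto
      also have "\<dots> = ennreal (C2 * C1)" using C1 C2 by (simp add: ennreal_mult')
      finally show ?thesis .
    qed
    finally show "orlicz_modular \<Phi> frac_measure (\<lambda>z. frac_quot s ?v z / (24 * L)) \<le> ennreal (1 + C2 * C1)"
      using C1 C2 by (simp add: ennreal_plus add_mono)
  qed
qed

text \<open>Provides competitors of finite energy at scale one. The integrand vanishes unless one of
  the points lies in the domain; the radial kernel bound with \<open>d = 1 / k\<close> then leaves
  an integral over a set of finite measure, and symmetry treats both cases alike.\<close>

lemma cutoff_frac_modular_finite:
  fixes \<Omega> :: "'a::euclidean_space set" and s :: real
  assumes \<Omega>: "open \<Omega>" "bounded \<Omega>" and s: "0 < s" "s < 1" and \<Phi>: "orlicz_function \<Phi>" and k: "k > 0" and c: "c \<ge> 0"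
  shows "orlicz_modular \<Phi> frac_measure (frac_quot s (\<lambda>x. c * cutoff \<Omega> k x)) < \<infinity>"
proof -
  let ?n = "DIM('a)" and ?\<psi> = "cutoff \<Omega> k"
  obtain C2 where C2_nonneg: "C2 \<ge> 0" and C2_bound: "\<And>\<Phi> A d (y::'a). orlicz_function \<Phi> \<Longrightarrow> A \<ge> 0 \<Longrightarrow> d > 0 \<Longrightarrow>
      (\<integral>\<^sup>+x. ennreal (1 / norm (x - y) ^ ?n) * ennreal (\<Phi> (A * min 1 (norm (x - y) / d) / norm (x - y) powr s)) \<partial>lborel)
        \<le> ennreal (C2 * \<Phi> (A / d powr s))"
    by (rule radial_kernel_bound[OF s, where 'a='a]) blast
  note C2 = C2_nonneg C2_bound[OF \<Phi>]
  note [measurable] = borel_measurable_orlicz_function[OF \<Phi>]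
  have [measurable]: "\<Omega> \<in> sets borel" using \<Omega>(1) by simp
  define H where "H x y = ennreal (1 / norm (x - y) ^ ?n) * ennreal (\<Phi> \<bar>c * min 1 (norm (x - y) / (1 / k)) / norm (x - y) powr s\<bar>)" for x y :: 'a
  have Hm: "(\<lambda>(x, y). H x y) \<in> borel_measurable (lborel \<Otimes>\<^sub>M lborel)" "\<And>y. (\<lambda>x. H x y) \<in> borel_measurable borel" "\<And>x. H x \<in> borel_measurable borel"
    unfolding H_def by measurable
  note [measurable] = Hm
  have H_sym: "H x y = H y x" for x y by (simp add: H_def norm_minus_commute)
  have H_int: "(\<integral>\<^sup>+x. H x y \<partial>lborel) \<le> ennreal (C2 * \<Phi> (c / (1 / k) powr s))" for y
  proof -
    have eq: "\<bar>c * min 1 (norm (x - y) / (1 / k)) / norm (x - y) powr s\<bar> = c * min 1 (norm (x - y) / (1 / k)) / norm (x - y) powr s" for x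
      using c k by simp
    have "0 < 1 / k" using k by simp
    from C2(2)[OF c this, of y] show ?thesis unfolding H_def eq .
  qed
  have fin: "emeasure lborel \<Omega> < \<infinity>" using emeasure_bounded_finite[OF \<Omega>(2)] by simp
  have I: "(\<integral>\<^sup>+y. indicator \<Omega> y * (\<integral>\<^sup>+x. H x y \<partial>lborel) \<partial>lborel) < \<infinity>"
  proof -
    have "(\<integral>\<^sup>+y. indicator \<Omega> y * (\<integral>\<^sup>+x. H x y \<partial>lborel) \<partial>lborel) \<le> (\<integral>\<^sup>+y. indicator \<Omega> y * ennreal (C2 * \<Phi> (c / (1 / k) powr s)) \<partial>lborel)"
      by (intro nn_integral_mono mult_left_mono H_int) simp
    also have "\<dots> = emeasure lborel \<Omega> * ennreal (C2 * \<Phi> (c / (1 / k) powr s))"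
      by (simp add: nn_integral_multc)
    also have "\<dots> < \<infinity>" using fin by (simp add: ennreal_mult_less_top)
    finally show ?thesis .
  qed
  have "orlicz_modular \<Phi> frac_measure (frac_quot s (\<lambda>x. c * ?\<psi> x)) =
      (\<integral>\<^sup>+x. \<integral>\<^sup>+y. ennreal (1 / norm (x - y) ^ ?n) * ennreal (\<Phi> \<bar>(c * ?\<psi> x - c * ?\<psi> y) / norm (x - y) powr s / 1\<bar>) \<partial>lborel \<partial>lborel)"
    using frac_modular_eq[OF \<Phi>, where L=1 and s=s and u="\<lambda>x. c * ?\<psi> x"] by simp
  also have "\<dots> \<le> (\<integral>\<^sup>+x. \<integral>\<^sup>+y. indicator \<Omega> x * H x y + indicator \<Omega> y * H x y \<partial>lborel \<partial>lborel)"
  proof (intro nn_integral_mono)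
    fix x y :: 'a
    show "ennreal (1 / norm (x - y) ^ ?n) * ennreal (\<Phi> \<bar>(c * ?\<psi> x - c * ?\<psi> y) / norm (x - y) powr s / 1\<bar>) \<le> indicator \<Omega> x * H x y + indicator \<Omega> y * H x y"
    proof (cases "x \<in> \<Omega> \<or> y \<in> \<Omega>")
      case False
      then show ?thesis using k by (simp add: cutoff_outside orlicz_function_zero[OF \<Phi>])
    next
      case True
      have "\<bar>?\<psi> x - ?\<psi> y\<bar> \<le> min 1 (norm (x - y) / (1 / k))"
        using cutoff_lipschitz[of k \<Omega> x y] cutoff_diff_le_1[of \<Omega> k x y] k by (simp add: mult.commute)
      then have le: "c * \<bar>?\<psi> x - ?\<psi> y\<bar> / norm (x - y) powr s \<le> c * min 1 (norm (x - y) / (1 / k)) / norm (x - y) powr s"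
        using c by (intro divide_right_mono mult_left_mono) auto
      have eq: "\<bar>(c * ?\<psi> x - c * ?\<psi> y) / norm (x - y) powr s / 1\<bar> = c * \<bar>?\<psi> x - ?\<psi> y\<bar> / norm (x - y) powr s"
        using c by (simp add: right_diff_distrib[symmetric] abs_mult abs_divide)
      have "\<Phi> \<bar>(c * ?\<psi> x - c * ?\<psi> y) / norm (x - y) powr s / 1\<bar> \<le> \<Phi> \<bar>c * min 1 (norm (x - y) / (1 / k)) / norm (x - y) powr s\<bar>"
        using order_trans[OF le abs_ge_self] unfolding eq[symmetric] by (rule orlicz_function_mono[OF \<Phi> abs_ge_zero])
      then have "ennreal (1 / norm (x - y) ^ ?n) * ennreal (\<Phi> \<bar>(c * ?\<psi> x - c * ?\<psi> y) / norm (x - y) powr s / 1\<bar>) \<le> H x y"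
        unfolding H_def by (intro mult_left_mono ennreal_leI) auto
      also have "H x y \<le> indicator \<Omega> x * H x y + indicator \<Omega> y * H x y"
        using True by (auto simp: indicator_def)
      finally show ?thesis .
    qed
  qed
  also have "\<dots> = (\<integral>\<^sup>+x. indicator \<Omega> x * (\<integral>\<^sup>+y. H x y \<partial>lborel) + (\<integral>\<^sup>+y. indicator \<Omega> y * H x y \<partial>lborel) \<partial>lborel)"
    by (intro nn_integral_cong) (simp add: nn_integral_add nn_integral_cmult)
  also have "\<dots> = (\<integral>\<^sup>+x. indicator \<Omega> x * (\<integral>\<^sup>+y. H x y \<partial>lborel) \<partial>lborel) + (\<integral>\<^sup>+x. \<integral>\<^sup>+y. indicator \<Omega> y * H x y \<partial>lborel \<partial>lborel)"
    by (rule nn_integral_add) measurable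
  also have "(\<integral>\<^sup>+x. \<integral>\<^sup>+y. indicator \<Omega> y * H x y \<partial>lborel \<partial>lborel) = (\<integral>\<^sup>+y. \<integral>\<^sup>+x. indicator \<Omega> y * H x y \<partial>lborel \<partial>lborel)"
    by (rule lborel_pair.Fubini'[symmetric]) measurable
  also have "\<dots> = (\<integral>\<^sup>+y. indicator \<Omega> y * (\<integral>\<^sup>+x. H x y \<partial>lborel) \<partial>lborel)"
    by (simp add: nn_integral_cmult)
  also have "(\<integral>\<^sup>+x. indicator \<Omega> x * (\<integral>\<^sup>+y. H x y \<partial>lborel) \<partial>lborel) = (\<integral>\<^sup>+y. indicator \<Omega> y * (\<integral>\<^sup>+x. H x y \<partial>lborel) \<partial>lborel)"
    by (subst H_sym) simp
  also have "\<dots> + \<dots> < \<infinity>" using I by simp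
  finally show ?thesis .
qed

section \<open>The weak* topology on the fractional Orlicz--Sobolev space\<close>

lemma frac_space_iff:
  fixes \<Omega> :: "'a::euclidean_space set"
  assumes \<Phi>: "orlicz_function \<Phi>"
  shows "u \<in> frac_space s \<Phi> \<Omega> \<longleftrightarrow> u \<in> borel_measurable lebesgue \<and>
    (\<exists>L>0. orlicz_modular \<Phi> (lebesgue_on \<Omega>) (\<lambda>x. u x / L) < \<infinity>) \<and>
    (\<exists>L>0. orlicz_modular \<Phi> frac_measure (\<lambda>z. frac_quot s u z / L) < \<infinity>)"
  unfolding frac_space_def orlicz_space_iff[OF \<Phi>]
  using measurable_restrict_space1[of u lebesgue borel \<Omega>] frac_quot_measurable[of u s] by blast

lemma topspace_frac_weak_star: "topspace (frac_weak_star s G \<Omega>) = frac_space s G \<Omega>"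
  by (auto simp: frac_weak_star_def orlicz_weak_star_def Let_def topspace_pullback_topology frac_space_def)

lemma frac_space_0_subset: "frac_space_0 s G \<Omega> \<subseteq> frac_space s G \<Omega>"
  unfolding frac_space_0_def topspace_frac_weak_star[symmetric] by (rule closure_of_subset_topspace)

lemma limitin_pullback_topology:
  assumes lim: "limitin T (\<lambda>k. f (x k)) (f l) F" and "l \<in> A" "\<And>k. x k \<in> A"
  shows "limitin (pullback_topology A f T) x l F"
  unfolding limitin_def
proof (intro conjI allI impI)
  show "l \<in> topspace (pullback_topology A f T)"
    using assms by (auto simp: topspace_pullback_topology limitin_def)
  fix U assume "openin (pullback_topology A f T) U \<and> l \<in> U"
  then obtain V where V: "openin T V" "U = f -` V \<inter> A" "l \<in> U"
    by (auto simp: openin_pullback_topology)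
  then have "\<forall>\<^sub>F k in F. f (x k) \<in> V" using lim by (auto simp: limitin_def)
  then show "\<forall>\<^sub>F k in F. x k \<in> U" by eventually_elim (use V assms(3) in auto)
qed

text \<open>Convergence in a product is coordinatewise, so the two nested pullbacks reduce weak*
  convergence to the individual pairings.\<close>

lemma limitin_frac_weak_star:
  fixes \<Omega> :: "'a::euclidean_space set"
  assumes "\<And>k. v k \<in> frac_space s G \<Omega>" "u \<in> frac_space s G \<Omega>"
    and lim: "\<And>w z. w \<in> orlicz_heart (complementary G) (lebesgue_on \<Omega>) \<Longrightarrow> z \<in> orlicz_heart (complementary G) frac_measure \<Longrightarrow>
      ((\<lambda>k. orlicz_pairing (lebesgue_on \<Omega>) frac_measure (v k, frac_quot s (v k)) (w, z)) \<longlongrightarrow>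
        orlicz_pairing (lebesgue_on \<Omega>) frac_measure (u, frac_quot s u) (w, z)) F"
  shows "limitin (frac_weak_star s G \<Omega>) v u F"
proof -
  let ?E = "orlicz_heart (complementary G) (lebesgue_on \<Omega>) \<times> orlicz_heart (complementary G) (frac_measure :: ('a \<times> 'a) measure)"
  let ?P = "\<lambda>w. restrict (orlicz_pairing (lebesgue_on \<Omega>) frac_measure w) ?E"
  have "limitin (product_topology (\<lambda>_. euclideanreal) ?E) (\<lambda>k. ?P (v k, frac_quot s (v k))) (?P (u, frac_quot s u)) F"
    unfolding limitin_componentwise using lim by (auto simp: limitin_canonical_iff)
  then have "limitin (orlicz_weak_star G (lebesgue_on \<Omega>) frac_measure) (\<lambda>k. (v k, frac_quot s (v k))) (u, frac_quot s u) F"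
    unfolding orlicz_weak_star_def Let_def
    by (rule limitin_pullback_topology) (use assms(1,2) in \<open>auto simp: frac_space_def\<close>)
  then show ?thesis
    unfolding frac_weak_star_def
    by (rule limitin_pullback_topology[where f="\<lambda>u. (u, frac_quot s u)" and x=v and l=u]) (use assms in auto)
qed

text \<open>Each pairing is a coordinate of the product. Through its closed zero set an identity
  valid for test functions passes to their closure.\<close>

lemma continuous_map_frac_pairing:
  fixes \<Omega> :: "'a::euclidean_space set"
  assumes "w \<in> orlicz_heart (complementary G) (lebesgue_on \<Omega>)" "z \<in> orlicz_heart (complementary G) frac_measure"
  shows "continuous_map (frac_weak_star s G \<Omega>) euclideanreal
    (\<lambda>u. orlicz_pairing (lebesgue_on \<Omega>) frac_measure (u, frac_quot s u) (w, z))"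
proof -
  let ?E = "orlicz_heart (complementary G) (lebesgue_on \<Omega>) \<times> orlicz_heart (complementary G) (frac_measure :: ('a \<times> 'a) measure)"
  let ?P = "\<lambda>w. restrict (orlicz_pairing (lebesgue_on \<Omega>) frac_measure w) ?E"
  have e: "(w, z) \<in> ?E" using assms by simp
  have "continuous_map (product_topology (\<lambda>_. euclideanreal) ?E) euclideanreal (\<lambda>h. h (w, z))"
    by (rule continuous_map_product_projection[OF e])
  then have "continuous_map (frac_weak_star s G \<Omega>) euclideanreal (((\<lambda>h. h (w, z)) \<circ> ?P) \<circ> (\<lambda>u. (u, frac_quot s u)))"
    unfolding frac_weak_star_def orlicz_weak_star_def Let_def by (intro continuous_map_pullback)
  then show ?thesis using e by (simp add: comp_def)
qed

lemma AE_lebesgue_on: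
  assumes "AE x in lebesgue. P x" "\<Omega> \<in> sets lebesgue"
  shows "AE x in lebesgue_on \<Omega>. P x"
  using assms by (subst AE_restrict_space_iff) (auto elim: eventually_mono)

text \<open>The sequence is taken from the closure rather than from \<open>S\<close>. The lemma can
  thus be applied twice, to mollifications and then to cutoffs, without a diagonal argument, which
  would need metrizability.\<close>

lemma closure_of_frac_weak_star_AE_limit:
  fixes \<Omega> :: "'a::euclidean_space set"
  assumes G: "young_function G" and \<Omega>: "\<Omega> \<in> sets lebesgue"
    and v: "\<And>k. v k \<in> frac_weak_star s G \<Omega> closure_of S" and u: "u \<in> borel_measurable lebesgue"
    and lim: "AE x in lebesgue. (\<lambda>k. v k x) \<longlonglongrightarrow> u x" and L: "L > 0"
    and J: "\<And>k. orlicz_modular G (lebesgue_on \<Omega>) (\<lambda>x. v k x / L) \<le> ennreal C"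
    and F: "\<And>k. orlicz_modular G frac_measure (\<lambda>z. frac_quot s (v k) z / L) \<le> ennreal C"
  shows "u \<in> frac_weak_star s G \<Omega> closure_of S"
proof -
  note O = young_function_orlicz[OF G]
  have v_space: "v k \<in> frac_space s G \<Omega>" for k
    using v[of k] closure_of_subset_topspace[of "frac_weak_star s G \<Omega>" S] topspace_frac_weak_star by blast
  then have vm: "v k \<in> borel_measurable lebesgue" for k by (simp add: frac_space_def)
  have vm\<Omega>: "v k \<in> borel_measurable (lebesgue_on \<Omega>)" for k
    using vm by (rule measurable_restrict_space1)
  have vmD: "frac_quot s (v k) \<in> borel_measurable frac_measure" for k
    using vm by (rule frac_quot_measurable)
  have um\<Omega>: "u \<in> borel_measurable (lebesgue_on \<Omega>)" using u by (rule measurable_restrict_space1)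
  have umD: "frac_quot s u \<in> borel_measurable frac_measure" using u by (rule frac_quot_measurable)
  have lim\<Omega>: "AE x in lebesgue_on \<Omega>. (\<lambda>k. v k x) \<longlonglongrightarrow> u x"
    using lim \<Omega> by (rule AE_lebesgue_on)
  have limD: "AE z in frac_measure. (\<lambda>k. frac_quot s (v k) z) \<longlonglongrightarrow> frac_quot s u z"
    using lim by (rule frac_quot_tendsto)
  have div: "AE x in M. (\<lambda>k. f k x / L) \<longlonglongrightarrow> g x / L"
    if "AE x in M. (\<lambda>k. f k x) \<longlonglongrightarrow> g x" for M :: "'b measure" and f :: "nat \<Rightarrow> 'b \<Rightarrow> real" and g
    using that by eventually_elim (use L in \<open>auto intro: tendsto_divide\<close>)
  have uJ: "orlicz_modular G (lebesgue_on \<Omega>) (\<lambda>x. u x / L) \<le> ennreal C"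
    by (rule orlicz_modular_limit_le[OF G _ div[OF lim\<Omega>] J]) (use vm\<Omega> in measurable)
  have uF: "orlicz_modular G frac_measure (\<lambda>z. frac_quot s u z / L) \<le> ennreal C"
    by (rule orlicz_modular_limit_le[OF G _ div[OF limD] F]) (use vmD in measurable)
  have u_space: "u \<in> frac_space s G \<Omega>"
    unfolding frac_space_iff[OF O] using u L le_less_trans[OF uJ ennreal_less_top] le_less_trans[OF uF ennreal_less_top]
    by (auto simp: infinity_ennreal_def)
  have "limitin (frac_weak_star s G \<Omega>) v u sequentially"
    unfolding orlicz_pairing_def
    by (rule limitin_frac_weak_star[OF v_space u_space])
       (auto simp: orlicz_pairing_def intro!: tendsto_add orlicz_heart_weak_convergence[OF G vm\<Omega> um\<Omega> lim\<Omega> L J] orlicz_heart_weak_convergence[OF G vmD umD limD L F])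
  then show ?thesis
    by (rule limitin_closedin[OF _ closedin_closure_of]) (use v in auto)
qed

section \<open>Functions vanishing outside the domain are weak* limits of test functions\<close>

lemma nn_integral_lebesgue_on_lborel:
  assumes "\<Omega> \<in> sets borel"
  shows "(\<integral>\<^sup>+x. f x \<partial>lebesgue_on \<Omega>) = (\<integral>\<^sup>+x. f x * indicator \<Omega> x \<partial>lborel)"
  using assms by (subst nn_integral_restrict_space) (auto simp: nn_integral_completion)

lemma orlicz_modular_lebesgue_on:
  assumes "\<Omega> \<in> sets borel" "\<Phi> 0 = 0" "\<And>x. x \<notin> \<Omega> \<Longrightarrow> u x = 0"
  shows "orlicz_modular \<Phi> (lebesgue_on \<Omega>) u = orlicz_modular \<Phi> lborel u"
  unfolding orlicz_modular_def nn_integral_lebesgue_on_lborel[OF assms(1)]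
  using assms by (intro nn_integral_cong) (auto simp: indicator_def)

lemma modular_bounded_support_integrable:
  assumes G: "young_function G" and [measurable]: "v \<in> borel_measurable M" "K \<in> sets M"
    and K: "emeasure M K < \<infinity>" and v0: "\<And>x. x \<notin> K \<Longrightarrow> v x = 0"
    and L: "L > 0" and fin: "orlicz_modular G M (\<lambda>x. v x / L) < \<infinity>"
  shows "integrable M v"
proof (rule integrableI_bounded)
  note O = young_function_orlicz[OF G]
  note [measurable] = borel_measurable_orlicz_function[OF O]
  obtain B where B: "B \<ge> 0" "\<And>t. t \<ge> 0 \<Longrightarrow> L * t \<le> G t + B"
    using young_function_affine_bound[OF G, of L] L by auto
  have "(\<integral>\<^sup>+x. ennreal (norm (v x)) \<partial>M) \<le> (\<integral>\<^sup>+x. ennreal (G \<bar>v x / L\<bar>) + ennreal B * indicator K x \<partial>M)"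
  proof (rule nn_integral_mono)
    fix x
    show "ennreal (norm (v x)) \<le> ennreal (G \<bar>v x / L\<bar>) + ennreal B * indicator K x"
    proof (cases "x \<in> K")
      case True
      have "norm (v x) = L * \<bar>v x / L\<bar>" using L by (simp add: abs_divide)
      also have "\<dots> \<le> G \<bar>v x / L\<bar> + B" by (rule B) simp
      finally have "ennreal (norm (v x)) \<le> ennreal (G \<bar>v x / L\<bar> + B)" by (rule ennreal_leI)
      then show ?thesis using True B(1) orlicz_function_nonneg[OF O] by (simp add: ennreal_plus)
    qed (simp add: v0)
  qed
  also have "\<dots> = orlicz_modular G M (\<lambda>x. v x / L) + (\<integral>\<^sup>+x. ennreal B * indicator K x \<partial>M)"
    unfolding orlicz_modular_def by (rule nn_integral_add) measurable
  also have "(\<integral>\<^sup>+x. ennreal B * indicator K x \<partial>M) = ennreal B * emeasure M K"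
    by (simp add: nn_integral_cmult_indicator)
  finally have "(\<integral>\<^sup>+x. ennreal (norm (v x)) \<partial>M) \<le> orlicz_modular G M (\<lambda>x. v x / L) + ennreal B * emeasure M K" .
  also have "\<dots> < \<infinity>" using fin K by (simp add: ennreal_mult_less_top)
  finally show "(\<integral>\<^sup>+x. ennreal (norm (v x)) \<partial>M) < \<infinity>" .
qed measurable

text \<open>Mollification converges in the mean at the rate \<open>e j powr s\<close>, hence almost
  everywhere along a subsequence, and keeps both modulars below those of \<open>v\<close>.\<close>

lemma compact_support_in_frac_space_0:
  fixes \<Omega> K :: "'a::euclidean_space set"
  assumes G: "young_function G" and \<Omega>: "open \<Omega>" and s: "0 < s"
    and v [measurable]: "v \<in> borel_measurable borel" and K: "compact K" "K \<subseteq> \<Omega>" and v0: "\<And>x. x \<notin> K \<Longrightarrow> v x = 0"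
    and L: "L > 0" and J: "orlicz_modular G (lebesgue_on \<Omega>) (\<lambda>x. v x / L) \<le> ennreal C"
    and F: "orlicz_modular G frac_measure (\<lambda>z. frac_quot s v z / L) \<le> ennreal C"
  shows "v \<in> frac_space_0 s G \<Omega>"
proof -
  note O = young_function_orlicz[OF G]
  let ?n = "DIM('a)"
  have \<Omega>b: "\<Omega> \<in> sets borel" using \<Omega> by simp
  have Jl: "orlicz_modular G lborel (\<lambda>x. v x / L) \<le> ennreal C"
    using J orlicz_modular_lebesgue_on[OF \<Omega>b, of G "\<lambda>x. v x / L"] v0 K(2) orlicz_function_zero[OF O] by fastforce
  have int: "integrable lborel v"
  proof (rule modular_bounded_support_integrable[OF G _ _ _ v0 L])
    show "K \<in> sets lborel" using K(1) by (simp add: compact_imp_closed)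
    show "emeasure lborel K < \<infinity>" using emeasure_compact_finite[OF K(1)] by simp
    show "orlicz_modular G lborel (\<lambda>x. v x / L) < \<infinity>" using le_less_trans[OF Jl ennreal_less_top] by simp
  qed auto
  obtain R where R: "R > 0" "\<And>x. x \<in> K \<Longrightarrow> norm x \<le> R"
    using compact_imp_bounded[OF K(1)] unfolding bounded_pos by blast
  then have vR: "v x = 0" if "norm x > R" for x using v0[of x] that by force
  obtain B where B: "B \<ge> 0" "\<And>(u :: 'a \<Rightarrow> real) L r. u \<in> borel_measurable borel \<Longrightarrow> (\<And>x. norm x > R \<Longrightarrow> u x = 0) \<Longrightarrow>
      L > 0 \<Longrightarrow> 0 < r \<Longrightarrow> r \<le> 1 \<Longrightarrow>
      (\<integral>\<^sup>+x. \<integral>\<^sup>+y. ennreal \<bar>u x - u y\<bar> * indicator (cball 0 r) (x - y) \<partial>lborel \<partial>lborel)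
        \<le> ennreal (L * r powr s * r ^ DIM('a)) *
          (orlicz_modular G frac_measure (\<lambda>z. frac_quot s u z / L) + ennreal B)"
    by (rule frac_L1_estimate[OF G s less_imp_le[OF R(1)], where 'a='a]) blast
  obtain M where M: "M > 0" "\<And>e. e > 0 \<Longrightarrow> \<exists>\<rho>::'a \<Rightarrow> real. (\<forall>k. C_k k \<rho>) \<and> (\<forall>x. 0 \<le> \<rho> x \<and> \<rho> x \<le> M / e ^ ?n) \<and>
      (\<forall>x. norm x \<ge> e \<longrightarrow> \<rho> x = 0) \<and> (\<integral>\<^sup>+x. ennreal (\<rho> x) \<partial>lborel) = 1"
    by (rule ex_mollifier[where 'a='a]) blast
  obtain \<delta> where \<delta>: "\<delta> > 0" "(\<Union>x\<in>K. cball x \<delta>) \<subseteq> \<Omega>"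
    using compact_subset_open_imp_cball_epsilon_subset[OF K(1) \<Omega> K(2)] by blast
  \<comment> \<open>Radii at most 1 are required by \<open>frac_L1_estimate\<close>; radii at most
    \<open>\<delta>\<close> keep the mollified supports in the domain.\<close>
  define e where "e j = min 1 \<delta> / real (Suc j)" for j
  have e: "e j > 0" "e j \<le> 1" "e j \<le> \<delta>" for j
  proof -
    have "min 1 \<delta> / real (Suc j) \<le> min 1 \<delta> / 1" using \<delta>(1) by (intro divide_left_mono) auto
    then show "e j \<le> 1" "e j \<le> \<delta>" by (auto simp: e_def)
  qed (use \<delta> in \<open>simp add: e_def\<close>)
  have e0: "e \<longlonglongrightarrow> 0"
    unfolding e_def by (rule LIMSEQ_Suc[OF lim_const_over_n])
  obtain \<rho> where \<rho>: "\<And>j k. C_k k (\<rho> j :: 'a \<Rightarrow> real)" "\<And>j x. 0 \<le> \<rho> j x" "\<And>j x. \<rho> j x \<le> M / e j ^ ?n"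
    "\<And>j x. norm x \<ge> e j \<Longrightarrow> \<rho> j x = 0" "\<And>j. (\<integral>\<^sup>+x. ennreal (\<rho> j x) \<partial>lborel) = 1"
    using M(2)[OF e(1)] by metis
  have \<rho>m: "\<rho> j \<in> borel_measurable borel" for j
    by (rule borel_measurable_continuous_onI[OF C_k_continuous[OF \<rho>(1)[where k=0]]])
  have \<rho>0: "\<rho> j x = 0" if "norm x > e j" for j x using \<rho>(4)[of j x] that by simp
  define \<phi> where "\<phi> j x = (\<integral>y. v y * \<rho> j (x - y) \<partial>lborel)" for j x
  note conv = convolution_integrable[OF G int \<rho>m \<rho>(2,3,5)] convolution_modular_le[OF G int \<rho>m \<rho>(2,3,5)]
    convolution_frac_modular_le[OF G int \<rho>m \<rho>(2,3,5)] convolution_L1_distance[OF G int \<rho>m \<rho>(2,3,5) \<rho>0]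
  have test: "\<phi> j \<in> test_functions \<Omega>" for j
    unfolding \<phi>_def
  proof (rule convolution_test_function[OF int K(1) v0 \<rho>(1) \<rho>0])
    fix x y :: 'a assume "x \<in> K" "norm y \<le> e j"
    then have "x + y \<in> cball x \<delta>" using e(3)[of j] by (simp add: dist_norm)
    then show "x + y \<in> \<Omega>" using \<delta>(2) \<open>x \<in> K\<close> by blast
  qed
  have \<phi>m [measurable]: "\<phi> j \<in> borel_measurable borel" for j
    using test[of j] by (intro borel_measurable_continuous_onI C_k_continuous[of 0]) (auto simp: test_functions_def)
  have \<phi>0: "\<phi> j x = 0" if "x \<notin> \<Omega>" for j x
    using test[of j] that closure_subset[of "{x. \<phi> j x \<noteq> 0}"] by (auto simp: test_functions_def)
  have \<phi>J: "orlicz_modular G (lebesgue_on \<Omega>) (\<lambda>x. \<phi> j x / L) \<le> ennreal C" for j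
  proof -
    have "orlicz_modular G (lebesgue_on \<Omega>) (\<lambda>x. \<phi> j x / L) = orlicz_modular G lborel (\<lambda>x. \<phi> j x / L)"
      using orlicz_function_zero[OF O] \<phi>0 by (intro orlicz_modular_lebesgue_on[OF \<Omega>b]) auto
    also have "\<dots> \<le> orlicz_modular G lborel (\<lambda>x. v x / L)"
      unfolding \<phi>_def by (rule conv(2))
    finally show ?thesis using Jl by simp
  qed
  have \<phi>F: "orlicz_modular G frac_measure (\<lambda>z. frac_quot s (\<phi> j) z / L) \<le> ennreal C" for j
    using order_trans[OF conv(3) F] by (simp add: \<phi>_def[abs_def])
  have \<phi>_cl: "\<phi> j \<in> frac_weak_star s G \<Omega> closure_of test_functions \<Omega>" for j
  proof -
    have "\<phi> j \<in> frac_space s G \<Omega>"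
      unfolding frac_space_iff[OF O]
      using L le_less_trans[OF \<phi>J ennreal_less_top] le_less_trans[OF \<phi>F ennreal_less_top]
      by (auto simp: infinity_ennreal_def intro!: measurable_completion)
    then show ?thesis
      using closure_of_subset_Int[of "frac_weak_star s G \<Omega>" "test_functions \<Omega>"] test topspace_frac_weak_star by blast
  qed
  have L1: "(\<integral>\<^sup>+x. ennreal \<bar>\<phi> j x - v x\<bar> \<partial>lborel) \<le> ennreal (M * L * (\<bar>C\<bar> + B) * e j powr s)" for j
  proof -
    have "(\<integral>\<^sup>+x. ennreal \<bar>\<phi> j x - v x\<bar> \<partial>lborel) \<le> ennreal (M / e j ^ ?n) *
        (\<integral>\<^sup>+x. \<integral>\<^sup>+y. ennreal \<bar>v x - v y\<bar> * indicator (cball 0 (e j)) (x - y) \<partial>lborel \<partial>lborel)"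
      unfolding \<phi>_def by (rule conv(4))
    also have "\<dots> \<le> ennreal (M / e j ^ ?n) * (ennreal (L * e j powr s * e j ^ ?n) *
        (orlicz_modular G frac_measure (\<lambda>z. frac_quot s v z / L) + ennreal B))"
      by (intro mult_left_mono B(2)[OF v vR L e(1,2)]) auto
    also have "\<dots> \<le> ennreal (M / e j ^ ?n) * (ennreal (L * e j powr s * e j ^ ?n) * (ennreal \<bar>C\<bar> + ennreal B))"
      by (intro mult_left_mono add_right_mono order_trans[OF F] ennreal_leI) auto
    also have "\<dots> = ennreal ((M / e j ^ ?n) * ((L * e j powr s * e j ^ ?n) * (\<bar>C\<bar> + B)))"
      using M(1) L e(1)[of j] B(1) by (simp add: ennreal_plus[symmetric] ennreal_mult[symmetric] del: ennreal_plus)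
    \<comment> \<open>The height of the mollifier cancels the volume factor, and only
      \<open>e j powr s\<close> survives.\<close>
    also have "(M / e j ^ ?n) * ((L * e j powr s * e j ^ ?n) * (\<bar>C\<bar> + B)) = M * L * (\<bar>C\<bar> + B) * e j powr s"
      using e(1)[of j] by simp
    finally show ?thesis .
  qed
  have int\<phi>: "integrable lborel (\<lambda>x. \<phi> j x - v x)" for j
    using le_less_trans[OF L1[of j] ennreal_less_top] by (intro integrableI_bounded) auto
  have lim0: "(\<lambda>j. \<integral>x. norm (\<phi> j x - v x) \<partial>lborel) \<longlonglongrightarrow> 0"
  proof (rule tendsto_sandwich[OF always_eventually always_eventually tendsto_const])
    show "\<forall>j. 0 \<le> (\<integral>x. norm (\<phi> j x - v x) \<partial>lborel)" by simp
    show "\<forall>j. (\<integral>x. norm (\<phi> j x - v x) \<partial>lborel) \<le> M * L * (\<bar>C\<bar> + B) * e j powr s"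
    proof
      fix j
      have "ennreal (\<integral>x. norm (\<phi> j x - v x) \<partial>lborel) = (\<integral>\<^sup>+x. ennreal (norm (\<phi> j x - v x)) \<partial>lborel)"
        by (rule nn_integral_eq_integral[symmetric]) (use integrable_norm[OF int\<phi>] in auto)
      also have "\<dots> \<le> ennreal (M * L * (\<bar>C\<bar> + B) * e j powr s)" using L1[of j] by simp
      finally show "(\<integral>x. norm (\<phi> j x - v x) \<partial>lborel) \<le> M * L * (\<bar>C\<bar> + B) * e j powr s"
        using M(1) L B(1) by (subst (asm) ennreal_le_iff) auto
    qed
    have "(\<lambda>j. e j powr s) \<longlonglongrightarrow> 0 powr s"
      by (intro tendsto_powr' e0 tendsto_const) (use s e(1) in \<open>auto intro!: always_eventually less_imp_le\<close>)
    then show "(\<lambda>j. M * L * (\<bar>C\<bar> + B) * e j powr s) \<longlonglongrightarrow> 0"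
      using tendsto_mult_right_zero[of "\<lambda>j. e j powr s" sequentially "M * L * (\<bar>C\<bar> + B)"] s by simp
  qed
  obtain r where r: "AE x in lborel. (\<lambda>j. \<phi> (r j) x - v x) \<longlonglongrightarrow> 0"
    using tendsto_L1_AE_subseq[of lborel "\<lambda>j x. \<phi> j x - v x", OF int\<phi> lim0] by blast
  then have lim: "AE x in lebesgue. (\<lambda>j. \<phi> (r j) x) \<longlonglongrightarrow> v x"
    by (intro AE_completion) (auto elim!: eventually_mono intro: LIM_zero_cancel)
  have "\<Omega> \<in> sets lebesgue" "v \<in> borel_measurable lebesgue"
    using \<Omega>b by (auto intro!: measurable_completion)
  then show ?thesis
    unfolding frac_space_0_def
    using closure_of_frac_weak_star_AE_limit[where v="\<lambda>j. \<phi> (r j)" and u=v, OF G _ \<phi>_cl _ lim L \<phi>J \<phi>F]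
    by blast
qed

lemma orlicz_modular_div_antimono:
  assumes \<Phi>: "orlicz_function \<Phi>" and "0 < L" "L \<le> L'"
  shows "orlicz_modular \<Phi> M (\<lambda>x. u x / L') \<le> orlicz_modular \<Phi> M (\<lambda>x. u x / L)"
proof (rule orlicz_modular_mono[OF \<Phi>], rule AE_I2)
  fix x
  have "\<bar>u x\<bar> / L' \<le> \<bar>u x\<bar> / L" using assms by (intro divide_left_mono mult_pos_pos) auto
  then show "\<bar>u x / L'\<bar> \<le> \<bar>u x / L\<bar>" using assms by (simp add: abs_divide)
qed

lemma vanishing_in_frac_space_0:
  fixes \<Omega> :: "'a::euclidean_space set"
  assumes G: "young_function G" and \<Omega>: "open \<Omega>" "bounded \<Omega>" "lipschitz_boundary \<Omega>" and s: "0 < s" "s < 1"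
    and u: "u \<in> frac_space s G \<Omega>" and u0: "AE x in lebesgue. x \<notin> \<Omega> \<longrightarrow> u x = 0"
  shows "u \<in> frac_space_0 s G \<Omega>"
proof -
  note O = young_function_orlicz[OF G]
  have \<Omega>b [measurable]: "\<Omega> \<in> sets borel" and \<Omega>l: "\<Omega> \<in> sets lebesgue" using \<Omega> by auto
  have um: "u \<in> borel_measurable lebesgue" using u by (simp add: frac_space_def)
  obtain v' where v': "v' \<in> borel_measurable borel" "AE x in lebesgue. u x = v' x"
    using borel_representative[OF um] by blast
  \<comment> \<open>Hardy's inequality and the cutoff estimate ask for a Borel function vanishing at
    every point outside the domain, not merely at almost every one.\<close>
  define v where "v x = v' x * indicator \<Omega> x" for x
  have v [measurable]: "v \<in> borel_measurable borel" unfolding v_def using v'(1) by measurable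
  have v0: "v x = 0" if "x \<notin> \<Omega>" for x using that by (simp add: v_def)
  have uv: "AE x in lebesgue. u x = v x"
    using v'(2) u0 by eventually_elim (auto simp: v_def indicator_def)
  obtain L1 where L1: "L1 > 0" "orlicz_modular G (lebesgue_on \<Omega>) (\<lambda>x. u x / L1) \<le> 1"
    using u orlicz_space_modular_le_1[OF O] unfolding frac_space_def by blast
  obtain L2 where L2: "L2 > 0" "orlicz_modular G frac_measure (\<lambda>z. frac_quot s u z / L2) \<le> 1"
    using u orlicz_space_modular_le_1[OF O] unfolding frac_space_def by blast
  \<comment> \<open>One scale has to serve both modulars, since the limit lemma uses a common
    one.\<close>
  define L where "L = max L1 L2"
  have L: "L > 0" "L1 \<le> L" "L2 \<le> L" using L1 by (auto simp: L_def)
  have uJ: "orlicz_modular G (lebesgue_on \<Omega>) (\<lambda>x. u x / L) \<le> 1"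
    using orlicz_modular_div_antimono[OF O L1(1) L(2), of "lebesgue_on \<Omega>" u] L1(2) by simp
  have uF: "orlicz_modular G frac_measure (\<lambda>z. frac_quot s u z / L) \<le> 1"
    using orlicz_modular_div_antimono[OF O L2(1) L(3), of frac_measure "frac_quot s u"] L2(2) by simp
  have vJ: "orlicz_modular G (lebesgue_on \<Omega>) (\<lambda>x. v x / L) \<le> 1"
  proof -
    have "orlicz_modular G (lebesgue_on \<Omega>) (\<lambda>x. v x / L) = orlicz_modular G (lebesgue_on \<Omega>) (\<lambda>x. u x / L)"
      by (rule orlicz_modular_cong, use AE_lebesgue_on[OF uv \<Omega>l] in eventually_elim) simp
    then show ?thesis using uJ by simp
  qed
  have vF: "orlicz_modular G frac_measure (\<lambda>z. frac_quot s v z / L) \<le> 1"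
    using uF frac_modular_cong_AE[OF uv, of G s L] by simp
  obtain C where C: "\<And>k. k > 0 \<Longrightarrow> orlicz_modular G frac_measure (\<lambda>z. frac_quot s (\<lambda>x. v x * cutoff \<Omega> k x) z / (24 * L)) \<le> ennreal C"
    using cutoff_modular_bound[OF \<Omega> s O v v0 L(1) vF] by blast
  define C' where "C' = max 1 C"
  have C': "ennreal C \<le> ennreal C'" "1 \<le> ennreal C'" by (auto simp: C'_def intro: ennreal_leI)
  define w where "w k x = v x * cutoff \<Omega> (real (Suc k)) x" for k x
  have wm: "w k \<in> borel_measurable borel" for k unfolding w_def by measurable
  have wF: "orlicz_modular G frac_measure (\<lambda>z. frac_quot s (w k) z / (24 * L)) \<le> ennreal C'" for k
    using order_trans[OF C[of "real (Suc k)"] C'(1)] by (simp add: w_def[abs_def])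
  have wJ: "orlicz_modular G (lebesgue_on \<Omega>) (\<lambda>x. w k x / (24 * L)) \<le> ennreal C'" for k
  proof -
    have "orlicz_modular G (lebesgue_on \<Omega>) (\<lambda>x. w k x / (24 * L)) \<le> orlicz_modular G (lebesgue_on \<Omega>) (\<lambda>x. v x / L)"
    proof (rule orlicz_modular_mono[OF O], rule AE_I2)
      fix x
      have "\<bar>w k x\<bar> \<le> \<bar>v x\<bar>" using cutoff_range[of \<Omega> "real (Suc k)" x] by (simp add: w_def abs_mult mult_left_le)
      then have "\<bar>w k x\<bar> / (24 * L) \<le> \<bar>v x\<bar> / L" using L by (intro frac_le) auto
      then show "\<bar>w k x / (24 * L)\<bar> \<le> \<bar>v x / L\<bar>" using L by (simp add: abs_divide)
    qed
    then show ?thesis by (rule order_trans[OF _ order_trans[OF vJ C'(2)]])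
  qed
  have w_cl: "w k \<in> frac_space_0 s G \<Omega>" for k
  proof (rule compact_support_in_frac_space_0[OF G \<Omega>(1) s(1) wm _ _ _ _ wJ wF])
    show "compact {x. 1 / real (Suc k) \<le> bdist \<Omega> x}" "{x. 1 / real (Suc k) \<le> bdist \<Omega> x} \<subseteq> \<Omega>"
      by (rule cutoff_support_compact[OF \<Omega>(1,2)], simp)+
    show "w k x = 0" if "x \<notin> {x. 1 / real (Suc k) \<le> bdist \<Omega> x}" for x
      using that cutoff_eq_0[of "real (Suc k)" x \<Omega>] by (simp add: w_def not_le del: of_nat_Suc)
  qed (use L in simp)
  have "(\<lambda>k. w k x) \<longlonglongrightarrow> v x" for x
  proof (cases "x \<in> \<Omega>")
    case True
    show ?thesis unfolding w_def using tendsto_mult[OF tendsto_const cutoff_tendsto_1[OF \<Omega>(1,2) True], of "v x"] by simp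
  qed (simp add: w_def v0)
  then have "AE x in lebesgue. (\<lambda>k. w k x) \<longlonglongrightarrow> u x"
    using uv by (auto elim: eventually_mono)
  then show ?thesis
    using w_cl unfolding frac_space_0_def
    by (intro closure_of_frac_weak_star_AE_limit[OF G \<Omega>l _ um _ _ wJ wF]) (use L in auto)
qed

section \<open>Elements of the closure vanish outside the domain\<close>

lemma orlicz_pairing_integrable:
  assumes G: "young_function G" and u: "u \<in> orlicz_space G M" and w: "w \<in> orlicz_space (complementary G) M"
  shows "integrable M (\<lambda>x. u x * w x)"
proof (rule integrableI_bounded)
  note O = young_function_orlicz[OF G] complementary_orlicz[OF G]
  have [measurable]: "u \<in> borel_measurable M" "w \<in> borel_measurable M"
    using orlicz_space_measurable[OF O(1) u] orlicz_space_measurable[OF O(2) w] .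
  show "(\<lambda>x. u x * w x) \<in> borel_measurable M" by measurable
  obtain L where L: "L > 0" "orlicz_modular G M (\<lambda>x. u x / L) \<le> 1"
    using orlicz_space_modular_le_1[OF O(1) u] by blast
  obtain l where l: "l > 0" "orlicz_modular (complementary G) M (\<lambda>x. w x / l) \<le> 1"
    using orlicz_space_modular_le_1[OF O(2) w] by blast
  have "(\<integral>\<^sup>+x. ennreal \<bar>u x * w x\<bar> \<partial>M) \<le> ennreal (L * l) * (1 + 1)"
    by (rule order_trans[OF orlicz_Hoelder[OF G _ _ L(1) l(1)] mult_left_mono[OF add_mono[OF L(2) l(2)]]]) simp_all
  also have "\<dots> < \<infinity>" by (simp add: ennreal_mult_less_top)
  finally show "(\<integral>\<^sup>+x. ennreal (norm (u x * w x)) \<partial>M) < \<infinity>" by simp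
qed

lemma emeasure_bounded_borel_finite:
  "bounded A \<Longrightarrow> emeasure lborel A < \<infinity>"
  using emeasure_bounded_finite by (simp add: infinity_ennreal_def)

text \<open>For a ball \<open>A\<close> inside \<open>\<Omega>\<close> and a set \<open>B\<close> outside, the test pair \<open>(w, z)\<close> below has pairing
  \<open>\<bar>B\<bar> \<integral>\<^sub>A u - \<integral>\<^sub>A \<integral>\<^sub>B (u x - u y) = \<bar>A\<bar> \<integral>\<^sub>B u\<close> with \<open>u\<close>. The ball is kept away from the boundary so that
  \<open>z\<close> is supported on a set of finite measure.\<close>

context
  fixes \<Omega> A B :: "'a::euclidean_space set" and s \<delta> :: real and G :: "real \<Rightarrow> real"
  assumes G: "young_function G" and \<Omega>: "\<Omega> \<in> sets borel" "bounded \<Omega>"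
    and A: "A \<in> sets borel" "A \<subseteq> \<Omega>" and B: "B \<in> sets borel" "bounded B"
    and \<delta>: "\<delta> > 0" "\<And>x y. x \<in> A \<Longrightarrow> y \<in> B \<Longrightarrow> \<delta> \<le> norm (x - y)" and s: "0 < s"
    and Apos: "emeasure lborel A > 0"
begin

definition ext_w :: "'a \<Rightarrow> real" where
  "ext_w x = measure lborel B * indicator A x"

text \<open>The two powers cancel the singular density and the denominator of the difference
  quotient, so that pairing with it integrates \<open>- (u x - u y)\<close> over the product of
  \<open>A\<close> and \<open>B\<close>.\<close>

definition ext_z :: "'a \<times> 'a \<Rightarrow> real" where
  "ext_z = (\<lambda>(x, y). - (indicator A x * indicator B y * (norm (x - y) ^ DIM('a) * norm (x - y) powr s)))"

lemma bounded_A: "bounded A"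
  using bounded_subset[OF \<Omega>(2) A(2)] .

lemma ext_w_heart: "ext_w \<in> orlicz_heart \<Phi> (lebesgue_on \<Omega>)" if \<Phi>: "orlicz_function \<Phi>"
proof (rule bounded_finite_support_orlicz_heart[OF \<Phi>])
  have "ext_w \<in> borel_measurable borel" unfolding ext_w_def[abs_def] using A(1) by measurable
  then have m: "ext_w \<in> borel_measurable lebesgue" by (auto intro!: measurable_completion)
  then show m': "ext_w \<in> borel_measurable (lebesgue_on \<Omega>)" by (rule measurable_restrict_space1)
  show "\<bar>ext_w x\<bar> \<le> measure lborel B" for x by (auto simp: ext_w_def indicator_def)
  have "emeasure (lebesgue_on \<Omega>) {x \<in> space (lebesgue_on \<Omega>). ext_w x \<noteq> 0} \<le> emeasure (lebesgue_on \<Omega>) (space (lebesgue_on \<Omega>))"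
    by (intro emeasure_mono) auto
  also have "\<dots> = emeasure lborel \<Omega>" using \<Omega> by (simp add: emeasure_restrict_space)
  also have "\<dots> < \<infinity>" using \<Omega>(2) by (rule emeasure_bounded_borel_finite)
  finally show "emeasure (lebesgue_on \<Omega>) {x \<in> space (lebesgue_on \<Omega>). ext_w x \<noteq> 0} < \<infinity>" .
qed

lemma ext_z_measurable: "ext_z \<in> borel_measurable borel"
proof -
  have ind: "(\<lambda>p. indicator A (fst p) :: real) \<in> borel_measurable (borel \<Otimes>\<^sub>M borel)"
      "(\<lambda>p. indicator B (snd p) :: real) \<in> borel_measurable (borel \<Otimes>\<^sub>M borel)"
    by (rule measurable_compose[OF measurable_fst borel_measurable_indicator[OF A(1)]],
        rule measurable_compose[OF measurable_snd borel_measurable_indicator[OF B(1)]])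
  have "(\<lambda>p::'a \<times> 'a. norm (fst p - snd p) ^ DIM('a)) \<in> borel_measurable (borel \<Otimes>\<^sub>M borel)"
    "(\<lambda>p::'a \<times> 'a. norm (fst p - snd p) powr s) \<in> borel_measurable (borel \<Otimes>\<^sub>M borel)"
    by measurable
  then show ?thesis
    unfolding ext_z_def case_prod_beta borel_prod[symmetric] using ind by (intro borel_measurable_uminus borel_measurable_times)
qed

lemma ext_z_heart: "ext_z \<in> orlicz_heart \<Phi> frac_measure" if \<Phi>: "orlicz_function \<Phi>"
proof -
  have "bounded (A \<union> B)" using bounded_A B(2) by simp
  then obtain R where "\<forall>x\<in>A \<union> B. norm x \<le> R" unfolding bounded_iff by blast
  then have R: "\<And>x. x \<in> A \<Longrightarrow> norm x \<le> R" "\<And>x. x \<in> B \<Longrightarrow> norm x \<le> R" by simp_all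
  show ?thesis
  proof (rule bounded_finite_support_orlicz_heart[OF \<Phi>])
    show "ext_z \<in> borel_measurable frac_measure" by (rule borel_measurable_frac_measureI[OF ext_z_measurable])
    show "\<bar>ext_z p\<bar> \<le> (2 * \<bar>R\<bar>) ^ DIM('a) * (2 * \<bar>R\<bar>) powr s" for p
    proof (cases "fst p \<in> A \<and> snd p \<in> B")
      case True
      have "norm (fst p - snd p) \<le> norm (fst p) + norm (snd p)" by (rule norm_triangle_ineq4)
      also have "\<dots> \<le> 2 * \<bar>R\<bar>" using R(1)[of "fst p"] R(2)[of "snd p"] True by linarith
      finally have "norm (fst p - snd p) \<le> 2 * \<bar>R\<bar>" .
      then have "norm (fst p - snd p) ^ DIM('a) * norm (fst p - snd p) powr s \<le> (2 * \<bar>R\<bar>) ^ DIM('a) * (2 * \<bar>R\<bar>) powr s"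
        using s by (intro mult_mono power_mono powr_mono2) auto
      then show ?thesis using True by (simp add: ext_z_def case_prod_beta)
    qed (auto simp: ext_z_def case_prod_beta indicator_def)
    have AB [measurable]: "A \<times> B \<in> sets borel" using A B by (intro borel_Times)
    have "emeasure frac_measure {p \<in> space frac_measure. ext_z p \<noteq> 0} \<le> emeasure frac_measure (A \<times> B)"
      using AB by (intro emeasure_mono) (auto simp: ext_z_def indicator_def split: if_splits)
    also have "\<dots> = (\<integral>\<^sup>+p. indicator (A \<times> B) p \<partial>frac_measure)"
      using AB by simp
    also have "\<dots> = (\<integral>\<^sup>+x. \<integral>\<^sup>+y. ennreal (1 / norm (x - y) ^ DIM('a)) * indicator (A \<times> B) (x, y) \<partial>lborel \<partial>lborel)"
      by (rule nn_integral_frac_measure) measurable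
    also have "\<dots> \<le> (\<integral>\<^sup>+x. \<integral>\<^sup>+y. (ennreal (1 / \<delta> ^ DIM('a)) * indicator A x) * indicator B y \<partial>lborel \<partial>lborel)"
    proof (intro nn_integral_mono)
      fix x y :: 'a
      show "ennreal (1 / norm (x - y) ^ DIM('a)) * indicator (A \<times> B) (x, y) \<le> (ennreal (1 / \<delta> ^ DIM('a)) * indicator A x) * indicator B y"
      proof (cases "x \<in> A \<and> y \<in> B")
        case True
        then have "\<delta> \<le> norm (x - y)" using \<delta>(2) by blast
        then have "1 / norm (x - y) ^ DIM('a) \<le> 1 / \<delta> ^ DIM('a)"
          using \<delta>(1) by (intro divide_left_mono power_mono mult_pos_pos zero_less_power) auto
        then show ?thesis using True by (simp add: ennreal_leI)
      qed (auto simp: indicator_def)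
    qed
    also have "\<dots> = ennreal (1 / \<delta> ^ DIM('a)) * emeasure lborel A * emeasure lborel B"
      using A(1) B(1) by (simp add: nn_integral_cmult nn_integral_multc)
    also have "\<dots> < \<infinity>"
      using emeasure_bounded_borel_finite[OF bounded_A] emeasure_bounded_borel_finite[OF B(2)]
      by (simp add: ennreal_mult_less_top)
    finally show "emeasure frac_measure {p \<in> space frac_measure. ext_z p \<noteq> 0} < \<infinity>" .
  qed
qed

lemma exterior_pairing:
  fixes u :: "'a \<Rightarrow> real"
  assumes u: "u \<in> frac_space s G \<Omega>" and v [measurable]: "v \<in> borel_measurable borel"
    and uv: "AE x in lebesgue. u x = v x"
  shows "integrable lborel (\<lambda>y. v y * indicator B y)"
    and "orlicz_pairing (lebesgue_on \<Omega>) frac_measure (u, frac_quot s u) (ext_w, ext_z) =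
      measure lborel A * (\<integral>y. v y * indicator B y \<partial>lborel)"
proof -
  note O = young_function_orlicz[OF G] complementary_orlicz[OF G]
  note [measurable] = A(1) B(1)
  have \<Omega>l: "\<Omega> \<in> sets lebesgue" using \<Omega> by auto
  have mB: "emeasure lborel B < \<infinity>" using B(2) by (rule emeasure_bounded_borel_finite)
  have intB: "integrable lborel (indicator B :: 'a \<Rightarrow> real)" using mB by (simp add: integrable_indicator_iff)
  have uL: "u \<in> orlicz_space G (lebesgue_on \<Omega>)" "frac_quot s u \<in> orlicz_space G frac_measure"
    using u by (auto simp: frac_space_def)
  have hw: "(indicator A :: 'a \<Rightarrow> real) \<in> orlicz_space (complementary G) (lebesgue_on \<Omega>)"
  proof (rule bounded_finite_support_orlicz_space[OF O(2), where B=1])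
    have "(indicator A :: 'a \<Rightarrow> real) \<in> borel_measurable lebesgue" by (auto intro!: measurable_completion)
    then show "(indicator A :: 'a \<Rightarrow> real) \<in> borel_measurable (lebesgue_on \<Omega>)" by (rule measurable_restrict_space1)
    have "emeasure (lebesgue_on \<Omega>) {x \<in> space (lebesgue_on \<Omega>). (indicator A x :: real) \<noteq> 0} \<le> emeasure (lebesgue_on \<Omega>) (space (lebesgue_on \<Omega>))"
      by (intro emeasure_mono) auto
    also have "\<dots> = emeasure lborel \<Omega>" using \<Omega> by (simp add: emeasure_restrict_space)
    also have "\<dots> < \<infinity>" using \<Omega>(2) by (rule emeasure_bounded_borel_finite)
    finally show "emeasure (lebesgue_on \<Omega>) {x \<in> space (lebesgue_on \<Omega>). (indicator A x :: real) \<noteq> 0} < \<infinity>" .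
  qed (auto simp: indicator_def)
  have AE\<Omega>: "AE x in lebesgue. indicator \<Omega> x *\<^sub>R (u x * indicator A x) = v x * indicator A x"
    using uv A(2) by (auto elim!: eventually_mono simp: indicator_def)
  have intA: "integrable lborel (\<lambda>x. v x * indicator A x)"
  proof -
    have "integrable (lebesgue_on \<Omega>) (\<lambda>x. u x * indicator A x)"
      by (rule orlicz_pairing_integrable[OF G uL(1) hw])
    then have "integrable lebesgue (\<lambda>x. indicator \<Omega> x *\<^sub>R (u x * indicator A x))"
      using \<Omega>l by (subst (asm) integrable_restrict_space) auto
    then have "integrable lebesgue (\<lambda>x. v x * indicator A x)"
      by (rule Bochner_Integration.integrable_cong_AE_imp)
         (use AE\<Omega> in \<open>auto elim: eventually_mono intro!: measurable_completion\<close>)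
    then show ?thesis by (subst (asm) integrable_completion) auto
  qed
  have first: "(\<integral>x. u x * ext_w x \<partial>lebesgue_on \<Omega>) = measure lborel B * (\<integral>x. v x * indicator A x \<partial>lborel)"
  proof -
    have "(\<integral>x. u x * ext_w x \<partial>lebesgue_on \<Omega>) = measure lborel B * (\<integral>x. u x * indicator A x \<partial>lebesgue_on \<Omega>)"
      unfolding ext_w_def by (subst integral_mult_right_zero[symmetric]) (simp add: mult_ac)
    also have "(\<integral>x. u x * indicator A x \<partial>lebesgue_on \<Omega>) = (\<integral>x. indicator \<Omega> x *\<^sub>R (u x * indicator A x) \<partial>lebesgue)"
      using \<Omega>l by (subst integral_restrict_space) auto
    also have "\<dots> = (\<integral>x. v x * indicator A x \<partial>lebesgue)"
    proof (rule integral_cong_AE[OF _ _ AE\<Omega>])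
      show m: "(\<lambda>x. v x * indicator A x) \<in> borel_measurable lebesgue" by (auto intro!: measurable_completion)
      show "(\<lambda>x. indicator \<Omega> x *\<^sub>R (u x * indicator A x)) \<in> borel_measurable lebesgue"
        by (rule borel_measurable_AE[OF m]) (use AE\<Omega> in \<open>auto elim: eventually_mono\<close>)
    qed
    also have "\<dots> = (\<integral>x. v x * indicator A x \<partial>lborel)" by (rule integral_completion) measurable
    finally show ?thesis .
  qed
  define f where "f = (\<lambda>(x, y). (v x - v y) * indicator A x * indicator B y)"
  have fm: "f \<in> borel_measurable borel"
  proof -
    have ind: "(\<lambda>p. indicator A (fst p) :: real) \<in> borel_measurable (borel \<Otimes>\<^sub>M borel)"
        "(\<lambda>p. indicator B (snd p) :: real) \<in> borel_measurable (borel \<Otimes>\<^sub>M borel)"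
      by (rule measurable_compose[OF measurable_fst borel_measurable_indicator[OF A(1)]],
          rule measurable_compose[OF measurable_snd borel_measurable_indicator[OF B(1)]])
    have "(\<lambda>p. v (fst p) - v (snd p)) \<in> borel_measurable (borel \<Otimes>\<^sub>M borel)" by measurable
    then show ?thesis
      unfolding f_def case_prod_beta borel_prod[symmetric] using ind by (intro borel_measurable_times)
  qed
  have Dm: "(\<lambda>p. frac_quot s v p * ext_z p) \<in> borel_measurable borel"
    using ext_z_measurable by measurable
  have Du: "AE p in frac_measure. frac_quot s u p * ext_z p = frac_quot s v p * ext_z p"
    using frac_quot_cong_AE[OF uv, of s] by eventually_elim simp
  have um: "(\<lambda>p. frac_quot s u p * ext_z p) \<in> borel_measurable frac_measure"
    using orlicz_space_measurable[OF O(1) uL(2)] borel_measurable_frac_measureI[OF ext_z_measurable] by measurable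
  define d where "d = (\<lambda>(x::'a, y). 1 / norm (x - y) ^ DIM('a))"
  have dm: "d \<in> borel_measurable borel" unfolding d_def borel_prod[symmetric] by measurable
  have frac_d: "frac_measure = density lebesgue (\<lambda>p. ennreal (d p))"
    by (simp add: frac_measure_def d_def case_prod_beta')
  have eq: "d p *\<^sub>R (frac_quot s v p * ext_z p) = - f p" for p
  proof (cases p)
    case (Pair x y)
    show ?thesis
    proof (cases "x \<in> A \<and> y \<in> B")
      case True
      then have "norm (x - y) > 0" using \<delta>(2)[of x y] \<delta>(1) by linarith
      then show ?thesis using True by (simp add: Pair d_def frac_quot_def ext_z_def f_def field_simps)
    qed (auto simp: Pair ext_z_def f_def)
  qed
  have intf: "integrable lborel f"
  proof -
    have "integrable frac_measure (\<lambda>p. frac_quot s u p * ext_z p)"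
      using orlicz_pairing_integrable[OF G uL(2)] ext_z_heart[OF O(2)] by (simp add: orlicz_heart_def)
    then have "integrable frac_measure (\<lambda>p. frac_quot s v p * ext_z p)"
      by (rule Bochner_Integration.integrable_cong_AE_imp) (use Du borel_measurable_frac_measureI[OF Dm] in \<open>auto elim: eventually_mono\<close>)
    then have "integrable lebesgue (\<lambda>p. d p *\<^sub>R (frac_quot s v p * ext_z p))"
      unfolding frac_d by (subst (asm) integrable_density) (use Dm dm in \<open>auto simp: d_def intro!: measurable_completion\<close>)
    then have "integrable lebesgue f" unfolding eq by simp
    then show ?thesis using fm by (subst (asm) integrable_completion) auto
  qed
  have second: "(\<integral>p. frac_quot s u p * ext_z p \<partial>frac_measure) = - (\<integral>p. f p \<partial>lborel)"
  proof -
    have "(\<integral>p. frac_quot s u p * ext_z p \<partial>frac_measure) = (\<integral>p. frac_quot s v p * ext_z p \<partial>frac_measure)"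
      by (rule integral_cong_AE[OF um borel_measurable_frac_measureI[OF Dm] Du])
    also have "\<dots> = (\<integral>p. d p *\<^sub>R (frac_quot s v p * ext_z p) \<partial>lebesgue)"
      unfolding frac_d by (rule integral_density) (use Dm dm in \<open>auto simp: d_def intro!: measurable_completion\<close>)
    also have "\<dots> = - (\<integral>p. f p \<partial>lebesgue)" unfolding eq by simp
    also have "(\<integral>p. f p \<partial>lebesgue) = (\<integral>p. f p \<partial>lborel)" using fm by (intro integral_completion) auto
    finally show ?thesis .
  qed
  have intf': "integrable (lborel \<Otimes>\<^sub>M lborel) f" using intf by (simp add: lborel_prod)
  show iB: "integrable lborel (\<lambda>y. v y * indicator B y)"
  proof -
    have ae: "AE x in lborel. integrable lborel (\<lambda>y. f (x, y))"
      by (rule lborel_pair.AE_integrable_fst'[OF intf'])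
    \<comment> \<open>Nothing is assumed about integrability of \<open>u\<close> outside the domain.
      Almost every slice of \<open>f\<close> is integrable and \<open>A\<close> has positive
      measure, so one slice over a point of \<open>A\<close> is; on \<open>B\<close> it differs from
      \<open>v\<close> by sign and a constant.\<close>
    have "\<exists>x\<in>A. integrable lborel (\<lambda>y. f (x, y))"
    proof (rule ccontr)
      assume "\<not> (\<exists>x\<in>A. integrable lborel (\<lambda>y. f (x, y)))"
      then have "AE x in lborel. x \<notin> A" using ae by (auto elim: eventually_mono)
      then have "emeasure lborel A = 0" by (subst (asm) AE_iff_measurable[OF _ refl]) auto
      then show False using Apos by simp
    qed
    then obtain x where x: "x \<in> A" "integrable lborel (\<lambda>y. f (x, y))" by blast
    have "integrable lborel (\<lambda>y. v x * indicator B y - f (x, y))"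
      using intB x(2) by simp
    then show ?thesis using x(1) by (simp add: f_def left_diff_distrib)
  qed
  let ?I = "\<integral>y. v y * indicator B y \<partial>lborel"
  have "(\<integral>p. f p \<partial>lborel) = (\<integral>x. \<integral>y. f (x, y) \<partial>lborel \<partial>lborel)"
    using lborel_pair.integral_fst'[OF intf'] by (simp add: lborel_prod)
  also have "\<dots> = (\<integral>x. measure lborel B * (v x * indicator A x) - ?I * indicator A x \<partial>lborel)"
  proof (rule Bochner_Integration.integral_cong[OF refl])
    fix x
    have "(\<integral>y. f (x, y) \<partial>lborel) = (\<integral>y. (v x * indicator A x) * indicator B y - indicator A x * (v y * indicator B y) \<partial>lborel)"
      by (intro Bochner_Integration.integral_cong) (auto simp: f_def algebra_simps)
    also have "\<dots> = (v x * indicator A x) * measure lborel B - indicator A x * ?I"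
      using intB iB by simp
    finally show "(\<integral>y. f (x, y) \<partial>lborel) = measure lborel B * (v x * indicator A x) - ?I * indicator A x"
      by (simp add: mult_ac)
  qed
  also have "\<dots> = measure lborel B * (\<integral>x. v x * indicator A x \<partial>lborel) - ?I * measure lborel A"
  proof -
    have "integrable lborel (indicator A :: 'a \<Rightarrow> real)"
      using emeasure_bounded_borel_finite[OF bounded_A] by (simp add: integrable_indicator_iff)
    then show ?thesis using intA by simp
  qed
  finally show "orlicz_pairing (lebesgue_on \<Omega>) frac_measure (u, frac_quot s u) (ext_w, ext_z) = measure lborel A * ?I"
    using first second by (simp add: orlicz_pairing_def)
qed

end

text \<open>Every test pairing vanishes on test functions and, being continuous, on their closure.
  Hence \<open>u\<close> has zero integral over each bounded Borel set outside the domain.\<close>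

lemma frac_space_0_vanishing:
  fixes \<Omega> :: "'a::euclidean_space set"
  assumes G: "young_function G" and \<Omega>: "open \<Omega>" "bounded \<Omega>" "\<Omega> \<noteq> {}" and s: "0 < s"
    and u: "u \<in> frac_space_0 s G \<Omega>"
  shows "AE x in lebesgue. x \<notin> \<Omega> \<longrightarrow> u x = 0"
proof -
  note O = young_function_orlicz[OF G] complementary_orlicz[OF G]
  have \<Omega>b: "\<Omega> \<in> sets borel" using \<Omega> by simp
  have us: "u \<in> frac_space s G \<Omega>"
    using u frac_space_0_subset by blast
  have um: "u \<in> borel_measurable lebesgue" using us by (simp add: frac_space_def)
  obtain v where v [measurable]: "v \<in> borel_measurable borel" and uv: "AE x in lebesgue. u x = v x"
    using borel_representative[OF um] by blast
  obtain a where "a \<in> \<Omega>" using \<Omega>(3) by blast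
  then obtain e where e: "e > 0" "ball a e \<subseteq> \<Omega>" using \<Omega>(1) openE by blast
  \<comment> \<open>Half the radius leaves the distance \<open>e / 2\<close> between
    \<open>A\<close> and the complement of the domain.\<close>
  define A where "A = ball a (e / 2)"
  have A: "A \<in> sets borel" "A \<subseteq> \<Omega>" using e by (auto simp: A_def)
  have Apos: "emeasure lborel A > 0" using e by (simp add: A_def emeasure_ball)
  have mA: "measure lborel A \<noteq> 0"
    using e less_imp_neq[OF unit_ball_vol_pos[of "real DIM('a)"], THEN not_sym] by (simp add: A_def content_ball)
  have key: "integrable lborel (\<lambda>y. v y * indicator B y) \<and> (\<integral>y. v y * indicator B y \<partial>lborel) = 0"
    if B: "B \<in> sets borel" "bounded B" "B \<inter> \<Omega> = {}" for B
  proof -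
    have dist: "e / 2 \<le> norm (x - y)" if xy: "x \<in> A" "y \<in> B" for x y
    proof -
      have "y \<notin> ball a e" using xy(2) B(3) e(2) by blast
      then have "e \<le> dist a y" by simp
      moreover have "dist a y \<le> dist a x + dist x y" by (rule dist_triangle)
      ultimately show ?thesis using xy(1) by (simp add: A_def dist_norm)
    qed
    have e2: "e / 2 > 0" using e by simp
    let ?P = "\<lambda>u. orlicz_pairing (lebesgue_on \<Omega>) frac_measure (u, frac_quot s u) (ext_w A B, ext_z A B s)"
    note ext = ext_w_heart[OF G \<Omega>b \<Omega>(2) A B(1,2) e2 dist s Apos O(2)]
      ext_z_heart[OF G \<Omega>b \<Omega>(2) A B(1,2) e2 dist s Apos O(2)]
    note pairing = exterior_pairing[OF G \<Omega>b \<Omega>(2) A B(1,2) e2 dist s Apos]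
    have cont: "continuous_map (frac_weak_star s G \<Omega>) euclideanreal ?P"
      by (rule continuous_map_frac_pairing) (rule ext, assumption+)+
    have "?P u \<in> {0}"
    proof -
      have "closedin (frac_weak_star s G \<Omega>) {w \<in> topspace (frac_weak_star s G \<Omega>). ?P w \<in> {0}}"
        by (rule closedin_continuous_map_preimage[OF cont]) simp
      \<comment> \<open>The closure depends only on the part of the set inside the topological
        space, so membership of all test functions in the Orlicz--Sobolev space is not at
        issue.\<close>
      moreover have "topspace (frac_weak_star s G \<Omega>) \<inter> test_functions \<Omega> \<subseteq> {w \<in> topspace (frac_weak_star s G \<Omega>). ?P w \<in> {0}}"
      proof
        fix \<phi> assume \<phi>: "\<phi> \<in> topspace (frac_weak_star s G \<Omega>) \<inter> test_functions \<Omega>"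
        then have \<phi>s: "\<phi> \<in> frac_space s G \<Omega>" by (simp add: topspace_frac_weak_star)
        have \<phi>m: "\<phi> \<in> borel_measurable borel"
          using \<phi> by (intro borel_measurable_continuous_onI C_k_continuous[of 0]) (auto simp: test_functions_def)
        have "\<phi> x = 0" if "x \<notin> \<Omega>" for x
          using \<phi> that closure_subset[of "{x. \<phi> x \<noteq> 0}"] by (auto simp: test_functions_def)
        then have "(\<lambda>y. \<phi> y * indicator B y) = (\<lambda>_. 0)" using B(3) by (auto simp: indicator_def fun_eq_iff)
        then have "(\<integral>y. \<phi> y * indicator B y \<partial>lborel) = 0" by simp
        moreover have "?P \<phi> = measure lborel A * (\<integral>y. \<phi> y * indicator B y \<partial>lborel)"
          by (rule pairing(2)[OF _ _ \<phi>s \<phi>m]) auto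
        ultimately show "\<phi> \<in> {w \<in> topspace (frac_weak_star s G \<Omega>). ?P w \<in> {0}}" using \<phi> by simp
      qed
      ultimately have "frac_weak_star s G \<Omega> closure_of test_functions \<Omega> \<subseteq> {w \<in> topspace (frac_weak_star s G \<Omega>). ?P w \<in> {0}}"
        by (subst closure_of_restrict) (rule closure_of_minimal)
      then show ?thesis using u unfolding frac_space_0_def by blast
    qed
    moreover have "?P u = measure lborel A * (\<integral>y. v y * indicator B y \<partial>lborel)"
      by (rule pairing(2)[OF _ _ us v uv])
    ultimately have "(\<integral>y. v y * indicator B y \<partial>lborel) = 0" using mA by simp
    moreover have "integrable lborel (\<lambda>y. v y * indicator B y)"
      by (rule pairing(1)[OF _ _ us v uv])
    ultimately show ?thesis by simp
  qed
  have zero: "AE x in lborel. x \<in> ball 0 (real k) - \<Omega> \<longrightarrow> \<not> 0 < c * v x" if c: "c = 1 \<or> c = -1" for k c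
  proof -
    \<comment> \<open>On this set the integrand has a sign, so its zero integral forces it to vanish
      almost everywhere; \<open>c\<close> selects the positive or the negative part.\<close>
    define B where "B = {x \<in> ball 0 (real k) - \<Omega>. 0 < c * v x}"
    have Bm: "B \<in> sets borel" unfolding B_def using \<Omega>b by measurable
    have "bounded B" by (rule bounded_subset[OF bounded_ball[of 0 "real k"]]) (auto simp: B_def)
    then have B: "integrable lborel (\<lambda>y. v y * indicator B y)" "(\<integral>y. v y * indicator B y \<partial>lborel) = 0"
      using key[OF Bm] by (auto simp: B_def)
    have i: "integrable lborel (\<lambda>y. c * (v y * indicator B y))" using B(1) by simp
    have "(\<integral>y. c * (v y * indicator B y) \<partial>lborel) = 0" using B(2) by simp
    moreover have "AE y in lborel. 0 \<le> c * (v y * indicator B y)"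
      by (rule AE_I2) (auto simp: B_def indicator_def)
    ultimately have "AE y in lborel. c * (v y * indicator B y) = 0"
      using integral_nonneg_eq_0_iff_AE[OF i] by simp
    then show ?thesis by eventually_elim (auto simp: B_def indicator_def)
  qed
  have "AE x in lborel. \<forall>k::nat. x \<in> ball 0 (real k) - \<Omega> \<longrightarrow> v x = 0"
    unfolding AE_all_countable
  proof
    fix k :: nat
    show "AE x in lborel. x \<in> ball 0 (real k) - \<Omega> \<longrightarrow> v x = 0"
      using zero[OF disjI1[OF refl], of k] zero[OF disjI2[OF refl], of k] by eventually_elim auto
  qed
  then have "AE x in lebesgue. \<forall>k::nat. x \<in> ball 0 (real k) - \<Omega> \<longrightarrow> v x = 0" by (rule AE_completion)
  then show ?thesis using uv
  proof eventually_elim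
    case (elim x)
    obtain k :: nat where "norm x < real k" using reals_Archimedean2 by blast
    then show ?case using elim by auto
  qed
qed

section \<open>Compactness\<close>

text \<open>The subsequence step of the Riesz--Fischer theorem: successive distances at most
  \<open>(1/2) ^ m\<close> make the telescoping series absolutely convergent almost
  everywhere.\<close>

lemma L1_Cauchy_AE_subsequence:
  fixes w :: "nat \<Rightarrow> 'b \<Rightarrow> real"
  assumes [measurable]: "\<And>i. w i \<in> borel_measurable M"
    and Cauchy: "\<And>e::real. e > 0 \<Longrightarrow> \<exists>N. \<forall>i\<ge>N. \<forall>l\<ge>N. (\<integral>\<^sup>+x. ennreal \<bar>w i x - w l x\<bar> \<partial>M) \<le> ennreal e"
  obtains q v where "strict_mono q" "v \<in> borel_measurable M" "AE x in M. (\<lambda>m. w (q m) x) \<longlonglongrightarrow> v x"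
proof -
  have "\<exists>N. \<forall>i\<ge>N. \<forall>l\<ge>N. (\<integral>\<^sup>+x. ennreal \<bar>w i x - w l x\<bar> \<partial>M) \<le> ennreal ((1/2) ^ m)" for m :: nat
    by (rule Cauchy) simp
  then obtain N where N: "\<And>m i l. i \<ge> N m \<Longrightarrow> l \<ge> N m \<Longrightarrow> (\<integral>\<^sup>+x. ennreal \<bar>w i x - w l x\<bar> \<partial>M) \<le> ennreal ((1/2) ^ m)"
    by metis
  \<comment> \<open>Summing the thresholds, with an extra 1, makes the indices strictly increasing
    while they stay above each threshold.\<close>
  define q where "q m = (\<Sum>i\<le>m. N i + 1)" for m :: nat
  have q_Suc: "q (Suc m) = q m + N (Suc m) + 1" for m by (simp add: q_def)
  have q: "strict_mono q" by (simp add: strict_mono_Suc_iff q_Suc)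
  have qN: "N m \<le> q m" for m by (cases m) (auto simp: q_def)
  have qN': "N m \<le> q (Suc m)" for m using qN[of m] q_Suc[of m] by simp
  define d where "d m x = w (q (Suc m)) x - w (q m) x" for m x
  have [measurable]: "d m \<in> borel_measurable M" for m unfolding d_def by measurable
  have "(\<integral>\<^sup>+x. (\<Sum>m. ennreal \<bar>d m x\<bar>) \<partial>M) = (\<Sum>m. \<integral>\<^sup>+x. ennreal \<bar>d m x\<bar> \<partial>M)"
    by (rule nn_integral_suminf) measurable
  also have "\<dots> \<le> (\<Sum>m. ennreal ((1/2) ^ m))"
    unfolding d_def by (intro suminf_le summableI N qN qN')
  also have "\<dots> = ennreal (\<Sum>m. (1/2) ^ m)"
    by (rule suminf_ennreal2) (auto intro: summable_geometric)
  also have "\<dots> < \<infinity>" by simp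
  finally have fin: "(\<integral>\<^sup>+x. (\<Sum>m. ennreal \<bar>d m x\<bar>) \<partial>M) \<noteq> \<infinity>" by simp
  have "AE x in M. (\<Sum>m. ennreal \<bar>d m x\<bar>) \<noteq> \<infinity>"
    by (rule nn_integral_noteq_infinite[OF _ fin]) measurable
  then have "AE x in M. convergent (\<lambda>m. w (q m) x)"
  proof eventually_elim
    case (elim x)
    then have "summable (\<lambda>m. \<bar>d m x\<bar>)" by (intro summable_suminf_not_top) auto
    then have "summable (\<lambda>m. d m x)" by (rule summable_rabs_cancel)
    then have "convergent (\<lambda>m. \<Sum>i<m. d i x)" by (simp add: summable_iff_convergent)
    moreover have "(\<Sum>i<m. d i x) = w (q m) x - w (q 0) x" for m
      unfolding d_def by (rule sum_lessThan_telescope)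
    ultimately have "convergent (\<lambda>m. w (q m) x - w (q 0) x)" by simp
    from convergent_add[OF this convergent_const[of "w (q 0) x"]] show ?case by simp
  qed
  then have "AE x in M. (\<lambda>m. w (q m) x) \<longlonglongrightarrow> lim (\<lambda>m. w (q m) x)"
    by eventually_elim (simp add: convergent_LIMSEQ_iff)
  moreover have "(\<lambda>x. lim (\<lambda>m. w (q m) x)) \<in> borel_measurable M"
    by (rule borel_measurable_lim_metric) measurable
  ultimately show ?thesis using that q by blast
qed

text \<open>The lower corner of the dyadic cube of side \<open>1 / 2 ^ j\<close> that contains
  \<open>x\<close>.\<close>

definition grid_point :: "nat \<Rightarrow> 'a::euclidean_space \<Rightarrow> 'a" where
  "grid_point j x = (\<Sum>b\<in>Basis. (of_int \<lfloor>2 ^ j * (x \<bullet> b)\<rfloor> / 2 ^ j) *\<^sub>R b)"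

lemma grid_point_measurable [measurable]: "grid_point j \<in> borel_measurable borel"
  unfolding grid_point_def[abs_def] by measurable

lemma countable_range_grid_point: "countable (range (grid_point j :: 'a \<Rightarrow> 'a::euclidean_space))"
proof -
  let ?g = "\<lambda>f :: 'a \<Rightarrow> int. \<Sum>b\<in>Basis. (of_int (f b) / 2 ^ j) *\<^sub>R b"
  have "range (grid_point j) \<subseteq> ?g ` (PiE Basis (\<lambda>_. UNIV))"
  proof
    fix c assume "c \<in> range (grid_point j :: 'a \<Rightarrow> 'a)"
    then obtain x :: 'a where "c = grid_point j x" by blast
    then have "c = ?g (restrict (\<lambda>b. \<lfloor>2 ^ j * (x \<bullet> b)\<rfloor>) Basis)" by (simp add: grid_point_def)
    moreover have "restrict (\<lambda>b. \<lfloor>2 ^ j * (x \<bullet> b)\<rfloor>) Basis \<in> PiE Basis (\<lambda>_. UNIV)" by simp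
    ultimately show "c \<in> ?g ` (PiE Basis (\<lambda>_. UNIV))" by blast
  qed
  moreover have "countable (?g ` (PiE Basis (\<lambda>_. UNIV)))" by (intro countable_image countable_PiE) auto
  ultimately show ?thesis by (rule countable_subset)
qed

lemma norm_diff_grid_point: "norm (x - grid_point j x) \<le> real DIM('a) / 2 ^ j"
  for x :: "'a::euclidean_space"
proof -
  have "norm (x - grid_point j x) \<le> (\<Sum>b\<in>Basis. \<bar>(x - grid_point j x) \<bullet> b\<bar>)" by (rule norm_le_l1)
  also have "\<dots> \<le> (\<Sum>b\<in>(Basis :: 'a set). 1 / 2 ^ j)"
  proof (rule sum_mono)
    fix b :: 'a assume b: "b \<in> Basis"
    have "grid_point j x \<bullet> b = of_int \<lfloor>2 ^ j * (x \<bullet> b)\<rfloor> / 2 ^ j"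
      using b by (simp add: grid_point_def inner_sum_left_Basis)
    then have "(x - grid_point j x) \<bullet> b = (2 ^ j * (x \<bullet> b) - of_int \<lfloor>2 ^ j * (x \<bullet> b)\<rfloor>) / 2 ^ j"
      by (simp add: inner_diff_left diff_divide_distrib)
    also have "\<bar>\<dots>\<bar> = \<bar>2 ^ j * (x \<bullet> b) - of_int \<lfloor>2 ^ j * (x \<bullet> b)\<rfloor>\<bar> / 2 ^ j" by (simp add: abs_divide)
    also have "\<dots> \<le> 1 / 2 ^ j"
    proof (rule divide_right_mono)
      show "\<bar>2 ^ j * (x \<bullet> b) - of_int \<lfloor>2 ^ j * (x \<bullet> b)\<rfloor>\<bar> \<le> 1" by linarith
    qed simp
    finally show "\<bar>(x - grid_point j x) \<bullet> b\<bar> \<le> 1 / 2 ^ j" .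
  qed
  finally show ?thesis by simp
qed

text \<open>Averages over balls centred at grid points approximate in \<open>L\<^sup>1\<close> uniformly along the sequence,
  and for each grid they depend on countably many bounded numbers only, so that a diagonal
  subsequence is Cauchy in \<open>L\<^sup>1\<close>.\<close>

lemma frac_modular_compactness:
  fixes u :: "nat \<Rightarrow> 'a::euclidean_space \<Rightarrow> real" and s R F M :: real
  assumes G: "young_function G" and s: "0 < s" and R: "R \<ge> 0"
    and um [measurable]: "\<And>k. u k \<in> borel_measurable borel" and u0: "\<And>k x. norm x > R \<Longrightarrow> u k x = 0"
    and F: "\<And>k. orlicz_modular G frac_measure (frac_quot s (u k)) \<le> ennreal F"
    and M: "M \<ge> 0" "\<And>k. (\<integral>\<^sup>+x. ennreal \<bar>u k x\<bar> \<partial>lborel) \<le> ennreal M"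
  obtains r v where "strict_mono r" "v \<in> borel_measurable borel" "AE x in lborel. (\<lambda>k. u (r k) x) \<longlonglongrightarrow> v x"
proof -
  let ?n = "DIM('a)"
  define V where "V = unit_ball_vol (real ?n)"
  have V: "V > 0" by (simp add: V_def)
  obtain B where B: "B \<ge> 0" "\<And>(u :: 'a \<Rightarrow> real) L r. u \<in> borel_measurable borel \<Longrightarrow> (\<And>x. norm x > R \<Longrightarrow> u x = 0) \<Longrightarrow>
      L > 0 \<Longrightarrow> 0 < r \<Longrightarrow> r \<le> 1 \<Longrightarrow>
      (\<integral>\<^sup>+x. \<integral>\<^sup>+y. ennreal \<bar>u x - u y\<bar> * indicator (cball 0 r) (x - y) \<partial>lborel \<partial>lborel)
        \<le> ennreal (L * r powr s * r ^ ?n) *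
          (orlicz_modular G frac_measure (\<lambda>z. frac_quot s u z / L) + ennreal B)"
    by (rule frac_L1_estimate[OF G s R, where 'a='a]) blast
  have int: "integrable lborel (u k)" for k
    using le_less_trans[OF M(2)[of k] ennreal_less_top] by (intro integrableI_bounded) auto
  \<comment> \<open>This bounds the distance of a point to its grid point, so the ball of radius
    \<open>\<rho> j\<close> around the grid point lies in the ball of radius
    \<open>2 * \<rho> j\<close> around \<open>x\<close>.\<close>
  define \<rho> where "\<rho> j = real ?n / 2 ^ j" for j
  have \<rho>: "\<rho> j > 0" for j by (simp add: \<rho>_def)
  define a where "a k j c = (\<integral>y. u k y * indicator (cball 0 (\<rho> j)) (y - c) \<partial>lborel)" for k j and c :: 'a
  have inta: "integrable lborel (\<lambda>y. u k y * indicator (cball 0 (\<rho> j)) (y - c))" for k j c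
  proof (rule Bochner_Integration.integrable_bound[OF int[of k]])
    have [measurable]: "cball (0::'a) (\<rho> j) \<in> sets borel" by simp
    show "(\<lambda>y. u k y * indicator (cball 0 (\<rho> j)) (y - c)) \<in> borel_measurable lborel" by measurable
  qed (auto simp: indicator_def)
  have a_bound: "norm (a k j c) \<le> M" for k j c
  proof -
    have "ennreal (norm (a k j c)) \<le> (\<integral>\<^sup>+y. ennreal (norm (u k y * indicator (cball 0 (\<rho> j)) (y - c))) \<partial>lborel)"
      unfolding a_def by (rule integral_norm_bound_ennreal[OF inta])
    also have "\<dots> \<le> (\<integral>\<^sup>+y. ennreal \<bar>u k y\<bar> \<partial>lborel)"
      by (intro nn_integral_mono ennreal_leI) (auto simp: indicator_def)
    also note M(2)
    finally show ?thesis using M(1) by simp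
  qed
  \<comment> \<open>All mesh sizes are treated as one countable index set, so a single extraction
    makes every average converge.\<close>
  define S where "S = (SIGMA j:UNIV. range (grid_point j :: 'a \<Rightarrow> 'a))"
  have "countable S" unfolding S_def by (intro countable_SIGMA countable_range_grid_point) auto
  then obtain r0 where r0: "strict_mono r0" "\<And>p. p \<in> S \<Longrightarrow> \<exists>l. (\<lambda>n. a (r0 n) (fst p) (snd p)) \<longlonglongrightarrow> l"
    using function_convergent_subsequence[of S "\<lambda>k p. a k (fst p) (snd p)" M] a_bound by blast
  define w where "w i = u (r0 i)" for i
  have wm [measurable]: "w i \<in> borel_measurable borel" for i by (simp add: w_def)
  define Av where "Av i j x = a (r0 i) j (grid_point j x) / (V * \<rho> j ^ ?n)" for i j x
  define \<alpha> where "\<alpha> j x = lim (\<lambda>i. Av i j x)" for j x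
  have Av_lim: "(\<lambda>i. Av i j x) \<longlonglongrightarrow> \<alpha> j x" for j x
  proof -
    have "(j, grid_point j x) \<in> S" by (auto simp: S_def)
    from r0(2)[OF this] obtain l where "(\<lambda>i. a (r0 i) j (grid_point j x)) \<longlonglongrightarrow> l" by auto
    from tendsto_divide[OF this tendsto_const[of "V * \<rho> j ^ ?n"]] have "convergent (\<lambda>i. Av i j x)"
      using V \<rho>[of j] by (auto simp: Av_def convergent_def)
    then show ?thesis unfolding \<alpha>_def by (simp add: convergent_LIMSEQ_iff)
  qed
  have Avm [measurable]: "Av i j \<in> borel_measurable borel" for i j
  proof -
    have [measurable]: "cball (0::'a) (\<rho> j) \<in> sets borel" by simp
    show ?thesis unfolding Av_def[abs_def] a_def by measurable
  qed
  have \<alpha>m [measurable]: "\<alpha> j \<in> borel_measurable borel" for j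
    unfolding \<alpha>_def[abs_def] by (rule borel_measurable_lim_metric) measurable
  have Av_bound: "\<bar>Av i j x\<bar> \<le> M / (V * \<rho> j ^ ?n)" for i j x
    unfolding Av_def abs_divide using a_bound M(1) V \<rho>[of j] by (auto intro!: frac_le)
  have \<alpha>_bound: "\<bar>\<alpha> j x\<bar> \<le> M / (V * \<rho> j ^ ?n)" for j x
    by (rule tendsto_upperbound[OF tendsto_rabs[OF Av_lim[of j x]]]) (use Av_bound in auto)
  \<comment> \<open>The bound of \<open>frac_L1_estimate\<close> at radius
    \<open>2 * \<rho> j\<close>, divided by the volume \<open>V * \<rho> j ^ n\<close> of the
    averaging ball.\<close>
  define \<delta> where "\<delta> j = 2 ^ ?n / V * (2 * \<rho> j) powr s * (\<bar>F\<bar> + B)" for j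
  have \<delta>_nonneg: "\<delta> j \<ge> 0" for j using V B(1) by (simp add: \<delta>_def)
  have approx: "(\<integral>\<^sup>+x. ennreal \<bar>w i x - Av i j x\<bar> \<partial>lborel) \<le> ennreal (\<delta> j)" if j: "2 * \<rho> j \<le> 1" for i j
  proof -
    let ?c = "V * \<rho> j ^ ?n"
    have c: "?c > 0" using V \<rho>[of j] by simp
    have [measurable]: "cball (0::'a) (2 * \<rho> j) \<in> sets borel" by simp
    have pt: "ennreal \<bar>w i x - Av i j x\<bar> \<le> ennreal (1 / ?c) * (\<integral>\<^sup>+y. ennreal \<bar>w i x - w i y\<bar> * indicator (cball 0 (2 * \<rho> j)) (x - y) \<partial>lborel)" for x
    proof -
      let ?g = "grid_point j x"
      let ?I = "\<lambda>y. indicator (cball ?g (\<rho> j)) y :: real"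
      have I: "indicator (cball 0 (\<rho> j)) (y - ?g) = ?I y" for y
        by (simp add: indicator_def dist_norm norm_minus_commute)
      have mI: "measure lborel (cball ?g (\<rho> j)) = ?c"
        using \<rho>[of j] by (simp add: content_cball V_def)
      have iI: "integrable lborel ?I" using emeasure_lborel_cball_finite[of ?g "\<rho> j"] by (simp add: integrable_indicator_iff)
      have i2: "integrable lborel (\<lambda>y. w i y * ?I y)" using inta[of "r0 i" j ?g] by (simp add: I w_def)
      have i3: "integrable lborel (\<lambda>y. w i x * ?I y - w i y * ?I y)" using iI i2 by simp
      have "w i x - Av i j x = (1 / ?c) * (\<integral>y. w i x * ?I y - w i y * ?I y \<partial>lborel)"
      proof -
        have "(\<integral>y. w i x * ?I y - w i y * ?I y \<partial>lborel) = w i x * ?c - a (r0 i) j ?g"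
          using iI i2 mI by (simp add: a_def I w_def)
        moreover have "p - q / ?c = (1 / ?c) * (p * ?c - q)" for p q :: real
          using V \<rho>[of j] by (simp add: right_diff_distrib)
        ultimately show ?thesis unfolding Av_def by presburger
      qed
      then have "ennreal \<bar>w i x - Av i j x\<bar> = ennreal (1 / ?c) * ennreal (norm (\<integral>y. w i x * ?I y - w i y * ?I y \<partial>lborel))"
        using V \<rho>[of j] by (simp add: abs_mult power_abs ennreal_mult'[symmetric])
      also have "\<dots> \<le> ennreal (1 / ?c) * (\<integral>\<^sup>+y. ennreal (norm (w i x * ?I y - w i y * ?I y)) \<partial>lborel)"
        by (intro mult_left_mono integral_norm_bound_ennreal[OF i3]) simp
      also have "\<dots> \<le> ennreal (1 / ?c) * (\<integral>\<^sup>+y. ennreal \<bar>w i x - w i y\<bar> * indicator (cball 0 (2 * \<rho> j)) (x - y) \<partial>lborel)"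
      proof (intro mult_left_mono nn_integral_mono)
        fix y
        show "ennreal (norm (w i x * ?I y - w i y * ?I y)) \<le> ennreal \<bar>w i x - w i y\<bar> * indicator (cball 0 (2 * \<rho> j)) (x - y)"
        proof (cases "y \<in> cball ?g (\<rho> j)")
          case True
          have "norm (x - y) \<le> norm (x - ?g) + norm (?g - y)"
            using norm_triangle_ineq[of "x - ?g" "?g - y"] by simp
          also have "\<dots> \<le> 2 * \<rho> j"
            using True norm_diff_grid_point[of x j] by (simp add: dist_norm \<rho>_def)
          finally show ?thesis using True by simp
        qed simp
      qed simp
      finally show ?thesis .
    qed
    have "(\<integral>\<^sup>+x. ennreal \<bar>w i x - Av i j x\<bar> \<partial>lborel) \<le>
      (\<integral>\<^sup>+x. ennreal (1 / ?c) * (\<integral>\<^sup>+y. ennreal \<bar>w i x - w i y\<bar> * indicator (cball 0 (2 * \<rho> j)) (x - y) \<partial>lborel) \<partial>lborel)"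
      by (intro nn_integral_mono pt)
    also have "\<dots> = ennreal (1 / ?c) * (\<integral>\<^sup>+x. \<integral>\<^sup>+y. ennreal \<bar>w i x - w i y\<bar> * indicator (cball 0 (2 * \<rho> j)) (x - y) \<partial>lborel \<partial>lborel)"
      by (rule nn_integral_cmult) measurable
    also have "\<dots> \<le> ennreal (1 / ?c) * (ennreal (1 * (2 * \<rho> j) powr s * (2 * \<rho> j) ^ ?n) *
          (orlicz_modular G frac_measure (\<lambda>z. frac_quot s (w i) z / 1) + ennreal B))"
      using \<rho>[of j] j by (intro mult_left_mono B(2)) (auto simp: w_def u0)
    also have "\<dots> \<le> ennreal (1 / ?c) * (ennreal (1 * (2 * \<rho> j) powr s * (2 * \<rho> j) ^ ?n) * (ennreal \<bar>F\<bar> + ennreal B))"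
    proof (intro mult_left_mono add_right_mono)
      show "orlicz_modular G frac_measure (\<lambda>z. frac_quot s (w i) z / 1) \<le> ennreal \<bar>F\<bar>"
        using order_trans[OF F[of "r0 i"] ennreal_leI[OF abs_ge_self]] by (simp add: w_def)
    qed auto
    also have "\<dots> = ennreal ((1 / ?c) * ((1 * (2 * \<rho> j) powr s * (2 * \<rho> j) ^ ?n) * (\<bar>F\<bar> + B)))"
      using c \<rho>[of j] B(1) by (simp add: ennreal_plus[symmetric] ennreal_mult[symmetric] del: ennreal_plus)
    also have "(1 / ?c) * ((1 * (2 * \<rho> j) powr s * (2 * \<rho> j) ^ ?n) * (\<bar>F\<bar> + B)) = \<delta> j"
      using c V \<rho>[of j] by (simp add: \<delta>_def power_mult_distrib)
    finally show ?thesis .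
  qed
  have \<rho>0: "\<rho> \<longlonglongrightarrow> 0"
    unfolding \<rho>_def using LIMSEQ_divide_realpow_zero[of 2 "real ?n"] by simp
  have \<delta>0: "\<delta> \<longlonglongrightarrow> 0"
  proof -
    have "(\<lambda>j. 2 * \<rho> j) \<longlonglongrightarrow> 0" using tendsto_mult_right_zero[OF \<rho>0] by simp
    then have "(\<lambda>j. (2 * \<rho> j) powr s) \<longlonglongrightarrow> 0 powr s"
      by (intro tendsto_powr' tendsto_const) (use s \<rho> in \<open>auto intro!: always_eventually less_imp_le\<close>)
    then have "(\<lambda>j. (2 * \<rho> j) powr s) \<longlonglongrightarrow> 0" using s by simp
    then show ?thesis unfolding \<delta>_def by (intro tendsto_mult_left_zero tendsto_mult_right_zero)
  qed
  have tri: "ennreal \<bar>a - c\<bar> \<le> ennreal \<bar>a - b\<bar> + ennreal \<bar>b - c\<bar>" for a b c :: real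
  proof -
    have "ennreal \<bar>a - c\<bar> \<le> ennreal (\<bar>a - b\<bar> + \<bar>b - c\<bar>)" by (intro ennreal_leI) linarith
    also have "\<dots> = ennreal \<bar>a - b\<bar> + ennreal \<bar>b - c\<bar>" by (rule ennreal_plus) auto
    finally show ?thesis .
  qed
  have Cauchy: "\<exists>N. \<forall>i\<ge>N. \<forall>l\<ge>N. (\<integral>\<^sup>+x. ennreal \<bar>w i x - w l x\<bar> \<partial>lborel) \<le> ennreal e" if e: "e > 0" for e :: real
  proof -
    have "eventually (\<lambda>j. \<delta> j < e / 4) sequentially" using \<delta>0 e by (intro order_tendstoD) auto
    moreover have "eventually (\<lambda>j. \<rho> j < 1 / 2) sequentially" using \<rho>0 by (intro order_tendstoD) auto
    ultimately have "eventually (\<lambda>j. \<delta> j < e / 4 \<and> \<rho> j < 1 / 2) sequentially" by eventually_elim simp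
    then obtain j where j: "\<delta> j < e / 4" "2 * \<rho> j \<le> 1"
      by (auto simp: eventually_sequentially)
    \<comment> \<open>The averages have only a constant as common bound, which is integrable on a
      set of finite measure. Restricting to this ball loses nothing, as the functions themselves
      vanish outside.\<close>
    let ?K = "cball (0::'a) R"
    have K [measurable]: "?K \<in> sets borel" by simp
    let ?m = "M / (V * \<rho> j ^ ?n)"
    have "(\<lambda>i. \<integral>\<^sup>+x. ennreal \<bar>Av i j x - \<alpha> j x\<bar> * indicator ?K x \<partial>lborel) \<longlonglongrightarrow> (\<integral>\<^sup>+x. 0 \<partial>(lborel :: 'a measure))"
    proof (rule nn_integral_dominated_convergence[where w="\<lambda>x. ennreal (2 * ?m) * indicator ?K x"])
      show "(\<integral>\<^sup>+x. ennreal (2 * ?m) * indicator ?K x \<partial>lborel) < \<infinity>"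
        using emeasure_lborel_cball_finite[of "0::'a" R] by (simp add: nn_integral_cmult_indicator ennreal_mult_less_top)
      show "AE x in lborel. (\<lambda>i. ennreal \<bar>Av i j x - \<alpha> j x\<bar> * indicator ?K x) \<longlonglongrightarrow> 0"
      proof (rule AE_I2)
        fix x
        have "(\<lambda>i. \<bar>Av i j x - \<alpha> j x\<bar>) \<longlonglongrightarrow> 0" using LIM_zero[OF Av_lim[of j x]] by (rule tendsto_rabs_zero)
        then have "(\<lambda>i. ennreal \<bar>Av i j x - \<alpha> j x\<bar>) \<longlonglongrightarrow> 0" by (simp add: ennreal_tendsto_0_iff)
        then show "(\<lambda>i. ennreal \<bar>Av i j x - \<alpha> j x\<bar> * indicator ?K x) \<longlonglongrightarrow> 0"
          by (cases "x \<in> ?K") auto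
      qed
      show "AE x in lborel. ennreal \<bar>Av i j x - \<alpha> j x\<bar> * indicator ?K x \<le> ennreal (2 * ?m) * indicator ?K x" for i
      proof (intro AE_I2 mult_right_mono ennreal_leI)
        fix x show "\<bar>Av i j x - \<alpha> j x\<bar> \<le> 2 * ?m" using Av_bound[of i j x] \<alpha>_bound[of j x] by linarith
      qed simp
    qed measurable
    then have "\<forall>\<^sub>F i in sequentially. (\<integral>\<^sup>+x. ennreal \<bar>Av i j x - \<alpha> j x\<bar> * indicator ?K x \<partial>lborel) < ennreal (e / 4)"
      using e by (intro order_tendstoD) auto
    then obtain N where N: "\<And>i. i \<ge> N \<Longrightarrow> (\<integral>\<^sup>+x. ennreal \<bar>Av i j x - \<alpha> j x\<bar> * indicator ?K x \<partial>lborel) < ennreal (e / 4)"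
      by (auto simp: eventually_sequentially)
    have half: "(\<integral>\<^sup>+x. ennreal \<bar>w i x - \<alpha> j x\<bar> * indicator ?K x \<partial>lborel) \<le> ennreal (e / 2)" if i: "i \<ge> N" for i
    proof -
      have "(\<integral>\<^sup>+x. ennreal \<bar>w i x - \<alpha> j x\<bar> * indicator ?K x \<partial>lborel) \<le>
          (\<integral>\<^sup>+x. ennreal \<bar>w i x - Av i j x\<bar> + ennreal \<bar>Av i j x - \<alpha> j x\<bar> * indicator ?K x \<partial>lborel)"
      proof (rule nn_integral_mono)
        fix x
        have "ennreal \<bar>w i x - \<alpha> j x\<bar> \<le> ennreal \<bar>w i x - Av i j x\<bar> + ennreal \<bar>Av i j x - \<alpha> j x\<bar>"
          by (rule tri)
        then show "ennreal \<bar>w i x - \<alpha> j x\<bar> * indicator ?K x \<le> ennreal \<bar>w i x - Av i j x\<bar> + ennreal \<bar>Av i j x - \<alpha> j x\<bar> * indicator ?K x"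
          by (cases "x \<in> ?K") auto
      qed
      also have "\<dots> = (\<integral>\<^sup>+x. ennreal \<bar>w i x - Av i j x\<bar> \<partial>lborel) + (\<integral>\<^sup>+x. ennreal \<bar>Av i j x - \<alpha> j x\<bar> * indicator ?K x \<partial>lborel)"
        by (rule nn_integral_add) measurable
      also have "\<dots> \<le> ennreal (\<delta> j) + ennreal (e / 4)"
        by (intro add_mono approx j less_imp_le[OF N[OF i]])
      also have "\<dots> = ennreal (\<delta> j + e / 4)" using \<delta>_nonneg e by (simp add: ennreal_plus)
      also have "\<dots> \<le> ennreal (e / 2)" using j by (intro ennreal_leI) simp
      finally show ?thesis .
    qed
    have "(\<integral>\<^sup>+x. ennreal \<bar>w i x - w l x\<bar> \<partial>lborel) \<le> ennreal e" if il: "i \<ge> N" "l \<ge> N" for i l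
    proof -
      have "(\<integral>\<^sup>+x. ennreal \<bar>w i x - w l x\<bar> \<partial>lborel) \<le>
        (\<integral>\<^sup>+x. ennreal \<bar>w i x - \<alpha> j x\<bar> * indicator ?K x + ennreal \<bar>w l x - \<alpha> j x\<bar> * indicator ?K x \<partial>lborel)"
      proof (rule nn_integral_mono)
        fix x
        have "ennreal \<bar>w i x - w l x\<bar> \<le> ennreal \<bar>w i x - \<alpha> j x\<bar> + ennreal \<bar>w l x - \<alpha> j x\<bar>"
          using tri[of "w i x" "w l x" "\<alpha> j x"] by (simp add: abs_minus_commute)
        moreover have "w i x - w l x = 0" if "x \<notin> ?K" using that u0[of x] by (simp add: w_def not_le)
        ultimately show "ennreal \<bar>w i x - w l x\<bar> \<le> ennreal \<bar>w i x - \<alpha> j x\<bar> * indicator ?K x + ennreal \<bar>w l x - \<alpha> j x\<bar> * indicator ?K x"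
          by (cases "x \<in> ?K") auto
      qed
      also have "\<dots> = (\<integral>\<^sup>+x. ennreal \<bar>w i x - \<alpha> j x\<bar> * indicator ?K x \<partial>lborel) + (\<integral>\<^sup>+x. ennreal \<bar>w l x - \<alpha> j x\<bar> * indicator ?K x \<partial>lborel)"
        by (rule nn_integral_add) measurable
      also have "\<dots> \<le> ennreal (e / 2) + ennreal (e / 2)" by (intro add_mono half il)
      also have "\<dots> = ennreal e" using e by (subst ennreal_plus[symmetric]) auto
      finally show ?thesis .
    qed
    then show ?thesis by blast
  qed
  obtain q v where q: "strict_mono q" "v \<in> borel_measurable lborel" "AE x in lborel. (\<lambda>m. w (q m) x) \<longlonglongrightarrow> v x"
  proof (rule L1_Cauchy_AE_subsequence[of w lborel])
    show "w i \<in> borel_measurable lborel" for i by simp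
  qed (use Cauchy in blast)+
  show ?thesis
    by (rule that[of "r0 \<circ> q" v]) (use q r0(1) in \<open>auto simp: w_def comp_def strict_mono_def\<close>)
qed

section \<open>Existence of minimizers\<close>

lemma frac_space_0_eq:
  fixes \<Omega> :: "'a::euclidean_space set"
  assumes "young_function G" "open \<Omega>" "bounded \<Omega>" "\<Omega> \<noteq> {}" "lipschitz_boundary \<Omega>" "0 < s" "s < 1"
  shows "u \<in> frac_space_0 s G \<Omega> \<longleftrightarrow> u \<in> frac_space s G \<Omega> \<and> (AE x in lebesgue. x \<notin> \<Omega> \<longrightarrow> u x = 0)"
proof
  assume u: "u \<in> frac_space_0 s G \<Omega>"
  then have "u \<in> frac_space s G \<Omega>"
    using frac_space_0_subset by blast
  then show "u \<in> frac_space s G \<Omega> \<and> (AE x in lebesgue. x \<notin> \<Omega> \<longrightarrow> u x = 0)"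
    using frac_space_0_vanishing[OF assms(1-4,6) u] by simp
next
  assume "u \<in> frac_space s G \<Omega> \<and> (AE x in lebesgue. x \<notin> \<Omega> \<longrightarrow> u x = 0)"
  then show "u \<in> frac_space_0 s G \<Omega>"
    using vanishing_in_frac_space_0[OF assms(1-3,5-7)] by blast
qed

text \<open>Intermediate values in the amplitude \<open>c\<close>: the modular is continuous in
  \<open>c\<close> by domination, zero at zero, and exceeds \<open>\<alpha>\<close> for large
  \<open>c\<close> by superlinear growth.\<close>

lemma ex_modular_scaled_cutoff:
  fixes \<Omega> :: "'a::euclidean_space set"
  assumes G: "young_function G" and \<Omega>: "open \<Omega>" "bounded \<Omega>" "\<Omega> \<noteq> {}" and \<alpha>: "\<alpha> > 0"
  obtains k c where "k > 0" "c \<ge> 0" "orlicz_modular G lborel (\<lambda>x. c * cutoff \<Omega> k x) = ennreal \<alpha>"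
proof -
  note O = young_function_orlicz[OF G]
  note [measurable] = borel_measurable_orlicz_function[OF O]
  have \<Omega>b [measurable]: "\<Omega> \<in> sets borel" using \<Omega> by simp
  have fin: "emeasure lborel \<Omega> < \<infinity>" using \<Omega>(2) by (rule emeasure_bounded_borel_finite)
  obtain a where a: "a \<in> \<Omega>" using \<Omega>(3) by blast
  define d where "d = bdist \<Omega> a"
  have d: "d > 0" using a bdist_pos[OF \<Omega>(1,2)] by (simp add: d_def)
  \<comment> \<open>Points within \<open>d / 2\<close> of \<open>a\<close> have depth at least
    \<open>d / 2 = 2 / k\<close>, where the cutoff equals 1.\<close>
  define k where "k = 4 / d"
  have k: "k > 0" using d by (simp add: k_def)
  let ?\<psi> = "cutoff \<Omega> k"
  have one: "?\<psi> x = 1" if "x \<in> ball a (d / 2)" for x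
  proof (rule cutoff_eq_1[OF k])
    have "d - bdist \<Omega> x \<le> dist a x"
      using infdist_triangle_abs[of a "- \<Omega>" x] by (simp add: d_def)
    then show "2 / k \<le> bdist \<Omega> x" using that d by (simp add: k_def)
  qed
  define h where "h c = (\<integral>x. G \<bar>c * ?\<psi> x\<bar> \<partial>lborel)" for c :: real
  have bound: "G \<bar>c * ?\<psi> x\<bar> \<le> G C * indicator \<Omega> x" if "0 \<le> c" "c \<le> C" for c C x
  proof (cases "x \<in> \<Omega>")
    case True
    have "\<bar>c * ?\<psi> x\<bar> \<le> C"
      using that cutoff_range[of \<Omega> k x] mult_left_le[of "?\<psi> x" c] by (simp add: abs_mult)
    then show ?thesis using True by (simp add: orlicz_function_mono[OF O])
  qed (simp add: cutoff_outside[OF k] orlicz_function_zero[OF O])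
  have int\<Omega>: "integrable lborel (\<lambda>x. C * indicator \<Omega> x :: real)" for C
    using fin by (intro integrable_mult_right) (simp add: integrable_indicator_iff)
  have int: "integrable lborel (\<lambda>x. G \<bar>c * ?\<psi> x\<bar>)" if "0 \<le> c" for c
    by (rule Bochner_Integration.integrable_bound[OF int\<Omega>[of "G c"]])
       (use bound[OF that order_refl] orlicz_function_nonneg[OF O] that in auto)
  have J: "orlicz_modular G lborel (\<lambda>x. c * ?\<psi> x) = ennreal (h c)" if "0 \<le> c" for c
    unfolding orlicz_modular_def h_def
    by (rule nn_integral_eq_integral[OF int[OF that]]) (intro AE_I2 orlicz_function_nonneg[OF O] abs_ge_zero)
  have cont: "continuous_on {0..} h"
    unfolding continuous_on_sequentially
  proof (intro allI ballI impI)
    fix x :: "nat \<Rightarrow> real" and c assume x: "c \<in> {0..}" "(\<forall>n. x n \<in> {0..}) \<and> x \<longlonglongrightarrow> c"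
    have "Bseq x" using x by (auto intro: convergent_imp_Bseq convergentI)
    then obtain C where C: "C > 0" "\<And>n. norm (x n) \<le> C" by (auto elim: BseqE)
    have "(\<lambda>n. \<integral>y. G \<bar>x n * ?\<psi> y\<bar> \<partial>lborel) \<longlonglongrightarrow> (\<integral>y. G \<bar>c * ?\<psi> y\<bar> \<partial>lborel)"
    proof (rule integral_dominated_convergence[OF _ _ int\<Omega>[of "G C"]])
      show "AE y in lborel. (\<lambda>n. G \<bar>x n * ?\<psi> y\<bar>) \<longlonglongrightarrow> G \<bar>c * ?\<psi> y\<bar>"
        using x by (intro AE_I2 young_function_tendsto[OF G] tendsto_mult tendsto_const) auto
      show "AE y in lborel. norm (G \<bar>x n * ?\<psi> y\<bar>) \<le> G C * indicator \<Omega> y" for n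
        using bound[of "x n" C] C(2)[of n] x orlicz_function_nonneg[OF O] by (intro AE_I2) auto
    qed measurable
    then show "(h \<circ> x) \<longlonglongrightarrow> h c" by (simp add: h_def comp_def)
  qed
  let ?b = "measure lborel (ball a (d / 2))"
  have b: "?b > 0" using d by (simp add: content_ball)
  obtain T where T: "T > 0" "\<And>t. t \<ge> T \<Longrightarrow> (\<alpha> / ?b) * t \<le> G t"
    using young_function_superlinear[OF G] by metis
  define C where "C = max T 1"
  have C: "C \<ge> 1" "\<alpha> / ?b \<le> G C"
  proof -
    have "(\<alpha> / ?b) * 1 \<le> (\<alpha> / ?b) * C" using \<alpha> b by (intro mult_left_mono) (auto simp: C_def)
    also have "\<dots> \<le> G C" by (rule T(2)) (simp add: C_def)
    finally show "\<alpha> / ?b \<le> G C" by simp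
  qed (simp add: C_def)
  have "h 0 = 0" by (simp add: h_def orlicz_function_zero[OF O])
  moreover have "\<alpha> \<le> h C"
  proof -
    have "\<alpha> \<le> G C * ?b" using C(2) b by (simp add: pos_divide_le_eq)
    also have "\<dots> = (\<integral>x. G C * indicator (ball a (d / 2)) x \<partial>lborel)" by simp
    also have "\<dots> \<le> h C"
      unfolding h_def
    proof (rule integral_mono[OF _ int])
      show "integrable lborel (\<lambda>x. G C * indicator (ball a (d / 2)) x)"
        using emeasure_bounded_borel_finite[OF bounded_ball[of a "d/2"]]
        by (intro integrable_mult_right) (simp add: integrable_indicator_iff)
      show "G C * indicator (ball a (d / 2)) x \<le> G \<bar>C * ?\<psi> x\<bar>" for x
        using one[of x] C(1) orlicz_function_nonneg[OF O] by (cases "x \<in> ball a (d / 2)") auto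
    qed (use C in simp)
    finally show ?thesis .
  qed
  ultimately obtain c where c: "0 \<le> c" "c \<le> C" "h c = \<alpha>"
    using IVT'[of h 0 \<alpha> C] \<alpha> C continuous_on_subset[OF cont, of "{0..C}"] by auto
  show ?thesis using that[OF k c(1)] J[OF c(1)] c(3) by simp
qed

section \<open>Minimizing sequences and the constraint\<close>

lemma frac_quot_abs_le: "\<bar>frac_quot s (\<lambda>x. \<bar>u x\<bar>) z\<bar> \<le> \<bar>frac_quot s u z\<bar>"
proof (cases z)
  case (Pair x y)
  have "\<bar>\<bar>u x\<bar> - \<bar>u y\<bar>\<bar> / norm (x - y) powr s \<le> \<bar>u x - u y\<bar> / norm (x - y) powr s"
    by (intro divide_right_mono) auto
  then show ?thesis by (simp add: Pair frac_quot_def abs_divide)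
qed

text \<open>Prepares a minimizing sequence for compactness. Taking the absolute value does not
  increase differences. Membership of \<open>w\<close> in \<open>frac_space_0\<close> is not
  claimed, because admissibility is established for the limit alone.\<close>

lemma nonneg_borel_competitor:
  fixes \<Omega> :: "'a::euclidean_space set"
  assumes G: "young_function G" and \<Omega>: "open \<Omega>" "bounded \<Omega>" "\<Omega> \<noteq> {}" and s: "0 < s"
    and u: "u \<in> frac_space_0 s G \<Omega>"
  obtains w where "w \<in> borel_measurable borel" "\<And>x. 0 \<le> w x" "\<And>x. x \<notin> \<Omega> \<Longrightarrow> w x = 0"
    "orlicz_modular G lborel w = energy_J G \<Omega> u" "energy_F s G w \<le> energy_F s G u"
proof -
  note O = young_function_orlicz[OF G]
  have \<Omega>b [measurable]: "\<Omega> \<in> sets borel" and \<Omega>l: "\<Omega> \<in> sets lebesgue" using \<Omega> by auto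
  have u0: "AE x in lebesgue. x \<notin> \<Omega> \<longrightarrow> u x = 0" by (rule frac_space_0_vanishing[OF G \<Omega> s u])
  have "u \<in> frac_space s G \<Omega>"
    using u frac_space_0_subset by blast
  then have um: "u \<in> borel_measurable lebesgue" by (simp add: frac_space_def)
  obtain v where v [measurable]: "v \<in> borel_measurable borel" and uv: "AE x in lebesgue. u x = v x"
    using borel_representative[OF um] by blast
  define w where "w x = \<bar>v x * indicator \<Omega> x\<bar>" for x
  have uw: "AE x in lebesgue. w x = \<bar>u x\<bar>"
    using uv u0 by eventually_elim (auto simp: w_def indicator_def)
  show ?thesis
  proof (rule that[of w])
    show "w \<in> borel_measurable borel" unfolding w_def by measurable
    show "0 \<le> w x" for x by (simp add: w_def)
    show w0: "w x = 0" if "x \<notin> \<Omega>" for x using that by (simp add: w_def)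
    have "orlicz_modular G lborel w = orlicz_modular G (lebesgue_on \<Omega>) w"
      using orlicz_modular_lebesgue_on[where \<Phi>=G and u=w, OF \<Omega>b orlicz_function_zero[OF O]] w0 by simp
    also have "\<dots> = orlicz_modular G (lebesgue_on \<Omega>) u"
      by (rule orlicz_modular_cong, use AE_lebesgue_on[OF uw \<Omega>l] in eventually_elim) simp
    finally show "orlicz_modular G lborel w = energy_J G \<Omega> u" by (simp add: energy_J_def)
    have "energy_F s G w = orlicz_modular G frac_measure (frac_quot s (\<lambda>x. \<bar>u x\<bar>))"
      unfolding energy_F_def
      by (rule orlicz_modular_cong, use frac_quot_cong_AE[OF uw, of s] in eventually_elim) simp
    also have "\<dots> \<le> energy_F s G u"
      unfolding energy_F_def by (intro orlicz_modular_mono[OF O] AE_I2 frac_quot_abs_le)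
    finally show "energy_F s G w \<le> energy_F s G u" .
  qed
qed

text \<open>Fatou's lemma gives one inequality. The other says that no mass escapes, and rests on
  uniform integrability of \<open>G \<bar>w k x\<bar>\<close> at scale one, which the energy bound
  supplies.\<close>

lemma modular_limit_eq:
  fixes w :: "nat \<Rightarrow> 'a::euclidean_space \<Rightarrow> real"
  assumes G: "young_function G" and \<Omega>: "\<Omega> \<in> sets borel" "emeasure lborel \<Omega> < \<infinity>" and s: "0 < s" and \<alpha>: "\<alpha> \<ge> 0"
    and w [measurable]: "\<And>k. w k \<in> borel_measurable borel" and v [measurable]: "v \<in> borel_measurable borel"
    and w0: "\<And>k x. x \<notin> \<Omega> \<Longrightarrow> w k x = 0"
    and J: "\<And>k. orlicz_modular G lborel (w k) = ennreal \<alpha>" and F: "\<And>k. energy_F s G (w k) \<le> ennreal C"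
    and lim: "AE x in lborel. (\<lambda>k. w k x) \<longlonglongrightarrow> v x"
  shows "energy_J G \<Omega> v = ennreal \<alpha>"
proof (rule antisym)
  note O = young_function_orlicz[OF G]
  note [measurable] = borel_measurable_orlicz_function[OF O] \<Omega>(1)
  have Jv: "energy_J G \<Omega> v = (\<integral>\<^sup>+x. ennreal (G \<bar>v x\<bar>) * indicator \<Omega> x \<partial>lborel)"
    unfolding energy_J_def orlicz_modular_def by (rule nn_integral_lebesgue_on_lborel[OF \<Omega>(1)])
  have "energy_J G \<Omega> v \<le> orlicz_modular G lborel v"
    unfolding Jv orlicz_modular_def by (intro nn_integral_mono) (auto simp: indicator_def)
  also have "\<dots> \<le> ennreal \<alpha>"
    by (rule orlicz_modular_limit_le[OF G _ lim]) (auto simp: J)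
  finally show "energy_J G \<Omega> v \<le> ennreal \<alpha>" .
  have "limsup (\<lambda>k. \<integral>\<^sup>+x. ennreal (G \<bar>w k x\<bar>) * indicator \<Omega> x \<partial>lborel) \<le> (\<integral>\<^sup>+x. ennreal (G \<bar>v x\<bar>) * indicator \<Omega> x \<partial>lborel)"
  proof (rule limsup_nn_integral_le_uniformly_integrable[OF _ _ _ \<Omega>(2)])
    show "AE x in lborel. (\<lambda>k. ennreal (G \<bar>w k x\<bar>)) \<longlonglongrightarrow> ennreal (G \<bar>v x\<bar>)"
      using lim by eventually_elim (intro tendsto_ennrealI young_function_tendsto[OF G])
    fix e :: real assume e: "e > 0"
    obtain T where T: "T \<ge> 0" "\<And>u :: 'a \<Rightarrow> real. u \<in> borel_measurable borel \<Longrightarrow> orlicz_modular G lborel u \<le> ennreal \<alpha> \<Longrightarrow>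
      orlicz_modular G frac_measure (frac_quot s u) \<le> ennreal \<bar>C\<bar> \<Longrightarrow>
      (\<integral>\<^sup>+x. ennreal (G \<bar>u x\<bar>) * indicator {x. \<bar>u x\<bar> > T} x \<partial>lborel) \<le> ennreal e"
      by (rule frac_modular_uniform_integrability[OF G s \<alpha> abs_ge_zero[of C] e, where 'a='a]) blast
    show "\<exists>m. \<forall>k. (\<integral>\<^sup>+x. (ennreal (G \<bar>w k x\<bar>) - ennreal m) * indicator \<Omega> x \<partial>lborel) \<le> ennreal e"
    proof (intro exI allI)
      fix k
      \<comment> \<open>The level is \<open>G T\<close>: where
        \<open>\<bar>w k x\<bar> \<le> T\<close>, monotonicity makes the truncated difference
        zero.\<close>
      have "(\<integral>\<^sup>+x. (ennreal (G \<bar>w k x\<bar>) - ennreal (G T)) * indicator \<Omega> x \<partial>lborel) \<le>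
          (\<integral>\<^sup>+x. ennreal (G \<bar>w k x\<bar>) * indicator {x. \<bar>w k x\<bar> > T} x \<partial>lborel)"
      proof (rule nn_integral_mono)
        fix x
        show "(ennreal (G \<bar>w k x\<bar>) - ennreal (G T)) * indicator \<Omega> x \<le> ennreal (G \<bar>w k x\<bar>) * indicator {x. \<bar>w k x\<bar> > T} x"
        proof (cases "\<bar>w k x\<bar> > T")
          case True
          have "ennreal (G \<bar>w k x\<bar>) - ennreal (G T) \<le> ennreal (G \<bar>w k x\<bar>)" by (rule diff_le_self_ennreal)
          then show ?thesis using True by (auto simp: indicator_def)
        next
          case False
          then have "G \<bar>w k x\<bar> \<le> G T" by (intro orlicz_function_mono[OF O]) auto
          then have "ennreal (G \<bar>w k x\<bar>) - ennreal (G T) = 0" by (simp add: ennreal_minus orlicz_function_nonneg[OF O T(1)] ennreal_neg)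
          then show ?thesis by simp
        qed
      qed
      also have "\<dots> \<le> ennreal e"
        by (rule T(2)[OF w]) (use J[of k] order_trans[OF F[of k] ennreal_leI[OF abs_ge_self]] in \<open>auto simp: energy_F_def\<close>)
      finally show "(\<integral>\<^sup>+x. (ennreal (G \<bar>w k x\<bar>) - ennreal (G T)) * indicator \<Omega> x \<partial>lborel) \<le> ennreal e" .
    qed
  qed measurable
  moreover have "(\<integral>\<^sup>+x. ennreal (G \<bar>w k x\<bar>) * indicator \<Omega> x \<partial>lborel) = ennreal \<alpha>" for k
  proof -
    have "(\<integral>\<^sup>+x. ennreal (G \<bar>w k x\<bar>) * indicator \<Omega> x \<partial>lborel) = orlicz_modular G lborel (w k)"
      unfolding orlicz_modular_def
      by (intro nn_integral_cong) (auto simp: indicator_def w0 orlicz_function_zero[OF O])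
    then show ?thesis using J by simp
  qed
  ultimately show "ennreal \<alpha> \<le> energy_J G \<Omega> v" by (simp add: Jv Limsup_const)
qed

theorem theorem1p1:
  fixes \<Omega> :: "'a::euclidean_space set" and s :: real and G :: "real \<Rightarrow> real"
  assumes "open \<Omega>" and "connected \<Omega>" and "\<Omega> \<noteq> {}" and "bounded \<Omega>"
    and "lipschitz_boundary \<Omega>"
    and "0 < s" and "s < 1"
    and "young_function G"
    and "(\<integral>\<^sup>+ t \<in> {1..}. ennreal ((t / G t) powr (s / (real DIM('a) - s))) \<partial>lborel) = \<infinity>"
    and "(\<integral>\<^sup>+ t \<in> {0..1}. ennreal ((t / G t) powr (s / (real DIM('a) - s))) \<partial>lborel) < \<infinity>"
  shows "\<forall>\<alpha>::real. \<alpha> > 0 \<longrightarrow>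
    (\<exists>u\<^sub>\<alpha> \<in> frac_space_0 s G \<Omega>. one_signed \<Omega> u\<^sub>\<alpha> \<and> energy_J G \<Omega> u\<^sub>\<alpha> = ennreal \<alpha> \<and>
      (\<forall>u \<in> frac_space_0 s G \<Omega>.
         energy_J G \<Omega> u = ennreal \<alpha> \<longrightarrow> energy_F s G u\<^sub>\<alpha> \<le> energy_F s G u))"
proof (intro allI impI)
  fix \<alpha> :: real assume \<alpha>: "\<alpha> > 0"
  note \<Omega> = assms(1,4,3) and s = assms(6,7) and G = assms(8)
  note O = young_function_orlicz[OF G]
  note V = frac_space_0_eq[OF G \<Omega> assms(5) s]
  have \<Omega>b: "\<Omega> \<in> sets borel" and \<Omega>l: "\<Omega> \<in> sets lebesgue" using \<Omega> by auto
  have fin: "emeasure lborel \<Omega> < \<infinity>" using \<Omega>(2) by (rule emeasure_bounded_borel_finite)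
  \<comment> \<open>Finiteness of both functionals at scale one puts \<open>u\<close> in the space,
    and the description of the closure does the rest. Used for the first competitor and for the
    limit.\<close>
  have admissible: "u \<in> frac_space_0 s G \<Omega>"
    if "u \<in> borel_measurable borel" "AE x in lebesgue. x \<notin> \<Omega> \<longrightarrow> u x = 0"
      "energy_J G \<Omega> u < \<infinity>" "energy_F s G u < \<infinity>" for u
    unfolding V frac_space_iff[OF O]
  proof (intro conjI)
    show "u \<in> borel_measurable lebesgue" using that(1) by (auto intro!: measurable_completion)
    show "\<exists>L>0. orlicz_modular G (lebesgue_on \<Omega>) (\<lambda>x. u x / L) < \<infinity>"
      by (rule exI[of _ 1]) (use that(3) in \<open>simp add: energy_J_def\<close>)
    show "\<exists>L>0. orlicz_modular G frac_measure (\<lambda>z. frac_quot s u z / L) < \<infinity>"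
      by (rule exI[of _ 1]) (use that(4) in \<open>simp add: energy_F_def\<close>)
  qed (use that(2) in simp)
  define S where "S = {u \<in> frac_space_0 s G \<Omega>. energy_J G \<Omega> u = ennreal \<alpha>}"
  define m where "m = (INF u\<in>S. energy_F s G u)"
  \<comment> \<open>A competitor of finite energy makes the infimum finite. Both the strict
    inequality \<open>m < m + ennreal (1 / real (Suc k))\<close> and the uniform energy bound depend
    on it.\<close>
  obtain u1 where u1: "u1 \<in> S" "energy_F s G u1 < \<infinity>"
  proof -
    obtain k c where k: "k > 0" and c: "c \<ge> 0" and J: "orlicz_modular G lborel (\<lambda>x. c * cutoff \<Omega> k x) = ennreal \<alpha>"
      using ex_modular_scaled_cutoff[OF G \<Omega> \<alpha>] by blast
    let ?u = "\<lambda>x. c * cutoff \<Omega> k x"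
    have F: "energy_F s G ?u < \<infinity>"
      unfolding energy_F_def by (rule cutoff_frac_modular_finite[OF \<Omega>(1,2) s O k c])
    have J': "energy_J G \<Omega> ?u = ennreal \<alpha>"
      unfolding energy_J_def J[symmetric]
      by (rule orlicz_modular_lebesgue_on[where \<Phi>=G and u="?u", OF \<Omega>b orlicz_function_zero[OF O]]) (simp add: cutoff_outside[OF k])
    have "?u \<in> frac_space_0 s G \<Omega>"
      by (rule admissible) (use F J' in \<open>auto simp: cutoff_outside[OF k]\<close>)
    then show ?thesis using that[of ?u] F J' by (simp add: S_def)
  qed
  have "m \<le> energy_F s G u1" unfolding m_def by (rule INF_lower[OF u1(1)])
  then have m: "m < \<infinity>" using u1(2) by simp
  have "\<exists>u\<in>S. energy_F s G u \<le> m + ennreal (1 / real (Suc k))" for k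
  proof -
    have "m < m + ennreal (1 / real (Suc k))"
      using m ennreal_add_left_cancel_less[of m 0 "ennreal (1 / real (Suc k))"] by (simp add: less_top)
    then have "\<exists>u\<in>S. energy_F s G u < m + ennreal (1 / real (Suc k))"
      unfolding m_def by (simp only: INF_less_iff)
    then show ?thesis by (auto intro: less_imp_le)
  qed
  then have "\<exists>w. w \<in> borel_measurable borel \<and> (\<forall>x. 0 \<le> w x) \<and> (\<forall>x. x \<notin> \<Omega> \<longrightarrow> w x = 0) \<and>
      orlicz_modular G lborel w = ennreal \<alpha> \<and> energy_F s G w \<le> m + ennreal (1 / real (Suc k))" for k
  proof -
    obtain u where u: "u \<in> frac_space_0 s G \<Omega>" "energy_J G \<Omega> u = ennreal \<alpha>" "energy_F s G u \<le> m + ennreal (1 / real (Suc k))"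
      using \<open>\<And>k. \<exists>u\<in>S. energy_F s G u \<le> m + ennreal (1 / real (Suc k))\<close>[of k] by (auto simp: S_def)
    obtain w where w: "w \<in> borel_measurable borel" "\<And>x. 0 \<le> w x" "\<And>x. x \<notin> \<Omega> \<Longrightarrow> w x = 0"
      "orlicz_modular G lborel w = energy_J G \<Omega> u" "energy_F s G w \<le> energy_F s G u"
      using nonneg_borel_competitor[OF G \<Omega> s(1) u(1)] by blast
    show ?thesis using w u(2) order_trans[OF w(5) u(3)] by (intro exI[of _ w]) auto
  qed
  then obtain w where w: "\<And>k. w k \<in> borel_measurable borel" "\<And>k x. 0 \<le> w k x" "\<And>k x. x \<notin> \<Omega> \<Longrightarrow> w k x = 0"
    "\<And>k. orlicz_modular G lborel (w k) = ennreal \<alpha>" "\<And>k. energy_F s G (w k) \<le> m + ennreal (1 / real (Suc k))"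
    by metis
  obtain C where C: "m + 1 = ennreal C" "C \<ge> 0"
    using m by (cases "m + 1") (auto simp: less_top)
  have wC: "energy_F s G (w k) \<le> ennreal C" for k
  proof -
    have "ennreal (1 / real (Suc k)) \<le> 1" by simp
    then show ?thesis using order_trans[OF w(5)[of k] add_left_mono] unfolding C(1)[symmetric] by blast
  qed
  obtain R where R: "R > 0" "\<And>x. x \<in> \<Omega> \<Longrightarrow> norm x \<le> R"
    using \<Omega>(2) unfolding bounded_pos by blast
  have wR: "w k x = 0" if "norm x > R" for k x using w(3)[of x k] R(2)[of x] that by force
  obtain B where B: "B \<ge> 0" "\<And>t. t \<ge> 0 \<Longrightarrow> 1 * t \<le> G t + B"
    using young_function_affine_bound[OF G zero_le_one] by metis
  \<comment> \<open>The constraint itself bounds the sequence in the mean, through the affine bound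
    on the domain of finite measure.\<close>
  define M where "M = \<alpha> + B * measure lborel \<Omega>"
  have M: "M \<ge> 0" using \<alpha> B(1) by (simp add: M_def)
  have wM: "(\<integral>\<^sup>+x. ennreal \<bar>w k x\<bar> \<partial>lborel) \<le> ennreal M" for k
  proof -
    have "(\<lambda>x. ennreal (G \<bar>w k x\<bar>)) \<in> borel_measurable lborel"
      using borel_measurable_orlicz_function[OF O w(1)[of k]] by measurable
    then have "(\<integral>\<^sup>+x. ennreal (G \<bar>w k x\<bar>) + ennreal B * indicator \<Omega> x \<partial>lborel) = ennreal \<alpha> + ennreal B * emeasure lborel \<Omega>"
      using \<Omega>b w(4)[of k] by (simp add: nn_integral_add nn_integral_cmult_indicator orlicz_modular_def)
    also have "\<dots> = ennreal M"
      using \<alpha> B(1) fin by (simp add: M_def emeasure_eq_ennreal_measure less_top ennreal_plus ennreal_mult)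
    finally have "(\<integral>\<^sup>+x. ennreal (G \<bar>w k x\<bar>) + ennreal B * indicator \<Omega> x \<partial>lborel) = ennreal M" .
    moreover have "ennreal \<bar>w k x\<bar> \<le> ennreal (G \<bar>w k x\<bar>) + ennreal B * indicator \<Omega> x" for x
    proof (cases "x \<in> \<Omega>")
      case True
      have "ennreal \<bar>w k x\<bar> \<le> ennreal (G \<bar>w k x\<bar> + B)" using B(2)[of "\<bar>w k x\<bar>"] by (intro ennreal_leI) simp
      then show ?thesis using True B(1) orlicz_function_nonneg[OF O] by (simp add: ennreal_plus)
    qed (simp add: w(3))
    ultimately show ?thesis using nn_integral_mono[of lborel "\<lambda>x. ennreal \<bar>w k x\<bar>" "\<lambda>x. ennreal (G \<bar>w k x\<bar>) + ennreal B * indicator \<Omega> x"] by simp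
  qed
  obtain r v where r: "strict_mono r" and v: "v \<in> borel_measurable borel" and lim: "AE x in lborel. (\<lambda>k. w (r k) x) \<longlonglongrightarrow> v x"
    by (rule frac_modular_compactness[OF G s(1) less_imp_le[OF R(1)] w(1) wR wC[unfolded energy_F_def] M wM])
  have J: "energy_J G \<Omega> v = ennreal \<alpha>"
    by (rule modular_limit_eq[OF G \<Omega>b fin s(1) less_imp_le[OF \<alpha>] w(1) v w(3,4) wC lim])
  have F: "energy_F s G v \<le> m"
  proof -
    have "energy_F s G v \<le> liminf (\<lambda>k. energy_F s G (w (r k)))"
      unfolding energy_F_def
      by (rule orlicz_modular_Fatou[OF G]) (use w(1) lim in \<open>auto intro!: frac_quot_measurable frac_quot_tendsto measurable_completion AE_completion\<close>)
    also have "\<dots> \<le> liminf (\<lambda>k. m + ennreal (1 / real (Suc k)))"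
    proof (intro Liminf_mono always_eventually allI)
      fix k
      \<comment> \<open>A strictly increasing index sequence satisfies \<open>k \<le> r k\<close>,
        so the subsequence is at least as close to the infimum.\<close>
      have "1 / real (Suc (r k)) \<le> 1 / real (Suc k)"
        using seq_suble[OF r, of k] by (intro divide_left_mono) auto
      then show "energy_F s G (w (r k)) \<le> m + ennreal (1 / real (Suc k))"
        using order_trans[OF w(5)[of "r k"] add_left_mono[OF ennreal_leI]] by blast
    qed
    also have "\<dots> = m"
    proof -
      have "(\<lambda>k. ennreal (1 / real (Suc k))) \<longlonglongrightarrow> ennreal 0"
        by (intro tendsto_ennrealI LIMSEQ_Suc[OF lim_const_over_n])
      then have "(\<lambda>k. m + ennreal (1 / real (Suc k))) \<longlonglongrightarrow> m + ennreal 0"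
        by (intro tendsto_add tendsto_const)
      then show ?thesis by (simp add: lim_imp_Liminf)
    qed
    finally show ?thesis .
  qed
  have nonneg: "AE x in lebesgue. 0 \<le> v x"
    using lim by (intro AE_completion, eventually_elim) (auto intro: LIMSEQ_le_const w(2))
  have zero: "AE x in lebesgue. x \<notin> \<Omega> \<longrightarrow> v x = 0"
  proof (intro AE_completion, use lim in eventually_elim, rule impI)
    fix x assume "(\<lambda>k. w (r k) x) \<longlonglongrightarrow> v x" "x \<notin> \<Omega>"
    then show "v x = 0" using LIMSEQ_unique[OF _ tendsto_const] by (simp add: w(3))
  qed
  have "v \<in> frac_space_0 s G \<Omega>"
    by (rule admissible[OF v zero]) (use J F m in \<open>auto intro: le_less_trans\<close>)
  moreover have "one_signed \<Omega> v"
    using AE_lebesgue_on[OF nonneg \<Omega>l] by (simp add: one_signed_def)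
  moreover have "energy_F s G v \<le> energy_F s G u" if "u \<in> frac_space_0 s G \<Omega>" "energy_J G \<Omega> u = ennreal \<alpha>" for u
    by (rule order_trans[OF F]) (use that in \<open>auto simp: m_def S_def intro: INF_lower\<close>)
  ultimately show "\<exists>u\<^sub>\<alpha> \<in> frac_space_0 s G \<Omega>. one_signed \<Omega> u\<^sub>\<alpha> \<and> energy_J G \<Omega> u\<^sub>\<alpha> = ennreal \<alpha> \<and>
      (\<forall>u \<in> frac_space_0 s G \<Omega>. energy_J G \<Omega> u = ennreal \<alpha> \<longrightarrow> energy_F s G u\<^sub>\<alpha> \<le> energy_F s G u)"
    using J by blast
qed



end
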